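(* Let $d\ge1$, let $G=(V,E)$ be a $d$-connected chordal graph with $|V|\ge d+2$, and let $E'$ be a set of pairs of non-adjacent vertices of $G$. Let $G^*={\rm tlc}_d(G)$. Then the following are equivalent: (i) $G+E'$ is globally rigid in $\mathbb{R}^d$; (ii) $G+E'$ is $(d+1)$-connected; (iii) no $Q\in\mathcal{Q}_{G^*}$ is a cut vertex of the multigraph $T_{G^*}+T_{G^*}\langle E'\rangle$.
   Context: A $d$-dimensional framework is a pair $(G,p)$ with $G=(V,E)$ a graph and $p:V\to\mathbb{R}^d$; it is generic if its $d|V|$ coordinates are algebraically independent over $\mathbb{Q}$. Frameworks $(G,p),(G,q)$ are equivalent if $\|p(u)-p(v)\|=\|q(u)-q(v)\|$ for all $uv\in E$, and congruent if this holds for all $u,v\in V$. $(G,p)$ is globally rigid if every equivalent $d$-dimensional framework is congruent to it; a graph is globally rigid in $\mathbb{R}^d$ if some (equivalently, every) generic realization in $\mathbb{R}^d$ is globally rigid. A vertex pair $\{u,v\}$ is weakly globally linked in $G$ in $\mathbb{R}^d$ if there is a generic realization $(G,p)$ in $\mathbb{R}^d$ such that every equivalent $d$-dimensional $(G,q)$ satisfies $\|q(u)-q(v)\|=\|p(u)-p(v)\|$; otherwise it is globally loose. $G$ is totally loose in $\mathbb{R}^d$ if every non-adjacent pair is globally loose in $G$. The totally loose closure ${\rm tlc}_d(G)$ is the unique minimal totally loose in $\mathbb{R}^d$ supergraph of $G$ on vertex set $V$; for a $d$-connected chordal $G$, ${\rm tlc}_d(G)$ is again a $d$-connected chordal graph.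 For a totally loose $d$-connected chordal graph $G^*$: $\mathcal{S}_{G^*}$ is the set of maximal cliques of $G^*$ and $\mathcal{Q}_{G^*}$ the set of $d$-separators (vertex sets of size $d$ whose removal disconnects $G^*$). The tree representation $T_{G^*}$ has node set $\mathcal{S}_{G^*}\cup\mathcal{Q}_{G^*}$, with $Q\in\mathcal{Q}_{G^*}$ adjacent to $S\in\mathcal{S}_{G^*}$ iff $Q\subseteq V(S)$; it is a tree. For a subgraph $T_0$ of $T_{G^*}$, $G^*[T_0]$ is the union of the subgraphs represented by the nodes of $T_0$. For non-adjacent $u,v$, let $P$ be the minimal path in $T_{G^*}$ with $u,v\in V(G^*[P])$, with end nodes $X,Y$; then $T_{G^*}\langle uv\rangle$ is the edge $XY$, and $T_{G^*}\langle E'\rangle=\{T_{G^*}\langle uv\rangle: uv\in E'\}$ (as a multiset). *)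

theory Defs
  imports "HOL-Analysis.Analysis"
begin

definition all_pairs :: "'a set \<Rightarrow> 'a set set" where
  "all_pairs V = {{u, v} | u v. u \<in> V \<and> v \<in> V \<and> u \<noteq> v}"

definition graph :: "'a set \<Rightarrow> 'a set set \<Rightarrow> bool" where
  "graph V E \<longleftrightarrow> finite V \<and> E \<subseteq> all_pairs V"

definition connected_on :: "'a set \<Rightarrow> 'a set set \<Rightarrow> bool" where
  "connected_on W E \<longleftrightarrow>
     (\<forall>u\<in>W. \<forall>v\<in>W. (\<lambda>x y. x \<in> W \<and> y \<in> W \<and> {x, y} \<in> E)\<^sup>*\<^sup>* u v)"

definition k_connected :: "nat \<Rightarrow> 'a set \<Rightarrow> 'a set set \<Rightarrow> bool" where
  "k_connected k V E \<longleftrightarrow> card V \<ge> k + 1 \<and>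
     (\<forall>S. S \<subseteq> V \<and> card S < k \<longrightarrow> connected_on (V - S) E)"

definition chordal :: "'a set \<Rightarrow> 'a set set \<Rightarrow> bool" where
  "chordal V E \<longleftrightarrow>
     (\<forall>cs. distinct cs \<and> set cs \<subseteq> V \<and> length cs \<ge> 4 \<and>
        (\<forall>i < length cs. {cs ! i, cs ! ((i + 1) mod length cs)} \<in> E) \<longrightarrow>
        (\<exists>i < length cs. \<exists>j < length cs. i \<noteq> j \<and>
            j \<noteq> (i + 1) mod length cs \<and> i \<noteq> (j + 1) mod length cs \<and>
            {cs ! i, cs ! j} \<in> E))"

definition clique :: "'a set \<Rightarrow> 'a set set \<Rightarrow> 'a set \<Rightarrow> bool" where
  "clique V E K \<longleftrightarrow> K \<subseteq> V \<and> (\<forall>u\<in>K. \<forall>v\<in>K. u \<noteq> v \<longrightarrow> {u, v} \<in> E)"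

definition maximal_cliques :: "'a set \<Rightarrow> 'a set set \<Rightarrow> 'a set set" where
  "maximal_cliques V E =
     {K. clique V E K \<and> (\<forall>K'. clique V E K' \<and> K \<subseteq> K' \<longrightarrow> K' = K)}"

definition separators :: "nat \<Rightarrow> 'a set \<Rightarrow> 'a set set \<Rightarrow> 'a set set" where
  "separators d V E = {Q. Q \<subseteq> V \<and> card Q = d \<and> \<not> connected_on (V - Q) E}"

text \<open>Algebraic independence over Q of the finite family x i, i in I:
no nonzero polynomial with rational coefficients in the variables I
vanishes at x.  A polynomial is a finitely supported map from monomials
(exponent vectors supported in I) to rational coefficients.\<close>
definition alg_indep :: "'i set \<Rightarrow> ('i \<Rightarrow> real) \<Rightarrow> bool" where
  "alg_indep I x \<longleftrightarrow>
     (\<forall>c :: ('i \<Rightarrow> nat) \<Rightarrow> rat.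
        finite {m. c m \<noteq> 0} \<and>
        (\<forall>m. c m \<noteq> 0 \<longrightarrow> (\<forall>i. i \<notin> I \<longrightarrow> m i = 0)) \<and>
        (\<Sum>m\<in>{m. c m \<noteq> 0}. of_rat (c m) * (\<Prod>i\<in>I. x i ^ m i)) = 0
        \<longrightarrow> (\<forall>m. c m = 0))"

definition generic :: "'a set \<Rightarrow> ('a \<Rightarrow> real ^ 'n) \<Rightarrow> bool" where
  "generic V p \<longleftrightarrow> alg_indep (V \<times> UNIV) (\<lambda>(v, i). p v $ i)"

definition equivalent_fw :: "'a set set \<Rightarrow> ('a \<Rightarrow> real ^ 'n) \<Rightarrow> ('a \<Rightarrow> real ^ 'n) \<Rightarrow> bool" where
  "equivalent_fw E p q \<longleftrightarrow>
     (\<forall>u v. {u, v} \<in> E \<longrightarrow> norm (p u - p v) = norm (q u - q v))"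

definition congruent_fw :: "'a set \<Rightarrow> ('a \<Rightarrow> real ^ 'n) \<Rightarrow> ('a \<Rightarrow> real ^ 'n) \<Rightarrow> bool" where
  "congruent_fw V p q \<longleftrightarrow>
     (\<forall>u\<in>V. \<forall>v\<in>V. norm (p u - p v) = norm (q u - q v))"

definition globally_rigid_fw :: "'a set \<Rightarrow> 'a set set \<Rightarrow> ('a \<Rightarrow> real ^ 'n) \<Rightarrow> bool" where
  "globally_rigid_fw V E p \<longleftrightarrow>
     (\<forall>q :: 'a \<Rightarrow> real ^ 'n. equivalent_fw E p q \<longrightarrow> congruent_fw V p q)"

definition globally_rigid :: "'n::finite itself \<Rightarrow> 'a set \<Rightarrow> 'a set set \<Rightarrow> bool" where
  "globally_rigid _ V E \<longleftrightarrow>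
     (\<exists>p :: 'a \<Rightarrow> real ^ 'n. generic V p \<and> globally_rigid_fw V E p)"

definition weakly_globally_linked :: "'n::finite itself \<Rightarrow> 'a set \<Rightarrow> 'a set set \<Rightarrow> 'a \<Rightarrow> 'a \<Rightarrow> bool" where
  "weakly_globally_linked _ V E u v \<longleftrightarrow>
     (\<exists>p :: 'a \<Rightarrow> real ^ 'n. generic V p \<and>
        (\<forall>q :: 'a \<Rightarrow> real ^ 'n. equivalent_fw E p q \<longrightarrow> norm (q u - q v) = norm (p u - p v)))"

definition totally_loose :: "'n::finite itself \<Rightarrow> 'a set \<Rightarrow> 'a set set \<Rightarrow> bool" where
  "totally_loose T V E \<longleftrightarrow>
     (\<forall>u\<in>V. \<forall>v\<in>V. u \<noteq> v \<and> {u, v} \<notin> E \<longrightarrow> \<not> weakly_globally_linked T V E u v)"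

definition tlc :: "'n::finite itself \<Rightarrow> 'a set \<Rightarrow> 'a set set \<Rightarrow> 'a set set" where
  "tlc T V E = (THE F. E \<subseteq> F \<and> F \<subseteq> all_pairs V \<and> totally_loose T V F \<and>
      (\<forall>F'. E \<subseteq> F' \<and> F' \<subseteq> all_pairs V \<and> totally_loose T V F' \<longrightarrow> F \<subseteq> F'))"

definition tnodes :: "nat \<Rightarrow> 'a set \<Rightarrow> 'a set set \<Rightarrow> ('a set + 'a set) set" where
  "tnodes d V E = Inl ` maximal_cliques V E \<union> Inr ` separators d V E"

definition nverts :: "'a set + 'a set \<Rightarrow> 'a set" where
  "nverts X = (case X of Inl S \<Rightarrow> S | Inr Q \<Rightarrow> Q)"

definition tadj :: "nat \<Rightarrow> 'a set \<Rightarrow> 'a set set \<Rightarrow> ('a set + 'a set) \<Rightarrow> ('a set + 'a set) \<Rightarrow> bool" where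
  "tadj d V E X Y \<longleftrightarrow> X \<in> tnodes d V E \<and> Y \<in> tnodes d V E \<and>
     ((\<exists>S Q. X = Inl S \<and> Y = Inr Q \<and> Q \<subseteq> S) \<or> (\<exists>S Q. X = Inr Q \<and> Y = Inl S \<and> Q \<subseteq> S))"

definition tpath :: "nat \<Rightarrow> 'a set \<Rightarrow> 'a set set \<Rightarrow> ('a set + 'a set) list \<Rightarrow> bool" where
  "tpath d V E P \<longleftrightarrow> P \<noteq> [] \<and> distinct P \<and> set P \<subseteq> tnodes d V E \<and>
     (\<forall>i. Suc i < length P \<longrightarrow> tadj d V E (P ! i) (P ! Suc i))"

definition covers :: "'a \<Rightarrow> 'a \<Rightarrow> ('a set + 'a set) list \<Rightarrow> bool" where
  "covers u v P \<longleftrightarrow> u \<in> \<Union> (nverts ` set P) \<and> v \<in> \<Union> (nverts ` set P)"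

definition min_tpath :: "nat \<Rightarrow> 'a set \<Rightarrow> 'a set set \<Rightarrow> 'a \<Rightarrow> 'a \<Rightarrow> ('a set + 'a set) list \<Rightarrow> bool" where
  "min_tpath d V E u v P \<longleftrightarrow> tpath d V E P \<and> covers u v P \<and>
     \<not> (\<exists>P'. tpath d V E P' \<and> covers u v P' \<and> set P' \<subset> set P)"

text \<open>Edges of T<E'>: X, Y are the end nodes of the minimal path for some uv in E'.
(Multiplicities are irrelevant for cut vertices.)\<close>
definition tedge :: "nat \<Rightarrow> 'a set \<Rightarrow> 'a set set \<Rightarrow> 'a set set \<Rightarrow> ('a set + 'a set) \<Rightarrow> ('a set + 'a set) \<Rightarrow> bool" where
  "tedge d V E E' X Y \<longleftrightarrow>
     (\<exists>u v P. {u, v} \<in> E' \<and> min_tpath d V E u v P \<and> hd P = X \<and> last P = Y)"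

definition cut_vertex :: "'b set \<Rightarrow> ('b \<Rightarrow> 'b \<Rightarrow> bool) \<Rightarrow> 'b \<Rightarrow> bool" where
  "cut_vertex N A x \<longleftrightarrow> x \<in> N \<and>
     (\<exists>a b. a \<in> N - {x} \<and> b \<in> N - {x} \<and>
        (\<lambda>y z. y \<in> N \<and> z \<in> N \<and> A y z)\<^sup>*\<^sup>* a b \<and>
        \<not> (\<lambda>y z. y \<in> N - {x} \<and> z \<in> N - {x} \<and> A y z)\<^sup>*\<^sup>* a b)"

definition tree_plus_adj :: "nat \<Rightarrow> 'a set \<Rightarrow> 'a set set \<Rightarrow> 'a set set \<Rightarrow> ('a set + 'a set) \<Rightarrow> ('a set + 'a set) \<Rightarrow> bool" where
  "tree_plus_adj d V E E' X Y \<longleftrightarrow> tadj d V E X Y \<or> tedge d V E E' X Y \<or> tedge d V E E' Y X"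

end

theory Submission
  imports Defs
begin

text \<open>Call two vertices of a d-connected chordal graph G linked if no d-set of vertices separates them.
  Building G up by simplicial vertices shows that equivalent realizations of G preserve the distances of
  linked pairs, while reflecting one side of a separating d-set in the hyperplane spanned by it changes
  the other distances. So the totally loose closure G* consists of the linked pairs, and a realization
  q equivalent to a generic p is given by one isometry on each maximal clique of G*, where the
  isometries of two cliques around a separator Q are equal or differ by the reflection in Q.

  If an additional edge xy keeps its length, then the product of the reflections along the tree path
  from x to y moves p y to a point with the same distance to p x. As the coordinates of p x and p y are
  transcendental over the field in which this product is defined, the product is the identity, and by
  the same genericity argument for a vertex of only the first separator no reflection occurs. Hence
  if every separator is crossed by an additional edge, all isometries agree.\<close>

section \<open>Algebraic independence\<close>

text \<open>Genericity enters in one form only: a linear equation for one coordinate, with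
  coefficients in the field of all remaining coordinates, is trivial. So every map built from
  \<open>p\<close> must have a controlled field of definition. This is why reflections are written
  as \<open>2P - 1\<close> with a rational orthogonal projection \<open>P\<close>, and why the
  isometries of cliques, whose coefficients depend on the arbitrary \<open>q\<close>, are only
  compared with each other: their quotients are products of reflections acting on \<open>p\<close>.
  The length condition for an edge xy is quadratic, but the square of \<open>p x\<close> cancels,
  which leaves a linear equation for \<open>p x\<close>. The product along a minimal path is defined
  without x and y because they occur only in its end nodes. Of the tree, the proof uses that the
  nodes containing a given vertex are joined through each other, and that each component of
  \<open>V - Q\<close> has exactly one maximal clique around the separator \<open>Q\<close>. The
  d-connectivity gives each added simplicial vertex at least d neighbours: exactly d of them
  separate it from the rest, more than d determine an isometry.\<close>

inductive_set fld :: "real set \<Rightarrow> real set" for X where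
  fld_base: "x \<in> X \<Longrightarrow> x \<in> fld X"
| fld_one: "1 \<in> fld X"
| fld_add: "a \<in> fld X \<Longrightarrow> b \<in> fld X \<Longrightarrow> a + b \<in> fld X"
| fld_minus: "a \<in> fld X \<Longrightarrow> - a \<in> fld X"
| fld_mult: "a \<in> fld X \<Longrightarrow> b \<in> fld X \<Longrightarrow> a * b \<in> fld X"
| fld_inverse: "a \<in> fld X \<Longrightarrow> inverse a \<in> fld X"

lemma fld_diff: "a \<in> fld X \<Longrightarrow> b \<in> fld X \<Longrightarrow> a - b \<in> fld X"
  using fld_add[of a X "- b"] fld_minus[of b X] by simp

lemma fld_zero: "0 \<in> fld X"
  using fld_diff[OF fld_one fld_one] by simp

lemma fld_divide: "a \<in> fld X \<Longrightarrow> b \<in> fld X \<Longrightarrow> a / b \<in> fld X"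
  by (simp add: divide_inverse fld_mult fld_inverse)

lemma fld_sum: "(\<And>i. i \<in> A \<Longrightarrow> f i \<in> fld X) \<Longrightarrow> sum f A \<in> fld X"
  by (induction A rule: infinite_finite_induct) (auto intro: fld_zero fld_add)

lemma fld_prod: "(\<And>i. i \<in> A \<Longrightarrow> f i \<in> fld X) \<Longrightarrow> prod f A \<in> fld X"
  by (induction A rule: infinite_finite_induct) (auto intro: fld_one fld_mult)

lemma fld_power: "a \<in> fld X \<Longrightarrow> a ^ n \<in> fld X"
  by (induction n) (auto intro: fld_one fld_mult)

lemma fld_of_nat: "of_nat n \<in> fld X"
  by (induction n) (auto intro: fld_zero fld_one fld_add)

lemma fld_of_int: "of_int n \<in> fld X"
  by (cases n rule: int_cases) (auto intro: fld_of_nat fld_minus fld_one fld_diff)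

lemma fld_of_rat: "of_rat r \<in> fld X"
proof (cases r)
  case (Fract a b)
  then show ?thesis
    by (simp add: of_rat_rat fld_divide fld_of_int)
qed

lemma fld_mono:
  assumes "X \<subseteq> Y" shows "fld X \<subseteq> fld Y"
proof
  fix x assume "x \<in> fld X"
  then show "x \<in> fld Y"
    by induction (use assms in \<open>auto intro: fld.intros\<close>)
qed

text \<open>The field is exhausted by the levels \<open>L n\<close>, each of which adds the results
  of one operation on the previous one. Countability leaves room for a real that is transcendental
  over the field.\<close>

lemma countable_fld:
  assumes "countable X" shows "countable (fld X)"
proof -
  define stp where "stp A = A \<union> (\<lambda>(a, b). a + b) ` (A \<times> A) \<union> uminus ` A
      \<union> (\<lambda>(a, b). a * b) ` (A \<times> A) \<union> inverse ` A" for A :: "real set"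
  define L where "L n = (stp ^^ n) (insert 1 X)" for n
  have cn: "countable (L n)" for n
    by (induction n) (auto simp: L_def stp_def assms)
  have up: "L n \<subseteq> L (Suc n)" for n
    by (auto simp: L_def stp_def)
  have mono: "L m \<subseteq> L n" if "m \<le> n" for m n
    using lift_Suc_mono_le[of L] up that by blast
  have "x \<in> (\<Union>n. L n)" if "x \<in> fld X" for x
    using that
  proof induction
    case (fld_base x)
    then show ?case by (auto simp: L_def intro!: exI[of _ 0])
  next
    case fld_one
    then show ?case by (auto simp: L_def intro!: exI[of _ 0])
  next
    case (fld_add a b)
    then obtain m n where "a \<in> L m" "b \<in> L n" by auto
    then have "a \<in> L (max m n)" "b \<in> L (max m n)"
      using mono by (meson max.cobounded1 max.cobounded2 subsetD)+
    then have "a + b \<in> L (Suc (max m n))"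
      by (auto simp: L_def stp_def)
    then show ?case by blast
  next
    case (fld_minus a)
    then obtain m where "a \<in> L m" by auto
    then have "- a \<in> L (Suc m)" by (auto simp: L_def stp_def)
    then show ?case by blast
  next
    case (fld_mult a b)
    then obtain m n where "a \<in> L m" "b \<in> L n" by auto
    then have "a \<in> L (max m n)" "b \<in> L (max m n)"
      using mono by (meson max.cobounded1 max.cobounded2 subsetD)+
    then have "a * b \<in> L (Suc (max m n))"
      by (auto simp: L_def stp_def)
    then show ?case by blast
  next
    case (fld_inverse a)
    then obtain m where "a \<in> L m" by auto
    then have "inverse a \<in> L (Suc m)" by (auto simp: L_def stp_def)
    then show ?case by blast
  qed
  then have "fld X \<subseteq> (\<Union>n. L n)" by blast
  moreover have "countable (\<Union>n. L n)" using cn by auto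
  ultimately show ?thesis by (rule countable_subset)
qed

section \<open>Existence of algebraically independent families\<close>

definition mon :: "'i set \<Rightarrow> ('i \<Rightarrow> real) \<Rightarrow> ('i \<Rightarrow> nat) \<Rightarrow> real" where
  "mon I x m = (\<Prod>i\<in>I. x i ^ m i)"

text \<open>Polynomials come up as sums over index sets other than their exponent vectors.
  Injectivity of \<open>f\<close> keeps distinct terms at distinct monomials, so no terms merge and
  the coefficients can be read off.\<close>

lemma alg_indep_inj:
  fixes f :: "'t \<Rightarrow> 'i \<Rightarrow> nat"
  assumes "alg_indep I x" "finite T" "inj_on f T"
    and supp: "\<And>t i. t \<in> T \<Longrightarrow> i \<notin> I \<Longrightarrow> f t i = 0"
    and zero: "(\<Sum>t\<in>T. of_rat (g t) * mon I x (f t)) = 0"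
    and "t \<in> T"
  shows "g t = 0"
proof -
  define c where "c m = (if m \<in> f ` T then g (the_inv_into T f m) else 0)" for m
  have cf: "c (f t) = g t" if "t \<in> T" for t
    using that assms(3) by (simp add: c_def the_inv_into_f_f)
  have sub: "{m. c m \<noteq> 0} \<subseteq> f ` T"
    by (auto simp: c_def split: if_splits)
  have fin: "finite {m. c m \<noteq> 0}"
    using sub assms(2) finite_surj by blast
  have "(\<Sum>m\<in>{m. c m \<noteq> 0}. of_rat (c m) * (\<Prod>i\<in>I. x i ^ m i)) =
        (\<Sum>m\<in>f ` T. of_rat (c m) * (\<Prod>i\<in>I. x i ^ m i))"
    using sub assms(2) by (intro sum.mono_neutral_left) auto
  also have "\<dots> = (\<Sum>t\<in>T. of_rat (g t) * mon I x (f t))"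
    using assms(3) by (simp add: sum.reindex cf mon_def)
  finally have "(\<Sum>m\<in>{m. c m \<noteq> 0}. of_rat (c m) * (\<Prod>i\<in>I. x i ^ m i)) = 0"
    using zero by simp
  moreover have "\<forall>m. c m \<noteq> 0 \<longrightarrow> (\<forall>i. i \<notin> I \<longrightarrow> m i = 0)"
  proof (intro allI impI)
    fix m i assume "c m \<noteq> 0" "i \<notin> I"
    then obtain t where "t \<in> T" "m = f t" using sub by auto
    then show "m i = 0" using supp \<open>i \<notin> I\<close> by simp
  qed
  ultimately have "c m = 0" for m
    using assms(1)[unfolded alg_indep_def, rule_format, of c m] fin by simp
  then show ?thesis using cf[OF assms(6)] by simp
qed

text \<open>Only countably many reals are roots of nonzero polynomials over the countable field
  \<open>F\<close>, and \<open>t\<close> is any other real. A relation in the enlarged family is a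
  polynomial in \<open>t\<close> over \<open>F\<close>, so each of its coefficients vanishes, and
  such a coefficient is a relation among the old values.\<close>

lemma alg_indep_insert:
  assumes fin: "finite I" and "k \<notin> I" and ind: "alg_indep I x"
  shows "\<exists>t. alg_indep (insert k I) (x(k := t))"
proof -
  define F where "F = fld (x ` I)"
  define P where "P = {q :: real poly. q \<noteq> 0 \<and> set (coeffs q) \<subseteq> F}"
  have "countable F"
    unfolding F_def using fin by (intro countable_fld countable_finite) auto
  then have "countable (lists F)" by (rule countable_lists)
  moreover have "P \<subseteq> Poly ` lists F"
  proof
    fix q assume "q \<in> P"
    then have "coeffs q \<in> lists F" by (auto simp: P_def)
    moreover have "q = Poly (coeffs q)" by simp
    ultimately show "q \<in> Poly ` lists F" by blast
  qed
  ultimately have "countable P"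
    using countable_subset[OF _ countable_image] by metis
  moreover have "countable {t. poly q t = 0}" if "q \<in> P" for q
    using that poly_roots_finite by (auto simp: P_def intro: countable_finite)
  ultimately have "countable (\<Union>q\<in>P. {t. poly q t = 0})"
    by (rule countable_UN)
  then have "(\<Union>q\<in>P. {t. poly q t = 0}) \<noteq> UNIV"
    using uncountable_UNIV_real by metis
  then obtain t where t: "\<And>q. q \<in> P \<Longrightarrow> poly q t \<noteq> 0"
    by blast
  have "c m0 = 0"
    if "finite {m. c m \<noteq> 0}"
      and supp: "\<forall>m. c m \<noteq> 0 \<longrightarrow> (\<forall>i. i \<notin> insert k I \<longrightarrow> m i = 0)"
      and zero: "(\<Sum>m\<in>{m. c m \<noteq> 0}. of_rat (c m) * (\<Prod>i\<in>insert k I. (x(k := t)) i ^ m i)) = 0"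
    for c :: "('a \<Rightarrow> nat) \<Rightarrow> rat" and m0
  proof (rule ccontr)
    assume c0: "c m0 \<noteq> 0"
    define A where "A = {m. c m \<noteq> 0}"
    have finA: "finite A" using that(1) by (simp add: A_def)
    \<comment> \<open>The relation read as a polynomial in the new variable: \<open>m k\<close> is
      the degree, the rest of the monomial goes into the coefficient.\<close>
    define q where "q = (\<Sum>m\<in>A. monom (of_rat (c m) * mon I x m) (m k))"
    have upd: "(\<Prod>i\<in>insert k I. (x(k := t)) i ^ m i) = mon I x m * t ^ m k" for m
    proof -
      have "(\<Prod>i\<in>I. (x(k := t)) i ^ m i) = mon I x m"
        unfolding mon_def using assms(2) by (intro prod.cong) auto
      then show ?thesis using assms by simp
    qed
    have "poly q t = 0"
      using zero unfolding upd by (simp add: q_def poly_sum poly_monom A_def mult.assoc)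
    moreover have cq: "coeff q n = (\<Sum>m\<in>{m\<in>A. m k = n}. of_rat (c m) * mon I x m)" for n
      using finA by (auto simp: q_def coeff_sum sum.inter_filter intro!: sum.cong)
    moreover have cF: "coeff q n \<in> F" for n
      unfolding cq F_def mon_def
      by (intro fld_sum fld_mult fld_of_rat fld_prod fld_power fld_base) auto
    moreover have "set (coeffs q) \<subseteq> F"
      unfolding coeffs_def using cF by auto
    ultimately have "q = 0"
      using t[of q] unfolding P_def by blast
    then have s0: "(\<Sum>m\<in>{m\<in>A. m k = m0 k}. of_rat (c m) * mon I x m) = 0"
      using cq[of "m0 k"] by simp
    have mm: "mon I x (m(k := 0)) = mon I x m" for m
      unfolding mon_def using assms(2) by (intro prod.cong) auto
    \<comment> \<open>Among monomials of the same degree in \<open>k\<close>, erasing that exponent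
      loses no information.\<close>
    have "inj_on (\<lambda>m. m(k := 0)) {m\<in>A. m k = m0 k}"
      by (intro inj_onI) (metis (mono_tags, lifting) fun_upd_triv fun_upd_upd mem_Collect_eq)
    then have "c m0 = 0"
      using supp finA s0 c0 
      by (intro alg_indep_inj[OF ind, of "{m\<in>A. m k = m0 k}" "\<lambda>m. m(k := 0)" c m0])
         (auto simp: mm A_def)
    then show False using c0 by simp
  qed
  then have "alg_indep (insert k I) (x(k := t))"
    unfolding alg_indep_def by blast
  then show ?thesis ..
qed

lemma alg_indep_empty: "alg_indep {} x"
  unfolding alg_indep_def
proof (intro allI impI, elim conjE)
  fix c :: "('a \<Rightarrow> nat) \<Rightarrow> rat" and m0
  assume supp: "\<forall>m. c m \<noteq> 0 \<longrightarrow> (\<forall>i. i \<notin> {} \<longrightarrow> m i = 0)"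
    and zero: "(\<Sum>m\<in>{m. c m \<noteq> 0}. of_rat (c m) * (\<Prod>i\<in>{}. x i ^ m i)) = 0"
  show "c m0 = 0"
  proof (rule ccontr)
    assume c0: "c m0 \<noteq> 0"
    have "m = m0" if "c m \<noteq> 0" for m
    proof
      show "m i = m0 i" for i
        using supp[rule_format, of m i] supp[rule_format, of m0 i] c0 that by simp
    qed
    then have "{m. c m \<noteq> 0} = {m0}" using c0 by blast
    then show False using zero c0 by simp
  qed
qed

lemma alg_indep_exists:
  assumes "finite I" shows "\<exists>x. alg_indep I x"
  using assms
proof (induction I rule: finite_induct)
  case empty
  show ?case by (rule exI, rule alg_indep_empty)
next
  case (insert k I)
  from insert(3) obtain x where x: "alg_indep I x" by (rule exE)
  from alg_indep_insert[OF insert(1,2) x] obtain t where "alg_indep (insert k I) (x(k := t))"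
    by (rule exE)
  then show ?case by (rule exI[of "alg_indep (insert k I)"])
qed

lemma generic_exists:
  fixes V :: "'a set"
  assumes "finite V" shows "\<exists>p :: 'a \<Rightarrow> real ^ 'n. generic V p"
proof -
  obtain x where x: "alg_indep (V \<times> (UNIV :: 'n set)) x"
    using alg_indep_exists[of "V \<times> (UNIV :: 'n set)"] assms by auto
  have "generic V (\<lambda>v. \<chi> i. x (v, i))"
    unfolding generic_def using x by (simp add: case_prod_beta')
  then show ?thesis by blast
qed

section \<open>Values of rational polynomials, their fractions, and relations of degree one\<close>

definition polys :: "'i set \<Rightarrow> ('i \<Rightarrow> real) \<Rightarrow> 'i set \<Rightarrow> real set" where
  "polys I x J = {r. \<exists>A c. finite A \<and> (\<forall>m\<in>A. \<forall>i. i \<notin> J \<longrightarrow> m i = 0) \<and>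
     r = (\<Sum>m\<in>A. of_rat (c m) * mon I x m)}"

lemma polysI:
  "finite A \<Longrightarrow> (\<And>m i. m \<in> A \<Longrightarrow> i \<notin> J \<Longrightarrow> m i = 0) \<Longrightarrow>
   (\<Sum>m\<in>A. of_rat (c m) * mon I x m) \<in> polys I x J"
  unfolding polys_def by blast

lemma polys_add:
  assumes "r \<in> polys I x J" "s \<in> polys I x J" shows "r + s \<in> polys I x J"
proof -
  obtain A c where A: "finite A" "\<forall>m\<in>A. \<forall>i. i \<notin> J \<longrightarrow> m i = 0"
    "r = (\<Sum>m\<in>A. of_rat (c m) * mon I x m)"
    using assms(1) unfolding polys_def by blast
  obtain B e where B: "finite B" "\<forall>m\<in>B. \<forall>i. i \<notin> J \<longrightarrow> m i = 0"
    "s = (\<Sum>m\<in>B. of_rat (e m) * mon I x m)"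
    using assms(2) unfolding polys_def by blast
  define c' where "c' m = (if m \<in> A then c m else 0)" for m
  define e' where "e' m = (if m \<in> B then e m else 0)" for m
  have "r = (\<Sum>m\<in>A\<union>B. of_rat (c' m) * mon I x m)"
    unfolding A(3) using A(1) B(1) by (intro sum.mono_neutral_cong_left) (auto simp: c'_def)
  moreover have "s = (\<Sum>m\<in>A\<union>B. of_rat (e' m) * mon I x m)"
    unfolding B(3) using A(1) B(1) by (intro sum.mono_neutral_cong_left) (auto simp: e'_def)
  ultimately have "r + s = (\<Sum>m\<in>A\<union>B. of_rat (c' m + e' m) * mon I x m)"
    by (simp add: sum.distrib of_rat_add distrib_right)
  then show ?thesis
    using polysI[of "A \<union> B" J "\<lambda>m. c' m + e' m" I x] A(1,2) B(1,2) by auto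
qed

lemma polys_sum:
  "(\<And>i. i \<in> T \<Longrightarrow> f i \<in> polys I x J) \<Longrightarrow> sum f T \<in> polys I x J"
proof (induction T rule: infinite_finite_induct)
  case (insert t T)
  then show ?case by (auto intro: polys_add)
qed (use polysI[of "{}"] in auto)

lemma mon_add: "mon I x (\<lambda>i. m i + n i) = mon I x m * mon I x n"
  by (simp add: mon_def power_add prod.distrib)

text \<open>Multiplying by a monomial shifts exponent vectors injectively, so no like terms have to
  be collected; general products are sums of such shifts.\<close>

lemma polys_term:
  assumes "s \<in> polys I x J" "\<forall>i. i \<notin> J \<longrightarrow> n i = 0"
  shows "of_rat a * mon I x n * s \<in> polys I x J"
proof -
  obtain B e where B: "finite B" "\<forall>m\<in>B. \<forall>i. i \<notin> J \<longrightarrow> m i = 0"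
    "s = (\<Sum>m\<in>B. of_rat (e m) * mon I x m)"
    using assms(1) unfolding polys_def by blast
  define f where "f m = (\<lambda>i. m i + n i)" for m
  have inj: "inj_on f B"
    by (auto simp: inj_on_def f_def fun_eq_iff)
  have "of_rat a * mon I x n * s = (\<Sum>m\<in>B. of_rat (a * e m) * mon I x (f m))"
    by (simp add: B(3) sum_distrib_left f_def mon_add of_rat_mult algebra_simps)
  also have "\<dots> = (\<Sum>m\<in>f ` B. of_rat (a * e (the_inv_into B f m)) * mon I x m)"
    using inj by (simp add: sum.reindex the_inv_into_f_f)
  finally have eq: "of_rat a * mon I x n * s = \<dots>" .
  show ?thesis unfolding eq
    using B assms(2) by (intro polysI) (auto simp: f_def)
qed

lemma polys_mult:
  assumes "r \<in> polys I x J" "s \<in> polys I x J" shows "r * s \<in> polys I x J"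
proof -
  obtain A c where A: "finite A" "\<forall>m\<in>A. \<forall>i. i \<notin> J \<longrightarrow> m i = 0"
    "r = (\<Sum>m\<in>A. of_rat (c m) * mon I x m)"
    using assms(1) unfolding polys_def by blast
  show ?thesis unfolding A(3) sum_distrib_right
    using A(2) assms(2) by (intro polys_sum polys_term) auto
qed

lemma polys_const: "of_rat a \<in> polys I x J"
  using polysI[of "{\<lambda>_. 0}" J "\<lambda>_. a" I x] by (simp add: mon_def)

lemma polys_minus: "r \<in> polys I x J \<Longrightarrow> - r \<in> polys I x J"
  using polys_mult[OF polys_const[of "-1"], of r] by (simp add: of_rat_minus)

lemma polys_var:
  assumes "finite I" "j \<in> I" "j \<in> J" shows "x j \<in> polys I x J"
proof -
  have "mon I x (\<lambda>i. if i = j then 1 else 0) = (\<Prod>i\<in>I. if i = j then x i else 1)"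
    unfolding mon_def by (intro prod.cong) auto
  also have "\<dots> = x j" using assms by (simp add: prod.delta)
  finally have "mon I x (\<lambda>i. if i = j then 1 else 0) = x j" .
  moreover have "(\<Sum>m\<in>{\<lambda>i. if i = j then 1 else 0}. of_rat 1 * mon I x m) \<in> polys I x J"
    using assms(3) by (intro polysI) auto
  ultimately show ?thesis by simp
qed

text \<open>Quotients of polynomial values are closed under the field operations. Clearing
  denominators then turns relations over the field into polynomial ones.\<close>

lemma fld_fraction:
  assumes "finite I" "J \<subseteq> I" "a \<in> fld (x ` J)"
  shows "\<exists>r\<in>polys I x J. \<exists>s\<in>polys I x J. s \<noteq> 0 \<and> a = r / s"
  using assms(3)
proof induction
  case (fld_base a)
  then obtain j where "j \<in> J" "a = x j" by blast
  then show ?case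
    using polys_var[OF assms(1), of j J x] polys_const[of 1 I x J] assms(2)
    by (intro bexI[of _ "x j"] bexI[of _ 1]) auto
next
  case fld_one
  show ?case using polys_const[of 1 I x J] by (auto intro!: bexI[of _ 1])
next
  case (fld_add a b)
  then obtain r s r' s' where "r \<in> polys I x J" "s \<in> polys I x J" "s \<noteq> 0" "a = r / s"
    "r' \<in> polys I x J" "s' \<in> polys I x J" "s' \<noteq> 0" "b = r' / s'" by blast
  then show ?case
    by (intro bexI[of _ "r * s' + r' * s"] bexI[of _ "s * s'"])
       (auto simp: field_simps intro: polys_mult polys_add)
next
  case (fld_minus a)
  then show ?case by (metis minus_divide_left polys_minus)
next
  case (fld_mult a b)
  then obtain r s r' s' where "r \<in> polys I x J" "s \<in> polys I x J" "s \<noteq> 0" "a = r / s"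
    "r' \<in> polys I x J" "s' \<in> polys I x J" "s' \<noteq> 0" "b = r' / s'" by blast
  then show ?case
    by (intro bexI[of _ "r * r'"] bexI[of _ "s * s'"]) (auto intro: polys_mult)
next
  case (fld_inverse a)
  then obtain r s where rs: "r \<in> polys I x J" "s \<in> polys I x J" "s \<noteq> 0" "a = r / s" by blast
  show ?case
  proof (cases "r = 0")
    \<comment> \<open>As \<open>inverse 0 = 0\<close>, the fraction \<open>0 / s\<close> also
      represents its own inverse.\<close>
    case True
    then show ?thesis
      using rs by (intro bexI[of _ r] bexI[of _ s]) auto
  next
    case False
    then show ?thesis using rs by (intro bexI[of _ s] bexI[of _ r]) auto
  qed
qed

text \<open>In \<open>a * x k - b = 0\<close> the monomials from \<open>a\<close> have exponent 1 at
  \<open>k\<close> and those from \<open>b\<close> exponent 0. They cannot cancel each other, so all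
  coefficients of \<open>a\<close> vanish.\<close>

lemma alg_indep_linear_polys:
  assumes "finite I" "alg_indep I x" "k \<in> I"
    and "a \<in> polys I x (I - {k})" "b \<in> polys I x (I - {k})" "a * x k = b"
  shows "a = 0"
proof -
  let ?J = "I - {k}"
  obtain A c where A: "finite A" "\<forall>m\<in>A. \<forall>i. i \<notin> ?J \<longrightarrow> m i = 0"
    "a = (\<Sum>m\<in>A. of_rat (c m) * mon I x m)"
    using assms(4) unfolding polys_def by blast
  obtain B e where B: "finite B" "\<forall>m\<in>B. \<forall>i. i \<notin> ?J \<longrightarrow> m i = 0"
    "b = (\<Sum>m\<in>B. of_rat (e m) * mon I x m)"
    using assms(5) unfolding polys_def by blast
  \<comment> \<open>A disjoint sum, since the same exponent vector may occur in both
    \<open>a\<close> and \<open>b\<close>.\<close>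
  define T where "T = A <+> B"
  define f where "f = case_sum (\<lambda>m. m(k := 1)) (\<lambda>m :: 'a \<Rightarrow> nat. m)"
  define g where "g = case_sum c (\<lambda>m. - e m)"
  have mk: "mon I x (m(k := 1)) = mon I x m * x k" if "m \<in> A" for m
  proof -
    have "m k = 0" using A(2) that by auto
    then show ?thesis unfolding mon_def
      using assms(1,3) by (subst (1 2) prod.remove[of _ k]) (auto intro!: prod.cong)
  qed
  have "(\<Sum>t\<in>T. of_rat (g t) * mon I x (f t)) =
      (\<Sum>m\<in>A. of_rat (c m) * (mon I x m * x k)) + (\<Sum>m\<in>B. of_rat (- e m) * mon I x m)"
    using A(1) B(1) by (simp add: T_def sum.Plus f_def g_def mk del: One_nat_def)
  also have "\<dots> = a * x k - b"
    by (simp add: A(3) B(3) sum_distrib_right of_rat_minus sum_negf mult.assoc)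
  finally have zero: "(\<Sum>t\<in>T. of_rat (g t) * mon I x (f t)) = 0"
    using assms(6) by simp
  have z: "m k = 0" if "m \<in> A \<union> B" for m using that A(2) B(2) by auto
  have "m = m'" if "m \<in> A" "m' \<in> A" "m(k := 1) = m'(k := 1)" for m m'
    using that z by (metis UnI1 fun_upd_triv fun_upd_upd)
  moreover have "m(k := 1) \<noteq> m'" if "m' \<in> B" for m m'
    using that z by (metis UnI2 fun_upd_same zero_neq_one)
  ultimately have "inj_on f T"
    by (auto simp: inj_on_def f_def T_def) metis
  moreover have "f t i = 0" if "t \<in> T" "i \<notin> I" for t i
    using that A(2) B(2) assms(3) by (auto simp: T_def f_def)
  ultimately have "g t = 0" if "t \<in> T" for t
    using alg_indep_inj[OF assms(2) _ _ _ zero] that A(1) B(1) by (simp add: T_def)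
  then have "c m = 0" if "m \<in> A" for m
    using that by (force simp: T_def g_def)
  then show ?thesis by (simp add: A(3))
qed

lemma alg_indep_linear:
  assumes "finite I" "alg_indep I x" "k \<in> I"
    and "a \<in> fld (x ` (I - {k}))" "b \<in> fld (x ` (I - {k}))" "a * x k = b"
  shows "a = 0"
proof -
  obtain r s where r: "r \<in> polys I x (I - {k})" "s \<in> polys I x (I - {k})" "s \<noteq> 0" "a = r / s"
    using fld_fraction[OF assms(1) _ assms(4)] by blast
  obtain r' s' where r': "r' \<in> polys I x (I - {k})" "s' \<in> polys I x (I - {k})" "s' \<noteq> 0" "b = r' / s'"
    using fld_fraction[OF assms(1) _ assms(5)] by blast
  have "r * s' * x k = r' * s"
    using assms(6) r r' by (simp add: field_simps)
  then have "r * s' = 0"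
    using alg_indep_linear_polys[OF assms(1-3), of "r * s'" "r' * s"] r r' polys_mult by blast
  then show ?thesis using r r' by simp
qed

section \<open>Chordal graphs\<close>

text \<open>The relation inside \<open>connected_on\<close>. It is polymorphic in the vertices so
  that it also describes walks between nodes of the tree.\<close>

definition reach :: "'a set \<Rightarrow> 'a set set \<Rightarrow> 'a \<Rightarrow> 'a \<Rightarrow> bool" where
  "reach W E = (\<lambda>x y. x \<in> W \<and> y \<in> W \<and> {x, y} \<in> E)\<^sup>*\<^sup>*"

lemma connected_on_reach: "connected_on W E \<longleftrightarrow> (\<forall>u\<in>W. \<forall>v\<in>W. reach W E u v)"
  by (simp add: connected_on_def reach_def)

lemma reach_refl [simp]: "reach W E x x"
  by (simp add: reach_def)

lemma reach_edge: "x \<in> W \<Longrightarrow> y \<in> W \<Longrightarrow> {x, y} \<in> E \<Longrightarrow> reach W E x y"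
  by (auto simp: reach_def)

lemma reach_trans: "reach W E x y \<Longrightarrow> reach W E y z \<Longrightarrow> reach W E x z"
  by (auto simp: reach_def)

lemma reach_sym: "reach W E x y \<Longrightarrow> reach W E y x"
  unfolding reach_def
  by (rule sympD[OF symp_rtranclp]) (auto simp: symp_def insert_commute)

lemma reach_induct [consumes 1, case_names refl step]:
  assumes "reach W E x y" and "P x"
    and "\<And>y z. reach W E x y \<Longrightarrow> y \<in> W \<Longrightarrow> z \<in> W \<Longrightarrow> {y, z} \<in> E \<Longrightarrow> P y \<Longrightarrow> P z"
  shows "P y"
  using assms unfolding reach_def
  by (induction rule: rtranclp_induct) blast+

lemma reach_mono:
  assumes "reach W E x y" "W \<subseteq> W'" "E \<subseteq> E'" shows "reach W' E' x y"
  using assms(1)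
proof (induction rule: reach_induct)
  case (step y z)
  then have "reach W' E' y z" using assms by (auto intro: reach_edge)
  then show ?case using step reach_trans by metis
qed simp

lemma reach_closed:
  assumes "reach W E x y" "x \<in> D"
    and "\<And>a b. a \<in> D \<Longrightarrow> a \<in> W \<Longrightarrow> b \<in> W \<Longrightarrow> {a, b} \<in> E \<Longrightarrow> b \<in> D"
  shows "y \<in> D"
  using assms(1) by (induction rule: reach_induct) (use assms in auto)

lemma reach_mem: "reach W E x y \<Longrightarrow> x \<in> W \<Longrightarrow> y \<in> W"
  by (erule reach_closed) auto

lemma reach_list:
  assumes "reach W E x y" "x \<in> W"
  shows "\<exists>xs. xs \<noteq> [] \<and> hd xs = x \<and> last xs = y \<and> set xs \<subseteq> W
    \<and> successively (\<lambda>a b. {a, b} \<in> E) xs"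
  using assms(1)
proof (induction rule: reach_induct)
  case refl
  show ?case using assms(2) by (intro exI[of _ "[x]"]) auto
next
  case (step y z)
  then obtain xs where "xs \<noteq> []" "hd xs = x" "last xs = y" "set xs \<subseteq> W"
    "successively (\<lambda>a b. {a, b} \<in> E) xs" by blast
  then show ?case using step
    by (intro exI[of _ "xs @ [z]"]) (auto simp: successively_append_iff)
qed

section \<open>Neighbourhoods, induced paths and simplicial vertices\<close>

definition nb :: "'a set \<Rightarrow> 'a set set \<Rightarrow> 'a \<Rightarrow> 'a set" where
  "nb V E v = {w \<in> V. {v, w} \<in> E}"

text \<open>Inductions delete vertices from \<open>V\<close> and keep \<open>E\<close> fixed, so
  \<open>E\<close> does not remain a set of pairs in \<open>V\<close>; absence of loops
  survives.\<close>

definition loopfree :: "'a set set \<Rightarrow> bool" where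
  "loopfree E \<longleftrightarrow> (\<forall>x. {x} \<notin> E)"

lemma loopfreeD: "loopfree E \<Longrightarrow> {x, y} \<in> E \<Longrightarrow> x \<noteq> y"
  by (auto simp: loopfree_def)

lemma chordal_subset: "chordal V E \<Longrightarrow> W \<subseteq> V \<Longrightarrow> chordal W E"
  unfolding chordal_def by (meson subset_trans)

text \<open>A walk of least length is an induced path, since a chord or a repeated vertex would
  allow part of it to be cut out.\<close>

lemma shortest_path:
  assumes "reach W E s s'" "s \<in> W"
  obtains xs where "xs \<noteq> []" "hd xs = s" "last xs = s'" "set xs \<subseteq> W"
    "successively (\<lambda>a b. {a, b} \<in> E) xs" "distinct xs"
    "\<And>i j. Suc i < j \<Longrightarrow> j < length xs \<Longrightarrow> {xs ! i, xs ! j} \<notin> E"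
proof -
  define path where "path xs \<longleftrightarrow> xs \<noteq> [] \<and> hd xs = s \<and> last xs = s' \<and> set xs \<subseteq> W
    \<and> successively (\<lambda>a b. {a, b} \<in> E) xs" for xs
  have "\<exists>xs. path xs" using reach_list[OF assms] by (simp add: path_def)
  then obtain xs where xs: "path xs" and least: "\<And>ys. path ys \<Longrightarrow> length xs \<le> length ys"
    using ex_has_least_nat[of path _ length] by metis
  have td: "successively (\<lambda>a b. {a, b} \<in> E) (take i xs)"
    "successively (\<lambda>a b. {a, b} \<in> E) (drop i xs)" for i
    using xs successively_append_iff[of _ "take i xs" "drop i xs"] by (auto simp: path_def)
  have last_take: "last (take i xs) = xs ! (i - 1)" if "0 < i" "i \<le> length xs" for i
    using that by (cases i) (simp_all add: take_Suc_conv_app_nth)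
  have short: "{xs ! i, xs ! j} \<notin> E" if "Suc i < j" "j < length xs" for i j
  proof
    assume e: "{xs ! i, xs ! j} \<in> E"
    have "path (take (Suc i) xs @ drop j xs)"
      using xs that e td[of "Suc i"] td[of j]
      by (auto simp: path_def successively_append_iff hd_append last_take hd_drop_conv_nth
          dest: in_set_takeD in_set_dropD)
    from least[OF this] show False using that by simp
  qed
  have "xs ! i \<noteq> xs ! j" if "i < j" "j < length xs" for i j
  proof
    assume e: "xs ! i = xs ! j"
    have c: "i = 0 \<or> {xs ! (i - 1), xs ! i} \<in> E"
      using xs that by (cases i) (auto simp: path_def successively_conv_nth)
    then have l: "i = 0 \<or> {last (take i xs), xs ! j} \<in> E"
      using e last_take[of i] that by (cases "i = 0") simp_all
    \<comment> \<open>For \<open>i = 0\<close> the prefix is empty and the shortened walk starts at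
      \<open>xs ! j\<close>, which equals \<open>xs ! 0\<close>.\<close>
    have "hd (take i xs @ drop j xs) = s"
    proof (cases "i = 0")
      case True
      then show ?thesis using xs that e hd_conv_nth[of xs] by (simp add: path_def hd_drop_conv_nth)
    next
      case False
      then show ?thesis using xs by (simp add: path_def hd_append)
    qed
    then have "path (take i xs @ drop j xs)"
      using xs that l td[of i] td[of j]
      by (auto simp: path_def successively_append_iff hd_drop_conv_nth
          dest: in_set_takeD in_set_dropD)
    from least[OF this] show False using that by simp
  qed
  then have "distinct xs"
    unfolding distinct_conv_nth by (metis nat_neq_iff)
  with xs short that show ?thesis by (auto simp: path_def)
qed

text \<open>A shortest path from \<open>s\<close> to \<open>s'\<close> with inner vertices in
  \<open>X\<close>, closed up by \<open>y\<close>, has no chord: the path is induced and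
  \<open>y\<close> has no neighbour in \<open>X\<close>. If \<open>s\<close> and \<open>s'\<close>
  are not adjacent, the path has an inner vertex and the cycle has length at least 4.\<close>

lemma chordal_square:
  assumes "chordal V E" "loopfree E" "X \<subseteq> V" "connected_on X E"
    and in_V: "s \<in> V" "s' \<in> V" "y \<in> V" and notin_X: "s \<notin> X" "s' \<notin> X" "y \<notin> X" and "s \<noteq> s'"
    and ys: "{y, s} \<in> E" "{y, s'} \<in> E"
    and a: "a \<in> X" "{s, a} \<in> E" and a': "a' \<in> X" "{s', a'} \<in> E"
    and yX: "\<And>x. x \<in> X \<Longrightarrow> {y, x} \<notin> E"
  shows "{s, s'} \<in> E"
proof (rule ccontr)
  assume nadj: "{s, s'} \<notin> E"
  let ?W = "X \<union> {s, s'}"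
  have "reach X E a a'" using assms(4) a a' by (auto simp: connected_on_reach)
  then have "reach ?W E a a'" by (rule reach_mono) auto
  moreover have "reach ?W E s a" using a by (auto intro: reach_edge)
  moreover have "reach ?W E a' s'" using a' by (auto intro: reach_edge simp: insert_commute)
  ultimately have "reach ?W E s s'" by (meson reach_trans)
  then obtain xs where xs: "xs \<noteq> []" "hd xs = s" "last xs = s'" "set xs \<subseteq> ?W"
    "successively (\<lambda>a b. {a, b} \<in> E) xs" "distinct xs"
    and short: "\<And>i j. Suc i < j \<Longrightarrow> j < length xs \<Longrightarrow> {xs ! i, xs ! j} \<notin> E"
    using shortest_path[of ?W E s s'] by auto
  define n where "n = length xs"
  have s0: "xs ! 0 = s" and sn: "xs ! (n - 1) = s'"
    using xs by (simp_all add: n_def hd_conv_nth last_conv_nth)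
  have edge: "{xs ! i, xs ! Suc i} \<in> E" if "Suc i < n" for i
    using xs(5) that by (auto simp: successively_conv_nth n_def)
  have "n > 0" using xs by (simp add: n_def)
  moreover have "n \<noteq> 1" using s0 sn assms(11) by auto
  moreover have "n \<noteq> 2" using s0 sn edge[of 0] nadj by auto
  ultimately have n3: "n \<ge> 3" by linarith
  have inner: "xs ! i \<in> X" if "0 < i" "i < n - 1" for i
  proof -
    have "i < length xs" "length xs - 1 < length xs" "xs \<noteq> []" using that xs(1) by (auto simp: n_def)
    have "xs ! i \<noteq> xs ! 0" "xs ! i \<noteq> xs ! (n - 1)"
      using that \<open>i < length xs\<close> \<open>xs \<noteq> []\<close> nth_eq_iff_index_eq[OF xs(6), of i 0] nth_eq_iff_index_eq[OF xs(6), of i "n - 1"]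
      by (auto simp: n_def dest: order.strict_trans)
    moreover have "xs ! i \<in> ?W" using xs(4) nth_mem[OF \<open>i < length xs\<close>] by blast
    ultimately show ?thesis using s0 sn by auto
  qed
  define cs where "cs = y # xs"
  have len: "length cs = Suc n" by (simp add: cs_def n_def)
  have "y \<noteq> s" "y \<noteq> s'" using ys loopfreeD[OF assms(2)] by blast+
  then have "distinct cs" using xs notin_X by (auto simp: cs_def)
  moreover have "set cs \<subseteq> V" using xs in_V assms(3) by (auto simp: cs_def)
  moreover have "{cs ! i, cs ! ((i + 1) mod length cs)} \<in> E" if i: "i < length cs" for i
  proof -
    consider "i = 0" | "i = n" | "0 < i" "i < n" using i len by linarith
    then show ?thesis
    proof cases
      case 1
      then show ?thesis using ys s0 n3 len by (simp add: cs_def)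
    next
      case 2
      then show ?thesis using ys sn n3 len by (simp add: cs_def nth_Cons' insert_commute)
    next
      case 3
      then show ?thesis using edge[of "i - 1"] len by (simp add: cs_def nth_Cons')
    qed
  qed
  moreover have "4 \<le> length cs" using len n3 by simp
  ultimately obtain i j where ij: "i < length cs" "j < length cs" "i \<noteq> j"
    "j \<noteq> (i + 1) mod length cs" "i \<noteq> (j + 1) mod length cs" "{cs ! i, cs ! j} \<in> E"
    using assms(1)[unfolded chordal_def, THEN spec[of _ cs]] by blast
  have nochord: "{cs ! i, cs ! j} \<notin> E" if "i < j" "j < Suc n" "j \<noteq> (i + 1) mod Suc n"
    "i \<noteq> (j + 1) mod Suc n" for i j
  proof (cases "i = 0")
    case True
    then have "j \<noteq> 1" "j \<noteq> n" using that by auto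
    then have "xs ! (j - 1) \<in> X" using inner[of "j - 1"] that True by auto
    then show ?thesis using yX True that by (simp add: cs_def nth_Cons')
  next
    case False
    then have "Suc (i - 1) < j - 1" "j - 1 < n" using that by auto
    then show ?thesis using short[of "i - 1" "j - 1"] False that
      by (simp add: cs_def nth_Cons' n_def)
  qed
  show False
  proof (cases "i < j")
    case True
    then show ?thesis using nochord[of i j] ij len by auto
  next
    case False
    then show ?thesis using nochord[of j i] ij len by (auto simp: insert_commute)
  qed
qed

lemma connected_on_insert:
  assumes "connected_on X E" "a \<in> X" "{s, a} \<in> E"
  shows "connected_on (insert s X) E"
proof -
  let ?W = "insert s X"
  have 1: "reach ?W E a u" if "u \<in> ?W" for u
  proof (cases "u = s")
    case True
    then show ?thesis using assms by (auto intro!: reach_edge simp: insert_commute)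
  next
    case False
    then have "reach X E a u" using assms that by (auto simp: connected_on_reach)
    then show ?thesis by (rule reach_mono) auto
  qed
  then show ?thesis
    unfolding connected_on_reach by (meson reach_sym reach_trans)
qed

text \<open>Take a maximal connected set X whose closed neighbourhood is not everything, and let Y be
  the complement of that neighbourhood. By maximality every neighbour of X is adjacent to all of Y,
  so chordality makes the neighbours of X a clique, and a simplicial vertex of Y remains simplicial.\<close>

lemma chordal_simplicial:
  assumes "finite V" "V \<noteq> {}" "chordal V E" "loopfree E"
  shows "\<exists>v\<in>V. clique V E (nb V E v)"
  using assms
proof (induction V rule: finite_psubset_induct)
  case (psubset V)
  show ?case
  proof (cases "\<forall>a\<in>V. \<forall>b\<in>V. a \<noteq> b \<longrightarrow> {a, b} \<in> E")
    case True
    then show ?thesis using psubset.prems(1) by (force simp: clique_def nb_def)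
  next
    case False
    then obtain a b where ab: "a \<in> V" "b \<in> V" "a \<noteq> b" "{a, b} \<notin> E" by blast
    define far where "far X = {y \<in> V. y \<notin> X \<and> (\<forall>x\<in>X. {y, x} \<notin> E)}" for X
    define good where "good X \<longleftrightarrow> X \<subseteq> V \<and> X \<noteq> {} \<and> connected_on X E \<and> far X \<noteq> {}" for X
    have "good {a}" using ab by (auto simp: good_def far_def connected_on_reach insert_commute)
    moreover have "\<forall>X. good X \<longrightarrow> card X < Suc (card V)"
      using psubset.hyps by (auto simp: good_def less_Suc_eq_le card_mono)
    ultimately obtain X where X: "good X" and maxX: "\<And>X'. good X' \<Longrightarrow> card X' \<le> card X"
      using ex_has_greatest_nat[of good "{a}" card] by blast
    have finX: "finite X" using X psubset.hyps by (auto simp: good_def intro: finite_subset)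
    have full: "{s, y} \<in> E" if sy: "s \<in> V" "s \<notin> X" "s \<notin> far X" "y \<in> far X" for s y
    proof (rule ccontr)
      assume n: "{s, y} \<notin> E"
      obtain x where "x \<in> X" "{s, x} \<in> E" using sy by (auto simp: far_def)
      then have "good (insert s X)"
        using X sy n connected_on_insert[of X E x s]
        by (auto simp: good_def far_def insert_commute)
      from maxX[OF this] show False using sy finX by simp
    qed
    have "far X \<subset> V" using X by (auto simp: good_def far_def)
    moreover have "far X \<noteq> {}" using X by (simp add: good_def)
    ultimately obtain v where v: "v \<in> far X" "clique (far X) E (nb (far X) E v)"
      using psubset.IH[of "far X"] chordal_subset[OF psubset.prems(2)] assms(4) by blast
    have "{z, z'} \<in> E" if z: "z \<in> nb V E v" and z': "z' \<in> nb V E v" and "z \<noteq> z'" for z z'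
    proof -
      have notX: "z \<notin> X" "z' \<notin> X" using z z' v(1) by (auto simp: nb_def far_def)
      have inV: "z \<in> V" "z' \<in> V" "{v, z} \<in> E" "{v, z'} \<in> E" using z z' by (auto simp: nb_def)
      consider "z \<in> far X" "z' \<in> far X" | "z \<in> far X" "z' \<notin> far X" | "z \<notin> far X" "z' \<in> far X"
        | "z \<notin> far X" "z' \<notin> far X" by blast
      then show ?thesis
      proof cases
        case 1
        then show ?thesis using v(2) inV that by (auto simp: clique_def nb_def)
      next
        case 2
        then show ?thesis using full[of z' z] notX inV by (simp add: insert_commute)
      next
        case 3
        then show ?thesis using full[of z z'] notX inV by simp
      next
        case 4
        then obtain x x' where x: "x \<in> X" "{z, x} \<in> E" "x' \<in> X" "{z', x'} \<in> E"
          using notX inV by (auto simp: far_def)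
        show ?thesis
          using chordal_square[OF psubset.prems(2) assms(4), of X z z' v x x'] X v(1) x notX inV that
          by (auto simp: good_def far_def)
      qed
    qed
    then have "clique V E (nb V E v)" by (auto simp: clique_def nb_def)
    then show ?thesis using v(1) by (auto simp: far_def)
  qed
qed

text \<open>The vertices before and after a visit to \<open>v\<close> are neighbours of
  \<open>v\<close>, hence equal or adjacent, and the visit can be skipped.\<close>

lemma simplicial_reach:
  assumes "clique V E (nb V E v)" "loopfree E" "W \<subseteq> V" "reach W E x y" "x \<noteq> v" "y \<noteq> v"
  shows "reach (W - {v}) E x y"
proof -
  \<comment> \<open>While the walk stands at \<open>v\<close>, the claim says that every possible
    next vertex is already reachable without \<open>v\<close>.\<close>
  have "(y \<noteq> v \<longrightarrow> reach (W - {v}) E x y) \<and>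
    (y = v \<longrightarrow> (\<forall>w\<in>W \<inter> nb V E v. reach (W - {v}) E x w))"
    using assms(4)
  proof (induction rule: reach_induct)
    case refl
    then show ?case using assms(5) by simp
  next
    case (step y z)
    have yz: "y \<noteq> z" using step(4) assms(2) loopfreeD by metis
    show ?case
    proof (cases "z = v")
      case True
      have "reach (W - {v}) E x w" if w: "w \<in> W \<inter> nb V E v" for w
      proof -
        have "y \<in> nb V E v"
          using step True assms(3) by (auto simp: nb_def insert_commute)
        then have "y = w \<or> {y, w} \<in> E" using w assms(1) by (auto simp: clique_def)
        moreover have "w \<noteq> v" using w assms(2) by (auto simp: nb_def dest: loopfreeD)
        ultimately have "reach (W - {v}) E y w"
          using w step yz True by (auto intro: reach_edge)
        moreover have "reach (W - {v}) E x y" using step yz True by blast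
        ultimately show ?thesis using reach_trans by metis
      qed
      then show ?thesis using True by blast
    next
      case False
      show ?thesis
      proof (cases "y = v")
        case True
        then have "z \<in> W \<inter> nb V E v" using step assms(3) by (auto simp: nb_def)
        then show ?thesis using step True False by blast
      next
        case 2: False
        then have "reach (W - {v}) E y z" using step False by (auto intro: reach_edge)
        moreover have "reach (W - {v}) E x y" using step 2 by blast
        ultimately show ?thesis using False reach_trans by metis
      qed
    qed
  qed
  then show ?thesis using assms(6) by blast
qed

lemma reach_isolated:
  assumes "reach (V - Q) E v y" "nb V E v \<subseteq> Q" shows "y = v"
proof -
  have "y \<in> {v}"
    using assms(1) by (rule reach_closed) (use assms(2) in \<open>auto simp: nb_def\<close>)
  then show ?thesis by simp
qed

text \<open>With fewer than \<open>d\<close> neighbours, \<open>v\<close> would be cut off by them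
  from some other vertex, which exists because \<open>V\<close> has at least \<open>d + 2\<close>
  elements. Connectivity survives the deletion because walks bypass \<open>v\<close>.\<close>

lemma simplicial_remove:
  assumes "finite V" "k_connected d V E" "loopfree E" "v \<in> V" "clique V E (nb V E v)"
    and "card V \<ge> d + 2"
  shows "k_connected d (V - {v}) E" "card (nb V E v) \<ge> d"
proof -
  have "connected_on (V - {v} - S) E" if S: "S \<subseteq> V - {v}" "card S < d" for S
  proof -
    have "reach (V - {v} - S) E x y" if "x \<in> V - {v} - S" "y \<in> V - {v} - S" for x y
    proof -
      have "reach (V - S) E x y"
        using assms(2) S that by (auto simp: k_connected_def connected_on_reach)
      moreover have "V - S - {v} = V - {v} - S" by blast
      ultimately show ?thesis
        using simplicial_reach[OF assms(5,3), of "V - S" x y] that by auto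
    qed
    then show ?thesis by (simp add: connected_on_reach)
  qed
  then show "k_connected d (V - {v}) E"
    using assms(1,4,6) by (auto simp: k_connected_def)
  show "card (nb V E v) \<ge> d"
  proof (rule ccontr)
    let ?N = "nb V E v"
    assume n: "\<not> d \<le> card ?N"
    have "?N \<subseteq> V" by (auto simp: nb_def)
    then have c: "connected_on (V - ?N) E" using n assms(2) by (auto simp: k_connected_def)
    have "card (insert v ?N) < card V"
      using n assms(6) finite_subset[OF \<open>?N \<subseteq> V\<close> assms(1)] by (simp add: card_insert_if)
    moreover have "insert v ?N \<subseteq> V" using \<open>?N \<subseteq> V\<close> assms(4) by auto
    ultimately obtain y where y: "y \<in> V" "y \<notin> insert v ?N"
      by (metis less_irrefl subsetI subset_antisym)
    have "v \<notin> ?N" using assms(3) by (auto simp: nb_def loopfree_def)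
    then have "reach (V - ?N) E v y" using c y assms(4) by (auto simp: connected_on_reach)
    then show False using y reach_isolated by fastforce
  qed
qed

text \<open>A non-adjacent pair would be disconnected by removing the other \<open>d - 1\<close>
  vertices.\<close>

lemma k_connected_complete:
  assumes "finite V" "k_connected d V E" "card V = d + 1"
  shows "clique V E V"
proof -
  have "{x, y} \<in> E" if xy: "x \<in> V" "y \<in> V" "x \<noteq> y" for x y
  proof (rule ccontr)
    assume n: "{x, y} \<notin> E"
    have "card {x, y} \<le> card V" using xy assms(1) by (intro card_mono) auto
    then have "card (V - {x, y}) < d" using xy assms(1,3) by (simp add: card_Diff_subset)
    moreover have "V - (V - {x, y}) = {x, y}" using xy by blast
    ultimately have "reach {x, y} E x y"
      using assms(2) by (auto simp: k_connected_def connected_on_reach dest: spec[of _ "V - {x, y}"])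
    then have "y \<in> {x}" by (rule reach_closed) (use n in auto)
    then show False using xy by simp
  qed
  then show ?thesis by (simp add: clique_def)
qed

lemma nb_insert: "loopfree E \<Longrightarrow> nb (insert v V) E v = nb V E v"
  by (auto simp: nb_def loopfree_def)

text \<open>Deleting simplicial vertices one at a time keeps the graph chordal and d-connected until
  \<open>d + 1\<close> vertices are left, which form a clique. Read backwards, each new vertex is
  glued to a clique of at least \<open>d\<close> old ones.\<close>

lemma chordal_connected_induct [consumes 4, case_names complete simplicial]:
  assumes "finite V" "chordal V E" "loopfree E" "k_connected d V E"
    and complete: "\<And>V. finite V \<Longrightarrow> card V = d + 1 \<Longrightarrow> clique V E V \<Longrightarrow> P V"
    and simplicial: "\<And>V v. finite V \<Longrightarrow> v \<notin> V \<Longrightarrow> clique (insert v V) E (nb V E v) \<Longrightarrow>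
      d \<le> card (nb V E v) \<Longrightarrow> k_connected d V E \<Longrightarrow> P V \<Longrightarrow> P (insert v V)"
  shows "P V"
  using assms(1,2,4)
proof (induction V rule: finite_psubset_induct)
  case (psubset V)
  show ?case
  proof (cases "card V = d + 1")
    case True
    then show ?thesis using complete k_connected_complete psubset by blast
  next
    case False
    then have cV: "card V \<ge> d + 2" using psubset.prems by (auto simp: k_connected_def)
    then have "V \<noteq> {}" by auto
    then obtain v where v: "v \<in> V" "clique V E (nb V E v)"
      using chordal_simplicial[of V E] psubset assms(3) by blast
    define V' where "V' = V - {v}"
    have V: "V = insert v V'" "v \<notin> V'" using v by (auto simp: V'_def)
    have nbe: "nb V E v = nb V' E v" using V nb_insert[OF assms(3)] by metis
    have k: "k_connected d V' E" "card (nb V E v) \<ge> d"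
      using simplicial_remove[OF psubset.hyps psubset.prems(2) assms(3) v cV] by (simp_all add: V'_def)
    have "V' \<subset> V" using V by blast
    then have "P V'" using psubset.IH[of V'] k chordal_subset[OF psubset.prems(1)] by auto
    then show ?thesis
      using simplicial[of V' v] V k v nbe psubset.hyps by (metis finite_insert)
  qed
qed

section \<open>Linked pairs (\<open>ns\<close>: not separated), and separators under the addition of
  a simplicial vertex\<close>

definition ns :: "nat \<Rightarrow> 'a set \<Rightarrow> 'a set set \<Rightarrow> 'a \<Rightarrow> 'a \<Rightarrow> bool" where
  "ns d V E x y \<longleftrightarrow>
    (\<forall>Q. Q \<subseteq> V \<and> card Q = d \<and> x \<notin> Q \<and> y \<notin> Q \<longrightarrow> reach (V - Q) E x y)"

lemma ns_sym: "ns d V E x y \<Longrightarrow> ns d V E y x"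
  unfolding ns_def using reach_sym by metis

lemma ns_edge: "x \<in> V \<Longrightarrow> y \<in> V \<Longrightarrow> {x, y} \<in> E \<Longrightarrow> ns d V E x y"
  unfolding ns_def by (auto intro: reach_edge)

context
  fixes V :: "'a set" and E v d
  assumes finV: "finite V" and vV: "v \<notin> V" and lf: "loopfree E"
    and cl: "clique (insert v V) E (nb V E v)" and d1: "d \<ge> 1"
    and cn: "d \<le> card (nb V E v)" and kc: "k_connected d V E"
begin

lemma step_reach: "reach (insert v V - Q) E x y \<Longrightarrow> x \<noteq> v \<Longrightarrow> y \<noteq> v \<Longrightarrow> reach (V - Q) E x y"
  using simplicial_reach[of "insert v V" E v "insert v V - Q" x y] cl lf vV
    reach_mono[of "insert v V - Q - {v}" E x y "V - Q" E]
  by (auto simp: nb_insert)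

text \<open>Apart from \<open>v\<close>, such a set has only \<open>d - 1\<close> vertices, too few
  to disconnect \<open>V\<close>. So only d-sets inside \<open>V\<close> can separate.\<close>

lemma step_connected: 
  assumes "Q \<subseteq> insert v V" "card Q = d" "v \<in> Q"
  shows "connected_on (insert v V - Q) E"
proof -
  have "finite Q" using assms finV finite_subset by blast
  then have "card (Q - {v}) < d" using assms d1 by simp
  moreover have "V - (Q - {v}) = insert v V - Q" using assms vV by blast
  ultimately show ?thesis using kc assms by (auto simp: k_connected_def dest: spec[of _ "Q - {v}"])
qed

text \<open>No d-set through \<open>v\<close> separates, and for the others walks through the
  simplicial \<open>v\<close> can be bypassed.\<close>

lemma ns_step:
  assumes "x \<in> V" "y \<in> V" shows "ns d (insert v V) E x y \<longleftrightarrow> ns d V E x y"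
proof
  assume l: "ns d (insert v V) E x y"
  show "ns d V E x y"
    unfolding ns_def
  proof (intro allI impI)
    fix Q assume Q: "Q \<subseteq> V \<and> card Q = d \<and> x \<notin> Q \<and> y \<notin> Q"
    then have "reach (insert v V - Q) E x y" using l by (auto simp: ns_def)
    then show "reach (V - Q) E x y" using step_reach assms vV by metis
  qed
next
  assume r: "ns d V E x y"
  show "ns d (insert v V) E x y"
    unfolding ns_def
  proof (intro allI impI)
    fix Q assume Q: "Q \<subseteq> insert v V \<and> card Q = d \<and> x \<notin> Q \<and> y \<notin> Q"
    show "reach (insert v V - Q) E x y"
    proof (cases "v \<in> Q")
      case True
      then show ?thesis using step_connected[of Q] Q assms by (auto simp: connected_on_reach)
    next
      case False
      then have "reach (V - Q) E x y" using r Q by (auto simp: ns_def)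
      then show ?thesis by (rule reach_mono) auto
    qed
  qed
qed

text \<open>Off a d-set inside \<open>V\<close> that misses \<open>z\<close>, the vertex
  \<open>v\<close> stays available as a way from \<open>z\<close> to \<open>y\<close>; afterwards
  \<open>v\<close> is bypassed.\<close>

lemma ns_step_nb:
  assumes "ns d (insert v V) E v y" "y \<in> V" "z \<in> nb V E v"
  shows "ns d V E z y"
  unfolding ns_def
proof (intro allI impI)
  fix Q assume Q: "Q \<subseteq> V \<and> card Q = d \<and> z \<notin> Q \<and> y \<notin> Q"
  then have "reach (insert v V - Q) E v y" using assms vV by (auto simp: ns_def)
  moreover have "reach (insert v V - Q) E z v"
    using Q assms vV by (auto simp: nb_def insert_commute intro!: reach_edge)
  ultimately have "reach (insert v V - Q) E z y" using reach_trans by metis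
  then show "reach (V - Q) E z y" using step_reach assms vV by (auto simp: nb_def)
qed

text \<open>Exactly \<open>d\<close> neighbours would themselves separate \<open>v\<close> from
  \<open>y\<close>. The surplus neighbour is what makes the neighbourhood determine an
  isometry.\<close>

lemma ns_step_card:
  assumes "ns d (insert v V) E v y" "y \<in> V" "y \<notin> nb V E v"
  shows "card (nb V E v) > d"
proof (rule ccontr)
  assume "\<not> card (nb V E v) > d"
  then have "card (nb V E v) = d" using cn by simp
  then have "reach (insert v V - nb V E v) E v y"
    using assms vV by (intro assms(1)[unfolded ns_def, rule_format]) (auto simp: nb_def)
  then have "y = v" by (rule reach_isolated) (simp add: nb_insert lf)
  then show False using assms vV by simp
qed

end

text \<open>A d-set that disconnects the enlarged graph either disconnects the old one or cuts off
  \<open>v\<close>. In the latter case it contains the neighbourhood of \<open>v\<close>, and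
  counting makes the two equal.\<close>

lemma separator_clique:
  assumes "finite V" "chordal V E" "loopfree E" "k_connected d V E" "d \<ge> 1"
    and "Q \<subseteq> V" "card Q = d" "\<not> connected_on (V - Q) E"
  shows "clique V E Q"
  using assms(1-4,6-)
proof (induction arbitrary: Q rule: chordal_connected_induct)
  case (complete V)
  then show ?case by (auto simp: clique_def)
next
  case (simplicial V v)
  note st = simplicial(1,2) assms(3) simplicial(3) assms(5) simplicial(4,5)
  have vQ: "v \<notin> Q" using step_connected[OF st] simplicial by blast
  show ?case
  proof (cases "connected_on (V - Q) E")
    case True
    have "nb V E v \<subseteq> Q"
    proof
      fix z assume z: "z \<in> nb V E v"
      show "z \<in> Q"
      proof (rule ccontr)
        assume "z \<notin> Q"
        then have "connected_on (insert v (V - Q)) E"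
          using z by (intro connected_on_insert[OF True, of z]) (auto simp: nb_def)
        then show False using simplicial vQ by (simp add: insert_Diff_if)
      qed
    qed
    moreover have "finite Q" using simplicial finite_subset by blast
    ultimately have "Q = nb V E v" using simplicial card_seteq by metis
    then show ?thesis using simplicial by simp
  next
    case False
    have "Q \<subseteq> V" using simplicial(7) vQ by blast
    then have "clique V E Q" using simplicial(6) simplicial(8) False by blast
    then show ?thesis by (auto simp: clique_def)
  qed
qed

text \<open>Supplies, for each component of \<open>V - Q\<close>, a clique of the tree attached to
  \<open>Q\<close>. If the new vertex \<open>v\<close> lies in \<open>Q\<close>, a neighbour of
  \<open>v\<close> outside \<open>Q\<close> serves, as the rest of \<open>Q\<close> consists of
  neighbours of \<open>v\<close> too. If \<open>u = v\<close>, either \<open>v\<close> itself serves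
  or a neighbour of \<open>v\<close> leads back to the old graph.\<close>

lemma clique_extend_component:
  assumes "finite V" "chordal V E" "loopfree E" "k_connected d V E" "d \<ge> 1"
    and "clique V E Q" "card Q = d" "u \<in> V - Q"
  shows "\<exists>w\<in>V - Q. reach (V - Q) E u w \<and> (\<forall>z\<in>Q. {w, z} \<in> E)"
  using assms(1-4,6-)
proof (induction arbitrary: Q u rule: chordal_connected_induct)
  case (complete V)
  then have "{u, z} \<in> E" if "z \<in> Q" for z
    using that unfolding clique_def by (metis DiffD1 DiffD2 subsetD)
  then show ?case using complete by (intro bexI[of _ u]) auto
next
  case (simplicial V v)
  note st = simplicial(1,2) assms(3) simplicial(3) assms(5) simplicial(4,5)
  have finQ: "finite Q" using simplicial(1,7) finite_subset by (auto simp: clique_def)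
  have finN: "finite (nb V E v)" using simplicial(1) by (auto simp: nb_def)
  show ?case
  proof (cases "v \<in> Q")
    case True
    have "card (Q - {v}) < card (nb V E v)"
      using True simplicial(4,8) finQ assms(5) by simp
    then have "\<not> nb V E v \<subseteq> Q - {v}" using finQ card_mono by (metis finite_Diff leD)
    moreover have vn: "v \<notin> nb V E v" using simplicial(2) by (auto simp: nb_def)
    ultimately obtain w where w: "w \<in> nb V E v" "w \<notin> Q" by blast
    have "{w, z} \<in> E" if "z \<in> Q" for z
    proof (cases "z = v")
      case True
      then show ?thesis using w by (auto simp: nb_def insert_commute)
    next
      case False
      then have "z \<in> nb V E v" using that simplicial(7) True by (auto simp: clique_def nb_def)
      then show ?thesis using w that simplicial(3) by (auto simp: clique_def)
    qed
    moreover have "reach (insert v V - Q) E u w"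
      using step_connected[OF st, of Q] True simplicial(7-9) w
      by (auto simp: connected_on_reach clique_def nb_def)
    ultimately show ?thesis using w by (auto simp: nb_def)
  next
    case False
    then have QV: "clique V E Q" using simplicial(7) by (auto simp: clique_def)
    have *: "\<exists>w\<in>insert v V - Q. reach (insert v V - Q) E u w \<and> (\<forall>z\<in>Q. {w, z} \<in> E)"
      if u: "u \<in> V - Q" for u
    proof -
      obtain w where w: "w \<in> V - Q" "reach (V - Q) E u w" "\<forall>z\<in>Q. {w, z} \<in> E"
        using simplicial(6)[OF QV simplicial(8) u] by blast
      have "reach (insert v V - Q) E u w" by (rule reach_mono[OF w(2)]) auto
      then show ?thesis using w by auto
    qed
    show ?thesis
    proof (cases "u = v")
      case uv: True
      show ?thesis
      proof (cases "nb V E v \<subseteq> Q")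
        case True
        then have "nb V E v = Q" using finQ simplicial card_seteq by metis
        then show ?thesis using uv False by (intro bexI[of _ v]) (auto simp: nb_def)
      next
        case 2: False
        then obtain z where z: "z \<in> V - Q" "{v, z} \<in> E" by (auto simp: nb_def)
        then have "reach (insert v V - Q) E v z" using False by (auto intro: reach_edge)
        then show ?thesis using *[OF z(1)] uv reach_trans by metis
      qed
    next
      case uv: False
      then show ?thesis using * simplicial(9) by blast
    qed
  qed
qed

text \<open>Shows that maximal cliques of G* have more than \<open>d\<close> vertices. If
  \<open>S\<close> contains the new vertex \<open>v\<close>, then a neighbour of \<open>v\<close>
  outside \<open>S\<close> is linked to every old vertex to which \<open>v\<close> is
  linked.\<close>

lemma ns_clique_extend:
  assumes "finite V" "chordal V E" "loopfree E" "k_connected d V E" "d \<ge> 1"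
    and "S \<subseteq> V" "\<And>x y. x \<in> S \<Longrightarrow> y \<in> S \<Longrightarrow> x \<noteq> y \<Longrightarrow> ns d V E x y" "card S \<le> d"
  shows "\<exists>w\<in>V - S. \<forall>s\<in>S. ns d V E w s"
  using assms(1-4,6-)
proof (induction arbitrary: S rule: chordal_connected_induct)
  case (complete V)
  then have "S \<noteq> V" by auto
  then obtain w where "w \<in> V - S" using complete by blast
  then have "ns d V E w s" if "s \<in> S" for s
    using that complete unfolding clique_def by (metis DiffD1 DiffD2 subsetD ns_edge)
  then show ?case using \<open>w \<in> V - S\<close> by blast
next
  case (simplicial V v)
  note st = simplicial(1,2) assms(3) simplicial(3) assms(5) simplicial(4,5)
  have finS: "finite S" using simplicial(1,7) finite_subset by blast
  show ?case
  proof (cases "v \<in> S")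
    case False
    then have SV: "S \<subseteq> V" using simplicial(7) by auto
    then have "ns d V E x y" if "x \<in> S" "y \<in> S" "x \<noteq> y" for x y
      using simplicial(8)[OF that] ns_step[OF st, of x y] that by blast
    then obtain w where "w \<in> V - S" "\<forall>s\<in>S. ns d V E w s"
      using simplicial(6)[OF SV _ simplicial(9)] by blast
    then show ?thesis using ns_step[OF st] SV by (intro bexI[of _ w]) auto
  next
    case True
    have nsv: "ns d (insert v V) E v s" if "s \<in> S" "s \<noteq> v" for s
      using simplicial(8)[OF True] that by auto
    have cS: "card (S - {v}) < d" using True simplicial(9) finS assms(5)
      by (simp add: card_Diff_singleton)
    have "\<not> nb V E v \<subseteq> S - {v}"
      using cS simplicial(4) finS card_mono[of "S - {v}" "nb V E v"] by auto
    moreover have "v \<notin> nb V E v" using simplicial(2) by (auto simp: nb_def)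
    ultimately obtain w where w: "w \<in> nb V E v" "w \<notin> S" by blast
    have "ns d (insert v V) E w s" if s: "s \<in> S" for s
    proof (cases "s = v")
      case True
      then show ?thesis using w by (auto simp: nb_def insert_commute intro!: ns_edge)
    next
      case False
      then have "s \<in> V" using s simplicial(7) by auto
      then show ?thesis
        using ns_step_nb[OF st nsv[OF s False] _ w(1)] ns_step[OF st, of w s] w by (auto simp: nb_def)
    qed
    then show ?thesis using w by (auto simp: nb_def)
  qed
qed

section \<open>The tree of cliques and separators\<close>

lemma tadj_sym: "tadj d V F X Y \<Longrightarrow> tadj d V F Y X"
  unfolding tadj_def by blast

lemma tree_plus_adj_sym: "tree_plus_adj d V F E' X Y \<Longrightarrow> tree_plus_adj d V F E' Y X"
  unfolding tree_plus_adj_def using tadj_sym by blast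

text \<open>Turns adjacency of nodes into an edge set, so that \<open>reach\<close> and its lemmas
  apply to the tree.\<close>

definition rel_edges :: "('b \<Rightarrow> 'b \<Rightarrow> bool) \<Rightarrow> 'b set set" where
  "rel_edges A = {{X, Y} | X Y. A X Y}"

lemma rel_edges_iff: "(\<And>X Y. A X Y \<Longrightarrow> A Y X) \<Longrightarrow> {X, Y} \<in> rel_edges A \<longleftrightarrow> A X Y"
  unfolding rel_edges_def by (auto simp: doubleton_eq_iff)

lemma tadj_edge [simp]: "{X, Y} \<in> rel_edges (tadj d V F) \<longleftrightarrow> tadj d V F X Y"
  by (rule rel_edges_iff) (rule tadj_sym)

lemma tplus_edge [simp]:
  "{X, Y} \<in> rel_edges (tree_plus_adj d V F E') \<longleftrightarrow> tree_plus_adj d V F E' X Y"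
  by (rule rel_edges_iff) (rule tree_plus_adj_sym)

lemma tadj_edges_sub: "rel_edges (tadj d V F) \<subseteq> rel_edges (tree_plus_adj d V F E')"
  unfolding rel_edges_def tree_plus_adj_def by blast

lemma cut_vertex_reach:
  "cut_vertex N (tree_plus_adj d V F E') x \<longleftrightarrow> x \<in> N \<and>
    (\<exists>a\<in>N - {x}. \<exists>b\<in>N - {x}. reach N (rel_edges (tree_plus_adj d V F E')) a b \<and>
      \<not> reach (N - {x}) (rel_edges (tree_plus_adj d V F E')) a b)"
  unfolding cut_vertex_def reach_def by auto

lemma tpath_successively:
  "tpath d V F P \<longleftrightarrow> P \<noteq> [] \<and> distinct P \<and> set P \<subseteq> tnodes d V F \<and> successively (tadj d V F) P"
  by (simp add: tpath_def successively_conv_nth)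

lemma tpath_append:
  "A \<noteq> [] \<Longrightarrow> B \<noteq> [] \<Longrightarrow> tpath d V F (A @ B) \<longleftrightarrow>
    tpath d V F A \<and> tpath d V F B \<and> set A \<inter> set B = {} \<and> tadj d V F (last A) (hd B)"
  by (auto simp: tpath_successively successively_append_iff)

lemma nverts_simps [simp]: "nverts (Inl S) = S" "nverts (Inr Q) = Q"
  by (simp_all add: nverts_def)

lemma tnodes_iff [simp]:
  "Inl S \<in> tnodes d V F \<longleftrightarrow> S \<in> maximal_cliques V F"
  "Inr Q \<in> tnodes d V F \<longleftrightarrow> Q \<in> separators d V F"
  by (auto simp: tnodes_def)

lemma tadj_Inl_Inr [simp]:
  "tadj d V F (Inl S) (Inr Q) \<longleftrightarrow> S \<in> maximal_cliques V F \<and> Q \<in> separators d V F \<and> Q \<subseteq> S"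
  "tadj d V F (Inr Q) (Inl S) \<longleftrightarrow> S \<in> maximal_cliques V F \<and> Q \<in> separators d V F \<and> Q \<subseteq> S"
  "\<not> tadj d V F (Inl S) (Inl S')" "\<not> tadj d V F (Inr Q) (Inr Q')"
  by (auto simp: tadj_def)

text \<open>By minimality, dropping either end node uncovers \<open>u\<close> or \<open>v\<close>.
  It cannot be the same vertex at both ends, since that vertex would then lie in no node at all.
  Which of the two sits at the head of the list is left open, hence two orientations.\<close>

lemma min_tpath_ends:
  assumes "min_tpath d V F u v P"
  obtains (single) X where "P = [X]" "u \<in> nverts X" "v \<in> nverts X"
  | (forward) "hd P \<noteq> last P" "u \<in> nverts (hd P)" "v \<in> nverts (last P)"
      "\<And>X. X \<in> set (tl P) \<Longrightarrow> u \<notin> nverts X" "\<And>X. X \<in> set (butlast P) \<Longrightarrow> v \<notin> nverts X"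
  | (backward) "hd P \<noteq> last P" "v \<in> nverts (hd P)" "u \<in> nverts (last P)"
      "\<And>X. X \<in> set (tl P) \<Longrightarrow> v \<notin> nverts X" "\<And>X. X \<in> set (butlast P) \<Longrightarrow> u \<notin> nverts X"
proof -
  have P: "tpath d V F P" and cov: "covers u v P"
    and least: "\<And>P'. tpath d V F P' \<Longrightarrow> set P' \<subset> set P \<Longrightarrow> \<not> covers u v P'"
    using assms by (auto simp: min_tpath_def)
  have "P \<noteq> []" "distinct P" using P by (auto simp: tpath_def)
  show ?thesis
  proof (cases "tl P = []")
    case True
    then obtain X where "P = [X]" using \<open>P \<noteq> []\<close> by (cases P) auto
    then show ?thesis using single cov by (simp add: covers_def)
  next
    case False
    have tlP: "P = [hd P] @ tl P" using \<open>P \<noteq> []\<close> by simp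
    have blP: "P = butlast P @ [last P]" using \<open>P \<noteq> []\<close> by simp
    have "butlast P \<noteq> []" using False \<open>P \<noteq> []\<close> by (cases P) auto
    have "tpath d V F (tl P)" using P tlP False tpath_append[of "[hd P]" "tl P"] by auto
    moreover have "set (tl P) \<subset> set P" using tlP \<open>distinct P\<close>
      by (metis distinct.simps(2) list.exhaust_sel list.set_sel(1) psubsetI set_subset_Cons \<open>P \<noteq> []\<close>)
    ultimately have c1: "\<not> covers u v (tl P)" using least by blast
    have "tpath d V F (butlast P)"
      using P blP \<open>butlast P \<noteq> []\<close> tpath_append[of "butlast P" "[last P]"] by auto
    moreover have "last P \<notin> set (butlast P)" using \<open>distinct P\<close> blP
      by (metis distinct_append disjoint_iff list.set_intros(1))
    then have "set (butlast P) \<subset> set P" using \<open>P \<noteq> []\<close>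
      by (metis in_set_butlastD last_in_set psubsetI subsetI)
    ultimately have c2: "\<not> covers u v (butlast P)" using least by blast
    have s1: "set P = insert (hd P) (set (tl P))" using \<open>P \<noteq> []\<close> by (cases P) auto
    have s2: "set P = insert (last P) (set (butlast P))"
      using \<open>P \<noteq> []\<close> by (cases P rule: rev_cases) auto
    have "hd P \<noteq> last P" using False \<open>distinct P\<close> \<open>P \<noteq> []\<close>
      by (cases P) (auto dest: last_in_set)
    have hd_bl: "hd P \<in> set (butlast P)"
      using s2 \<open>hd P \<noteq> last P\<close> hd_in_set[OF \<open>P \<noteq> []\<close>] by auto
    have cov': "u \<in> \<Union> (nverts ` set P)" "v \<in> \<Union> (nverts ` set P)" using cov by (auto simp: covers_def)
    have "(\<forall>X\<in>set (tl P). u \<notin> nverts X) \<or> (\<forall>X\<in>set (tl P). v \<notin> nverts X)"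
      using c1 by (auto simp: covers_def)
    moreover have "(\<forall>X\<in>set (butlast P). u \<notin> nverts X) \<or> (\<forall>X\<in>set (butlast P). v \<notin> nverts X)"
      using c2 by (auto simp: covers_def)
    ultimately consider
        "\<forall>X\<in>set (tl P). u \<notin> nverts X" "\<forall>X\<in>set (butlast P). v \<notin> nverts X"
      | "\<forall>X\<in>set (tl P). v \<notin> nverts X" "\<forall>X\<in>set (butlast P). u \<notin> nverts X"
      | "\<forall>X\<in>set (tl P). u \<notin> nverts X" "\<forall>X\<in>set (butlast P). u \<notin> nverts X"
      | "\<forall>X\<in>set (tl P). v \<notin> nverts X" "\<forall>X\<in>set (butlast P). v \<notin> nverts X"
      by blast
    then show ?thesis
    proof cases
      case 1
      moreover have "u \<in> nverts (hd P)" using 1 cov'(1) s1 by auto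
      moreover have "v \<in> nverts (last P)" using 1 cov'(2) s2 by auto
      ultimately show ?thesis using forward \<open>hd P \<noteq> last P\<close> by blast
    next
      case 2
      moreover have "v \<in> nverts (hd P)" using 2 cov'(2) s1 by auto
      moreover have "u \<in> nverts (last P)" using 2 cov'(1) s2 by auto
      ultimately show ?thesis using backward \<open>hd P \<noteq> last P\<close> by blast
    next
      case 3
      then show ?thesis using cov'(1) s1 hd_bl by auto
    next
      case 4
      then show ?thesis using cov'(2) s1 hd_bl by auto
    qed
  qed
qed

text \<open>The properties of G* on which the tree arguments rest, with \<open>nonadj\<close> as
  total looseness in combinatorial form. They are obtained from the chordality of G, because G and
  G* have the same components after the removal of a d-set.\<close>

locale loose_graph =
  fixes V :: "'a set" and F :: "'a set set" and d :: nat
  assumes fin: "finite V" and lf: "loopfree F" and d1: "d \<ge> 1"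
    and nonadj: "x \<in> V \<Longrightarrow> y \<in> V \<Longrightarrow> x \<noteq> y \<Longrightarrow> {x, y} \<notin> F \<Longrightarrow>
      \<exists>Q. Q \<subseteq> V \<and> card Q = d \<and> x \<notin> Q \<and> y \<notin> Q \<and> \<not> reach (V - Q) F x y"
    and sep_clique: "Q \<in> separators d V F \<Longrightarrow> clique V F Q"
    and sep_ext: "Q \<in> separators d V F \<Longrightarrow> u \<in> V - Q \<Longrightarrow>
      \<exists>w\<in>V - Q. reach (V - Q) F u w \<and> (\<forall>z\<in>Q. {w, z} \<in> F)"
    and max_card: "S \<in> maximal_cliques V F \<Longrightarrow> d < card S"
begin

abbreviation "mc \<equiv> maximal_cliques V F"
abbreviation "seps \<equiv> separators d V F"
abbreviation "nodes \<equiv> tnodes d V F"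
abbreviation "tedges \<equiv> rel_edges (tadj d V F)"
abbreviation "conn Q \<equiv> reach (V - Q) F"

section \<open>Maximal cliques, separators and the components they meet\<close>

lemma mc_clique: "S \<in> mc \<Longrightarrow> clique V F S"
  by (simp add: maximal_cliques_def)

lemma mc_sub: "S \<in> mc \<Longrightarrow> S \<subseteq> V"
  using mc_clique by (auto simp: clique_def)

lemma sepD: "Q \<in> seps \<Longrightarrow> Q \<subseteq> V" "Q \<in> seps \<Longrightarrow> card Q = d"
  by (auto simp: separators_def)

lemma sep_fin: "Q \<in> seps \<Longrightarrow> finite Q"
  using sepD(1) fin finite_subset by blast

lemma node_clique: "X \<in> nodes \<Longrightarrow> clique V F (nverts X)"
  by (cases X) (auto simp: mc_clique sep_clique)

lemma node_sub: "X \<in> nodes \<Longrightarrow> nverts X \<subseteq> V"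
  using node_clique by (auto simp: clique_def)

lemma clique_in_mc:
  assumes "clique V F K" shows "\<exists>S\<in>mc. K \<subseteq> S"
proof -
  have "\<forall>K'. clique V F K' \<and> K \<subseteq> K' \<longrightarrow> card K' < Suc (card V)"
    using fin by (auto simp: clique_def less_Suc_eq_le card_mono)
  then obtain S where S: "clique V F S" "K \<subseteq> S"
    and mx: "\<And>K'. clique V F K' \<Longrightarrow> K \<subseteq> K' \<Longrightarrow> card K' \<le> card S"
    using ex_has_greatest_nat[of "\<lambda>K'. clique V F K' \<and> K \<subseteq> K'" K card "Suc (card V)"] assms by auto
  have "K' = S" if "clique V F K'" "S \<subseteq> K'" for K'
  proof -
    have "finite K'" using that fin finite_subset by (auto simp: clique_def)
    then show ?thesis using card_seteq[of K' S] mx[of K'] that S by auto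
  qed
  then show ?thesis using S by (auto simp: maximal_cliques_def)
qed

lemma vertex_in_mc: "x \<in> V \<Longrightarrow> \<exists>S\<in>mc. x \<in> S"
  using clique_in_mc[of "{x}"] by (auto simp: clique_def)

lemma edge_in_mc: "x \<in> V \<Longrightarrow> y \<in> V \<Longrightarrow> {x, y} \<in> F \<Longrightarrow> \<exists>S\<in>mc. x \<in> S \<and> y \<in> S"
  using clique_in_mc[of "{x, y}"] by (auto simp: clique_def insert_commute)

lemma clique_conn: "clique V F K \<Longrightarrow> x \<in> K - Q \<Longrightarrow> y \<in> K - Q \<Longrightarrow> conn Q x y"
  by (cases "x = y") (auto simp: clique_def intro!: reach_edge)

lemma sepI: "Q \<subseteq> V \<Longrightarrow> card Q = d \<Longrightarrow> x \<in> V - Q \<Longrightarrow> y \<in> V - Q \<Longrightarrow> \<not> conn Q x y \<Longrightarrow> Q \<in> seps"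
  by (auto simp: separators_def connected_on_reach)

lemma sep_diff: "Q \<in> seps \<Longrightarrow> Q' \<in> seps \<Longrightarrow> Q \<noteq> Q' \<Longrightarrow> \<exists>z. z \<in> Q - Q'"
  using card_subset_eq[of Q' Q] sep_fin sepD(2) by auto

text \<open>Places every node other than \<open>Q\<close> in a definite component of
  \<open>V - Q\<close>: the node is a clique, and by its size it is not contained in
  \<open>Q\<close>.\<close>

lemma node_extra:
  assumes "X \<in> nodes" "Q \<in> seps" "X \<noteq> Inr Q" shows "\<exists>z. z \<in> nverts X - Q"
proof (cases X)
  case (Inl S)
  then have "d < card S" using assms max_card by simp
  then have "\<not> S \<subseteq> Q" using assms sep_fin sepD(2) card_mono by (metis leD)
  then show ?thesis using Inl by auto
next
  case (Inr Q')
  then show ?thesis using assms sep_diff by auto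
qed

lemma mc_nonadj:
  assumes "S \<in> mc" "u \<in> V" "u \<notin> S" shows "\<exists>v\<in>S. {u, v} \<notin> F"
proof (rule ccontr)
  assume "\<not> ?thesis"
  then have "clique V F (insert u S)"
    using mc_clique[OF assms(1)] assms by (auto simp: clique_def insert_commute)
  then show False using assms by (auto simp: maximal_cliques_def)
qed

text \<open>By maximality a vertex of \<open>S\<close> outside \<open>S'\<close> has a non-neighbour
  in \<open>S'\<close>, and non-adjacent vertices are separated by some \<open>Q\<close>. A common
  vertex of the cliques off \<open>Q\<close> would connect the two.\<close>

lemma mc_separated:
  assumes "S \<in> mc" "S' \<in> mc" "S \<noteq> S'"
  shows "\<exists>Q\<in>seps. \<exists>u\<in>S - Q. \<exists>v\<in>S' - Q. \<not> conn Q u v \<and> S \<inter> S' \<subseteq> Q"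
proof -
  have "\<not> S \<subseteq> S'"
    using assms mc_clique[OF assms(2)] unfolding maximal_cliques_def by blast
  then obtain u where u: "u \<in> S" "u \<notin> S'" by blast
  then have uV: "u \<in> V" using assms mc_sub by blast
  obtain v where v: "v \<in> S'" "{u, v} \<notin> F" using mc_nonadj[OF assms(2) uV u(2)] by blast
  have vV: "v \<in> V" using v assms mc_sub by blast
  obtain Q where Q: "Q \<subseteq> V" "card Q = d" "u \<notin> Q" "v \<notin> Q" "\<not> conn Q u v"
    using nonadj[OF uV vV _ v(2)] u v by blast
  have "z \<in> Q" if "z \<in> S \<inter> S'" for z
  proof (rule ccontr)
    assume "z \<notin> Q"
    then have "conn Q u z" "conn Q z v"
      using clique_conn[OF mc_clique[OF assms(1)]] clique_conn[OF mc_clique[OF assms(2)]] that u v Q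
      by auto
    then show False using Q reach_trans by metis
  qed
  then show ?thesis using Q u v uV vV sepI[of Q u v] by blast
qed

text \<open>Two such cliques would be separated by a set containing their intersection, hence
  containing \<open>Q\<close>. By size this set is \<open>Q\<close>, contrary to the connection
  between \<open>x\<close> and \<open>y\<close>.\<close>

lemma mc_component_unique:
  assumes "Q \<in> seps" "S \<in> mc" "S' \<in> mc" "Q \<subseteq> S" "Q \<subseteq> S'"
    and "x \<in> S - Q" "y \<in> S' - Q" "conn Q x y"
  shows "S = S'"
proof (rule ccontr)
  assume "S \<noteq> S'"
  then obtain Q' u v where Q': "Q' \<in> seps" "u \<in> S - Q'" "v \<in> S' - Q'" "\<not> conn Q' u v" "S \<inter> S' \<subseteq> Q'"
    using mc_separated[OF assms(2,3)] by blast
  have "Q \<subseteq> Q'" using Q' assms by blast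
  then have "Q = Q'" using card_subset_eq[of Q' Q] sep_fin sepD(2) assms(1) Q'(1) by auto
  then have "conn Q u x" "conn Q y v"
    using clique_conn mc_clique assms Q' by blast+
  then show False using assms(8) Q' \<open>Q = Q'\<close> reach_trans by metis
qed

lemma component_mc:
  assumes "Q \<in> seps" "u \<in> V - Q"
  shows "\<exists>S\<in>mc. Q \<subseteq> S \<and> (\<exists>w\<in>S - Q. conn Q u w)"
proof -
  obtain w where w: "w \<in> V - Q" "conn Q u w" "\<forall>z\<in>Q. {w, z} \<in> F"
    using sep_ext[OF assms] by blast
  have "clique V F (insert w Q)"
    using sep_clique[OF assms(1)] w by (auto simp: clique_def insert_commute)
  then obtain S where "S \<in> mc" "insert w Q \<subseteq> S" using clique_in_mc by blast
  then show ?thesis using w by blast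
qed

text \<open>The separators between two cliques, a measure of their distance in the tree. As a clique
  stays connected off \<open>Q\<close>, one separated pair means that all pairs are
  separated.\<close>

definition splits :: "'a set \<Rightarrow> 'a set \<Rightarrow> 'a set set" where
  "splits S S' = {Q \<in> seps. \<exists>x\<in>S - Q. \<exists>y\<in>S' - Q. \<not> conn Q x y}"

lemma splits_sym: "splits S S' = splits S' S"
proof -
  have "splits S S' \<subseteq> splits S' S" for S S'
  proof
    fix Q assume "Q \<in> splits S S'"
    then obtain x y where Q: "Q \<in> seps" "x \<in> S - Q" "y \<in> S' - Q" "\<not> conn Q x y"
      by (auto simp: splits_def)
    then have "\<not> conn Q y x" using reach_sym[of "V - Q" F y x] by blast
    then show "Q \<in> splits S' S" using Q by (auto simp: splits_def)
  qed
  then show ?thesis by blast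
qed

lemma finite_splits: "finite (splits S S')"
  by (rule finite_subset[of _ "Pow V"]) (auto simp: splits_def fin dest: sepD(1))

text \<open>Let \<open>Q2\<close> separate \<open>S\<close> from \<open>S1\<close>. The part of
  \<open>Q\<close> off \<open>Q2\<close> lies on the side of \<open>S1\<close>, so the component of
  \<open>S\<close> off \<open>Q2\<close> avoids \<open>Q\<close>; it stays on the side of
  \<open>u\<close> and cannot meet \<open>S'\<close>. The inclusion is strict because
  \<open>Q\<close> separates \<open>S\<close> from \<open>S'\<close> but not from
  \<open>S1\<close>.\<close>

lemma splits_less:
  assumes S: "S \<in> mc" "S' \<in> mc" "S1 \<in> mc"
    and Q: "Q \<in> seps" "u \<in> S - Q" "v \<in> S' - Q" "\<not> conn Q u v"
    and w: "Q \<subseteq> S1" "w \<in> S1 - Q" "conn Q u w"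
  shows "splits S S1 \<subset> splits S S'"
proof
  have conn_S: "conn Q x u" if "x \<in> S - Q" for x
    using clique_conn[OF mc_clique[OF S(1)]] that Q by blast
  show "splits S S1 \<subseteq> splits S S'"
  proof
    fix Q2 assume "Q2 \<in> splits S S1"
    then obtain a b where ab: "Q2 \<in> seps" "a \<in> S - Q2" "b \<in> S1 - Q2" "\<not> conn Q2 a b"
      by (auto simp: splits_def)
    have disj: "\<not> conn Q2 a z" if "z \<in> Q - Q2" for z
    proof
      assume "conn Q2 a z"
      moreover have "conn Q2 z b"
        using clique_conn[OF mc_clique[OF S(3)], of z Q2 b] that w ab by blast
      ultimately have "conn Q2 a b" by (rule reach_trans)
      then show False using ab by blast
    qed
    have aV: "a \<in> V - Q2" using ab mc_sub S by blast
    have "a \<notin> Q" using disj[of a] ab by auto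
    obtain y where y: "y \<in> S' - Q2"
      using node_extra[of "Inl S'" Q2] S ab by auto
    have "\<not> conn Q2 a y"
    proof
      assume "conn Q2 a y"
      \<comment> \<open>A walk off \<open>Q2\<close> from \<open>a\<close> cannot enter
        \<open>Q\<close>, so it is also a walk off \<open>Q\<close>.\<close>
      then have "conn Q a y \<and> y \<notin> Q"
      proof (induction rule: reach_induct)
        case refl
        then show ?case using \<open>a \<notin> Q\<close> by simp
      next
        case (step y z)
        have "conn Q2 a z" using step reach_trans reach_edge by metis
        then have "z \<notin> Q" using disj step by blast
        then have "conn Q y z" using step by (auto intro: reach_edge)
        then show ?case using step \<open>z \<notin> Q\<close> reach_trans by metis
      qed
      then have "conn Q a y" "y \<notin> Q" by auto
      moreover have "conn Q u a" using reach_sym[OF conn_S[of a]] ab \<open>a \<notin> Q\<close> by blast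
      moreover have "conn Q y v"
        using clique_conn[OF mc_clique[OF S(2)]] y Q \<open>y \<notin> Q\<close> by blast
      ultimately show False using Q reach_trans by metis
    qed
    then show "Q2 \<in> splits S S'" using ab y by (auto simp: splits_def)
  qed
  have "Q \<notin> splits S S1"
  proof
    assume "Q \<in> splits S S1"
    then obtain a b where ab: "a \<in> S - Q" "b \<in> S1 - Q" "\<not> conn Q a b"
      by (auto simp: splits_def)
    have "conn Q a u" using conn_S ab by blast
    moreover have "conn Q w b" using clique_conn[OF mc_clique[OF S(3)]] w ab by blast
    ultimately show False using ab w reach_trans by metis
  qed
  moreover have "Q \<in> splits S S'" using Q by (auto simp: splits_def)
  ultimately show "splits S S1 \<noteq> splits S S'" by blast
qed

text \<open>A separator Q between S and S' contains their intersection, and maximal cliques around Q on the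
  two sides are separated from S, respectively S', by fewer separators.\<close>

lemma tree_chain:
  assumes "S \<in> mc" "S' \<in> mc" "I \<subseteq> S" "I \<subseteq> S'"
  shows "reach {X \<in> nodes. I \<subseteq> nverts X} tedges (Inl S) (Inl S')"
  using assms
proof (induction "card (splits S S')" arbitrary: S S' rule: less_induct)
  case less
  let ?M = "{X \<in> nodes. I \<subseteq> nverts X}"
  show ?case
  proof (cases "S = S'")
    case False
    then obtain Q u v where Q: "Q \<in> seps" "u \<in> S - Q" "v \<in> S' - Q" "\<not> conn Q u v" "S \<inter> S' \<subseteq> Q"
      using mc_separated less by blast
    have uv: "u \<in> V - Q" "v \<in> V - Q" using Q mc_sub less.prems by blast+
    obtain S1 w where S1: "S1 \<in> mc" "Q \<subseteq> S1" "w \<in> S1 - Q" "conn Q u w"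
      using component_mc[OF Q(1) uv(1)] by blast
    obtain S2 w' where S2: "S2 \<in> mc" "Q \<subseteq> S2" "w' \<in> S2 - Q" "conn Q v w'"
      using component_mc[OF Q(1) uv(2)] by blast
    have I: "I \<subseteq> Q" using Q less.prems by blast
    have "splits S S1 \<subset> splits S S'"
      using splits_less[OF less.prems(1,2) S1(1) Q(1-4) S1(2-4)] .
    then have "card (splits S S1) < card (splits S S')"
      using finite_splits psubset_card_mono by blast
    then have 1: "reach ?M tedges (Inl S) (Inl S1)"
      using less.hyps less.prems S1 I by blast
    have "\<not> conn Q v u" using Q reach_sym by metis
    then have "splits S' S2 \<subset> splits S' S"
      using splits_less[OF less.prems(2,1) S2(1) Q(1) Q(3) Q(2) _ S2(2-4)] by blast
    then have "card (splits S' S2) < card (splits S S')"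
      using finite_splits psubset_card_mono splits_sym by metis
    then have "reach ?M tedges (Inl S') (Inl S2)"
      using less.hyps less.prems S2 I by blast
    then have 2: "reach ?M tedges (Inl S2) (Inl S')" by (rule reach_sym)
    have 3: "reach ?M tedges (Inl S1) (Inr Q)" "reach ?M tedges (Inr Q) (Inl S2)"
      using S1 S2 Q(1) I by (auto intro!: reach_edge)
    show ?thesis
      by (rule reach_trans[OF reach_trans[OF 1 3(1)] reach_trans[OF 3(2) 2]])
  qed simp
qed

text \<open>The running intersection property of a clique tree, extended to separator nodes by
  stepping to a clique around the separator. An empty \<open>I\<close> gives connectivity, a
  singleton \<open>I\<close> the subtree of a vertex.\<close>

lemma node_chain:
  assumes "X \<in> nodes" "Y \<in> nodes" "I \<subseteq> nverts X" "I \<subseteq> nverts Y"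
  shows "reach {X \<in> nodes. I \<subseteq> nverts X} tedges X Y"
proof -
  let ?M = "{X \<in> nodes. I \<subseteq> nverts X}"
  have *: "\<exists>S\<in>mc. I \<subseteq> S \<and> reach ?M tedges X (Inl S)" if X: "X \<in> nodes" "I \<subseteq> nverts X" for X
  proof (cases X)
    case (Inl S)
    then show ?thesis using X by (intro bexI[of _ S]) auto
  next
    case (Inr Q)
    then have "clique V F Q" using X sep_clique by simp
    then obtain S where S: "S \<in> mc" "Q \<subseteq> S" using clique_in_mc by blast
    then have "reach ?M tedges X (Inl S)" using X Inr by (auto intro!: reach_edge)
    then show ?thesis using S X Inr by auto
  qed
  obtain S where S: "S \<in> mc" "I \<subseteq> S" "reach ?M tedges X (Inl S)" using *[of X] assms by blast
  obtain S' where S': "S' \<in> mc" "I \<subseteq> S'" "reach ?M tedges Y (Inl S')" using *[of Y] assms by blast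
  have "reach ?M tedges (Inl S) (Inl S')" by (rule tree_chain) (use S S' in auto)
  then show ?thesis
    by (rule reach_trans[OF S(3) reach_trans[OF _ reach_sym[OF S'(3)]]])
qed

lemma tree_connected: "X \<in> nodes \<Longrightarrow> Y \<in> nodes \<Longrightarrow> reach nodes tedges X Y"
  using node_chain[of X Y "{}"] by simp

lemma vertex_chain:
  assumes "X \<in> nodes" "Y \<in> nodes" "z \<in> nverts X" "z \<in> nverts Y" "z \<notin> Q"
  shows "reach (nodes - {Inr Q}) tedges X Y"
  by (rule reach_mono[OF node_chain[of X Y "{z}"]]) (use assms in auto)

lemma tadj_common:
  assumes "tadj d V F X Y" shows "nverts X \<subseteq> nverts Y \<or> nverts Y \<subseteq> nverts X"
  using assms by (auto simp: tadj_def)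

text \<open>Neighbouring nodes are nested and the smaller one is not contained in \<open>Q\<close>.
  So they share a vertex off \<open>Q\<close>, and the component does not change along the
  path.\<close>

lemma tpath_conn:
  assumes "tpath d V F P" "Q \<in> seps" "Inr Q \<notin> set P" "X \<in> set P" "Y \<in> set P"
    and "x \<in> nverts X - Q" "y \<in> nverts Y - Q"
  shows "conn Q x y"
proof -
  have "\<forall>Y\<in>set P. \<forall>y\<in>nverts Y - Q. \<forall>x\<in>nverts (hd P) - Q. conn Q x y"
    using assms(1,3)
  proof (induction P)
    case (Cons X P)
    have XN: "X \<in> nodes" using Cons.prems by (auto simp: tpath_def)
    show ?case
    proof (cases "P = []")
      case True
      then show ?thesis using clique_conn[OF node_clique[OF XN]] by auto
    next
      case False
      have P: "tpath d V F P" "tadj d V F X (hd P)"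
        using Cons.prems False tpath_append[of "[X]" P] by auto
      have hN: "hd P \<in> nodes" "X \<noteq> Inr Q" 
        using P False Cons.prems by (auto simp: tpath_def)
      have hQ: "hd P \<noteq> Inr Q" using Cons.prems(2) hd_in_set[OF False] by force
      obtain z where z: "z \<in> nverts X - Q" "z \<in> nverts (hd P) - Q"
        using tadj_common[OF P(2)] node_extra[OF XN assms(2) hN(2)] node_extra[OF hN(1) assms(2) hQ]
        by blast
      have "conn Q x y" if xy: "x \<in> nverts X - Q" "Y \<in> set (X # P)" "y \<in> nverts Y - Q" for x y Y
      proof (cases "Y = X")
        case True
        then show ?thesis using clique_conn[OF node_clique[OF XN]] xy by auto
      next
        case False
        then have "conn Q z y" using Cons P(1) z xy by auto
        moreover have "conn Q x z" using clique_conn[OF node_clique[OF XN]] xy z by auto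
        ultimately show ?thesis using reach_trans[of "V - Q" F x z y] by blast
      qed
      then show ?thesis by simp
    qed
  qed (simp add: tpath_def)
  moreover have "P \<noteq> []" using assms(1) by (simp add: tpath_def)
  then have "hd P \<in> set P" by simp
  then have hN: "hd P \<in> nodes" "hd P \<noteq> Inr Q"
    using assms(1,3) unfolding tpath_def by (blast, metis)
  moreover obtain z where "z \<in> nverts (hd P) - Q" using node_extra[OF hN(1) assms(2) hN(2)] by blast
  ultimately have "conn Q z x" "conn Q z y" using assms by blast+
  then show ?thesis by (rule reach_trans[OF reach_sym])
qed

text \<open>A covering path of least length is also minimal for inclusion, since its nodes are
  distinct and length is cardinality.\<close>

lemma min_tpath_exists:
  assumes "u \<in> V" "v \<in> V" shows "\<exists>P. min_tpath d V F u v P"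
proof -
  obtain S S' where S: "S \<in> mc" "u \<in> S" "S' \<in> mc" "v \<in> S'" using vertex_in_mc assms by blast
  then have "reach nodes tedges (Inl S) (Inl S')" using tree_connected by simp
  then obtain P where P: "P \<noteq> []" "hd P = Inl S" "last P = Inl S'" "set P \<subseteq> nodes"
    "successively (\<lambda>a b. {a, b} \<in> tedges) P" "distinct P"
    by (rule shortest_path) (use S in auto)
  define good where "good P \<longleftrightarrow> tpath d V F P \<and> covers u v P" for P
  have "Inl S \<in> set P" "Inl S' \<in> set P" using P(1-3) hd_in_set last_in_set by metis+
  then have "covers u v P" using S unfolding covers_def by force
  then have "good P" using P by (simp add: good_def tpath_successively)
  then obtain P' where P': "good P'" "\<And>P''. good P'' \<Longrightarrow> length P' \<le> length P''"
    using ex_has_least_nat[of good P length] by metis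
  have "\<not> set P'' \<subset> set P'" if "good P''" for P''
  proof
    assume "set P'' \<subset> set P'"
    then have "card (set P'') < card (set P')" by (simp add: psubset_card_mono)
    then show False using P'(2)[OF that] P'(1) that
      by (auto simp: good_def tpath_def distinct_card)
  qed
  then show ?thesis using P' unfolding min_tpath_def good_def by blast
qed

section \<open>Cut vertices of the augmented tree and connectivity off a separator\<close>

context
  fixes E E' :: "'a set set" and Q
  assumes E_sub: "E \<subseteq> F" and Q: "Q \<in> seps"
    and F_reach: "\<And>x y. x \<in> V - Q \<Longrightarrow> y \<in> V - Q \<Longrightarrow> {x, y} \<in> F \<Longrightarrow> reach (V - Q) E x y"
begin

abbreviation "plus_edges \<equiv> rel_edges (tree_plus_adj d V F E')"

lemma conn_base: "conn Q x y \<Longrightarrow> reach (V - Q) (E \<union> E') x y"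
proof (induction rule: reach_induct)
  case (step y z)
  have "reach (V - Q) (E \<union> E') y z"
    by (rule reach_mono[OF F_reach]) (use step in auto)
  then show ?case using step reach_trans by metis
qed simp

lemma tree_reach_plus:
  "reach M tedges X Y \<Longrightarrow> reach M plus_edges X Y"
  by (erule reach_mono) (auto simp: tadj_edges_sub)

text \<open>A walk off \<open>Q\<close> is followed in the augmented tree: an edge of
  \<open>E\<close> stays inside a maximal clique, an edge of \<open>E'\<close> is a jump between the
  end nodes of its minimal path.\<close>

lemma connected_imp_not_cut:
  assumes "connected_on (V - Q) (E \<union> E')"
  shows "\<not> cut_vertex nodes (tree_plus_adj d V F E') (Inr Q)"
proof -
  let ?M = "nodes - {Inr Q}"
  have "reach ?M plus_edges A B" if AB: "A \<in> ?M" "B \<in> ?M" for A B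
  proof -
    obtain x where x: "x \<in> nverts A - Q" using node_extra[of A Q] AB Q by auto
    obtain y where y: "y \<in> nverts B - Q" using node_extra[of B Q] AB Q by auto
    have xV: "x \<in> V - Q" "y \<in> V - Q" using x y AB node_sub by auto
    then have "reach (V - Q) (E \<union> E') x y" using assms by (auto simp: connected_on_reach)
    \<comment> \<open>The claim covers all nodes containing the current vertex, as the next edge
      dictates from which of them the walk continues.\<close>
    then have "\<forall>Y\<in>nodes. y \<in> nverts Y \<longrightarrow> reach ?M plus_edges A Y"
    proof (induction rule: reach_induct)
      case refl
      then show ?case using tree_reach_plus[OF vertex_chain] x AB by blast
    next
      case (step y z)
      show ?case
      proof (intro ballI impI)
        fix Z assume Z: "Z \<in> nodes" "z \<in> nverts Z"
        have ch: "reach ?M plus_edges X Z" if "X \<in> nodes" "z \<in> nverts X" for X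
          using tree_reach_plus[OF vertex_chain] that Z step by blast
        from step(4) consider "{y, z} \<in> F" | "{y, z} \<in> E'" using E_sub by blast
        then show "reach ?M plus_edges A Z"
        proof cases
          case 1
          then obtain S where S: "S \<in> mc" "y \<in> S" "z \<in> S" using edge_in_mc step by blast
          then have "reach ?M plus_edges A (Inl S)" using step(5) by simp
          then show ?thesis using ch[of "Inl S"] S reach_trans by fastforce
        next
          case 2
          obtain P where P: "min_tpath d V F y z P" using min_tpath_exists step by blast
          then have PN: "set P \<subseteq> nodes" "P \<noteq> []" by (auto simp: min_tpath_def tpath_def)
          then have hN: "hd P \<in> nodes" "last P \<in> nodes" by auto
          have "tedge d V F E' (hd P) (last P)" using 2 P unfolding tedge_def by blast
          then have "tree_plus_adj d V F E' (hd P) (last P)" "tree_plus_adj d V F E' (last P) (hd P)"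
            by (simp_all add: tree_plus_adj_def)
          then have r: "reach ?M plus_edges (hd P) (last P)" "reach ?M plus_edges (last P) (hd P)"
            if "hd P \<noteq> Inr Q" "last P \<noteq> Inr Q" using that hN by (auto intro!: reach_edge)
          have ne: "X \<noteq> Inr Q" if "y \<in> nverts X \<or> z \<in> nverts X" for X
            using that step by auto
          from P show ?thesis
          proof (cases rule: min_tpath_ends)
            case (single X)
            then have "reach ?M plus_edges A X" using step(5) hN by auto
            then show ?thesis using ch[of X] single hN reach_trans by fastforce
          next
            case forward
            then have 1: "reach ?M plus_edges A (hd P)" using step(5) hN by auto
            have 2: "reach ?M plus_edges (last P) Z" using ch forward hN by auto
            have "reach ?M plus_edges (hd P) (last P)"
              by (rule r(1)) (use ne forward in blast)+
            from reach_trans[OF reach_trans[OF 1 this] 2] show ?thesis .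
          next
            case backward
            then have 1: "reach ?M plus_edges A (last P)" using step(5) hN by auto
            have 2: "reach ?M plus_edges (hd P) Z" using ch backward hN by auto
            have "reach ?M plus_edges (last P) (hd P)"
              by (rule r(2)) (use ne backward in blast)+
            from reach_trans[OF reach_trans[OF 1 this] 2] show ?thesis .
          qed
        qed
      qed
    qed
    then show ?thesis using y AB by auto
  qed
  then show ?thesis by (auto simp: cut_vertex_reach)
qed

text \<open>Each edge of the augmented tree that avoids the node \<open>Q\<close> has to yield a
  connection off \<open>Q\<close>. If the minimal path of \<open>uv\<close> passes through
  \<open>Q\<close>, the edge \<open>uv\<close> itself does so: \<open>u\<close> and \<open>v\<close>
  occur only in the end nodes, hence not in \<open>Q\<close>.\<close>

lemma not_cut_imp_connected:
  assumes "\<not> cut_vertex nodes (tree_plus_adj d V F E') (Inr Q)"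
  shows "connected_on (V - Q) (E \<union> E')"
proof -
  let ?M = "nodes - {Inr Q}"
  let ?r = "reach (V - Q) (E \<union> E')"
  have cl: "?r x y" if "X \<in> nodes" "x \<in> nverts X - Q" "y \<in> nverts X - Q" for X x y
    using conn_base clique_conn[OF node_clique] that by blast
  have edge: "\<exists>x\<in>nverts X - Q. \<exists>y\<in>nverts Y - Q. ?r x y"
    if XY: "X \<in> ?M" "Y \<in> ?M" "tedge d V F E' X Y" for X Y
  proof -
    obtain u v P where P: "{u, v} \<in> E'" "min_tpath d V F u v P" "hd P = X" "last P = Y"
      using XY by (auto simp: tedge_def)
    have tp: "tpath d V F P" "P \<noteq> []" using P by (auto simp: min_tpath_def tpath_def)
    obtain x y where xy: "x \<in> nverts X - Q" "y \<in> nverts Y - Q"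
      using node_extra[of X Q] node_extra[of Y Q] XY Q by auto
    show ?thesis
    proof (cases "Inr Q \<in> set P")
      case False
      then have "conn Q x y"
        using tpath_conn[OF tp(1) Q, of X Y x y] xy P tp hd_in_set last_in_set by metis
      then show ?thesis using conn_base xy by blast
    next
      case True
      have QP: "Inr Q \<in> set (tl P)" "Inr Q \<in> set (butlast P)"
        using True XY P tp by (metis Diff_iff insertCI list.collapse set_ConsD,
            metis Diff_iff append_butlast_last_id in_set_butlast_appendI insertCI set_ConsD
              Un_iff empty_iff list.set(1) set_append)
      from P(2) show ?thesis
      proof (cases rule: min_tpath_ends)
        case (single X)
        then show ?thesis using QP by simp
      next
        case forward
        then have "u \<notin> Q" "v \<notin> Q" using QP nverts_simps(2) by metis+
        moreover have "u \<in> V" "v \<in> V" using forward P node_sub XY by blast+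
        ultimately show ?thesis using forward P
          by (intro bexI[of _ u] bexI[of _ v]) (auto intro!: reach_edge)
      next
        case backward
        then have "u \<notin> Q" "v \<notin> Q" using QP nverts_simps(2) by metis+
        moreover have "u \<in> V" "v \<in> V" using backward P node_sub XY by blast+
        ultimately show ?thesis using backward P
          by (intro bexI[of _ v] bexI[of _ u]) (auto intro!: reach_edge simp: insert_commute)
      qed
    qed
  qed
  have link: "\<exists>x\<in>nverts X - Q. \<exists>y\<in>nverts Y - Q. ?r x y"
    if XY: "X \<in> ?M" "Y \<in> ?M" "tree_plus_adj d V F E' X Y" for X Y
  proof -
    from XY(3) consider "tadj d V F X Y" | "tedge d V F E' X Y" | "tedge d V F E' Y X"
      by (auto simp: tree_plus_adj_def)
    then show ?thesis
    proof cases
      case 1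
      obtain x y where "x \<in> nverts X - Q" "y \<in> nverts Y - Q"
        using node_extra[of X Q] node_extra[of Y Q] XY Q by auto
      then obtain z where "z \<in> nverts X - Q" "z \<in> nverts Y - Q" using tadj_common[OF 1] by blast
      then show ?thesis by (intro bexI[of _ z]) auto
    next
      case 2
      then show ?thesis using edge XY by blast
    next
      case 3
      then show ?thesis using edge[of Y X] XY reach_sym by metis
    qed
  qed
  have "?r x y" if xy: "x \<in> V - Q" "y \<in> V - Q" for x y
  proof -
    obtain S S' where S: "S \<in> mc" "x \<in> S" "S' \<in> mc" "y \<in> S'" using vertex_in_mc xy by blast
    then have "reach nodes plus_edges (Inl S) (Inl S')"
      using tree_reach_plus[OF tree_connected] by simp
    then have "reach ?M plus_edges (Inl S) (Inl S')"
      using assms S Q by (auto simp: cut_vertex_reach)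
    then have "\<forall>z\<in>nverts (Inl S') - Q. ?r x z"
    proof (induction rule: reach_induct)
      case refl
      then show ?case using cl[of "Inl S"] S xy by auto
    next
      case (step Y Z)
      obtain y' z' where yz: "y' \<in> nverts Y - Q" "z' \<in> nverts Z - Q" "?r y' z'"
        using link[OF step(2,3)] step(4) by auto
      then show ?case using step cl[of Z z'] reach_trans by (metis DiffD1)
    qed
    then show ?thesis using S xy by auto
  qed
  then show ?thesis by (simp add: connected_on_reach)
qed

end

text \<open>After \<open>Q2\<close> the path runs in another component of \<open>V - Q2\<close>,
  because otherwise its next clique would be \<open>S2\<close> again by uniqueness.\<close>

lemma tpath_later:
  assumes "tpath d V F (Inl S2 # Inr Q2 # P)" "w \<in> S2" "w \<notin> Q2" "X \<in> set P"
  shows "w \<notin> nverts X"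
proof
  assume wX: "w \<in> nverts X"
  have ne: "P \<noteq> []" using assms(4) by auto
  have P: "tpath d V F P" "tadj d V F (Inr Q2) (hd P)" "Inl S2 \<notin> set P" "Inr Q2 \<notin> set P"
    "S2 \<in> mc" "Q2 \<in> seps" "Q2 \<subseteq> S2"
    using assms(1) ne by (auto simp: tpath_successively successively_Cons)
  then obtain S3 where S3: "hd P = Inl S3" "S3 \<in> mc" "Q2 \<subseteq> S3" by (cases "hd P") auto
  obtain t where t: "t \<in> S3 - Q2" using node_extra[of "Inl S3" Q2] S3 P by auto
  have "conn Q2 w t"
    using tpath_conn[OF P(1) P(6) P(4) assms(4), of "hd P" w t] hd_in_set[OF ne] S3 wX t assms by auto
  then have "S2 = S3"
    using mc_component_unique[OF P(6,5) S3(2) P(7) S3(3)] assms t by blast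
  then show False using P(3) S3 ne hd_in_set by metis
qed

end

section \<open>Generic frameworks\<close>

text \<open>Surjectivity is included so that points can be pulled back along the isometry.\<close>

definition isom :: "(real ^ 'n \<Rightarrow> real ^ 'n) \<Rightarrow> bool" where
  "isom A \<longleftrightarrow> (\<forall>x y. norm (A x - A y) = norm (x - y)) \<and> surj A"

lemma isom_inj: "isom A \<Longrightarrow> A x = A y \<Longrightarrow> x = y"
  unfolding isom_def by (metis norm_eq_zero right_minus_eq)

lemma norm_diff_eq_inner:
  fixes a b c d :: "'a :: real_inner"
  assumes "norm a = norm c" "norm b = norm d" "norm (a - b) = norm (c - d)"
  shows "a \<bullet> b = c \<bullet> d"
proof -
  have "(norm (a - b))\<^sup>2 = (norm (c - d))\<^sup>2" "(norm a)\<^sup>2 = (norm c)\<^sup>2" "(norm b)\<^sup>2 = (norm d)\<^sup>2"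
    using assms by simp_all
  then show ?thesis
    by (simp add: power2_norm_eq_inner inner_diff_left inner_diff_right inner_commute)
qed

locale generic_fw =
  fixes V :: "'a set" and p :: "'a \<Rightarrow> real ^ 'n"
  assumes finV: "finite V" and gen: "generic V p"
begin

section \<open>Coordinate fields and affine maps defined over them\<close>

definition FF :: "'a set \<Rightarrow> real set" where
  "FF W = fld ((\<lambda>(z, i). p z $ i) ` (W \<times> UNIV))"

lemma FF_mono: "W \<subseteq> W' \<Longrightarrow> FF W \<subseteq> FF W'"
  unfolding FF_def by (intro fld_mono) auto

lemmas FF_closed = fld_add[of _ "(\<lambda>(z, i). p z $ i) ` (W \<times> UNIV)" for W, folded FF_def]
  fld_minus[of _ "(\<lambda>(z, i). p z $ i) ` (W \<times> UNIV)" for W, folded FF_def]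
  fld_diff[of _ "(\<lambda>(z, i). p z $ i) ` (W \<times> UNIV)" for W, folded FF_def]
  fld_mult[of _ "(\<lambda>(z, i). p z $ i) ` (W \<times> UNIV)" for W, folded FF_def]
  fld_divide[of _ "(\<lambda>(z, i). p z $ i) ` (W \<times> UNIV)" for W, folded FF_def]
  fld_sum[of _ _ "(\<lambda>(z, i). p z $ i) ` (W \<times> UNIV)" for W, folded FF_def]

lemma FF_const: "0 \<in> FF W" "1 \<in> FF W"
  by (simp_all add: FF_def fld_zero fld_one)

lemma FF_point: "z \<in> W \<Longrightarrow> p z $ i \<in> FF W"
  unfolding FF_def by (rule fld_base) force

definition vecF :: "'a set \<Rightarrow> real ^ 'n \<Rightarrow> bool" where
  "vecF W x \<longleftrightarrow> (\<forall>i. x $ i \<in> FF W)"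

definition matF :: "'a set \<Rightarrow> real ^ 'n ^ 'n \<Rightarrow> bool" where
  "matF W M \<longleftrightarrow> (\<forall>i j. M $ i $ j \<in> FF W)"

lemma vecF_point: "z \<in> W \<Longrightarrow> vecF W (p z)"
  by (simp add: vecF_def FF_point)

lemma vecF_diff: "vecF W x \<Longrightarrow> vecF W y \<Longrightarrow> vecF W (x - y)"
  by (simp add: vecF_def FF_closed)

lemma vecF_add: "vecF W x \<Longrightarrow> vecF W y \<Longrightarrow> vecF W (x + y)"
  by (simp add: vecF_def FF_closed)

lemma vecF_minus: "vecF W x \<Longrightarrow> vecF W (- x)"
  by (simp add: vecF_def FF_closed)

lemma vecF_mult: "matF W M \<Longrightarrow> vecF W x \<Longrightarrow> vecF W (M *v x)"
  by (simp add: vecF_def matF_def matrix_vector_mult_def FF_closed)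

lemma FF_inner: "vecF W x \<Longrightarrow> vecF W y \<Longrightarrow> x \<bullet> y \<in> FF W"
  by (simp add: vecF_def inner_vec_def FF_closed)

lemma matF_mult: "matF W M \<Longrightarrow> matF W N \<Longrightarrow> matF W (M ** N)"
  by (simp add: matF_def matrix_matrix_mult_def FF_closed)

lemma matF_add: "matF W M \<Longrightarrow> matF W N \<Longrightarrow> matF W (M + N)"
  by (simp add: matF_def FF_closed)

lemma matF_diff: "matF W M \<Longrightarrow> matF W N \<Longrightarrow> matF W (M - N)"
  by (simp add: matF_def FF_closed)

lemma matF_double:
  assumes "matF W M" shows "matF W (2 *\<^sub>R M)"
proof -
  have "2 * a \<in> FF W" if "a \<in> FF W" for a
    using FF_closed(1)[OF that that] by simp
  then show ?thesis using assms by (simp add: matF_def)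
qed

lemma vecF_double:
  assumes "vecF W x" shows "vecF W (2 *\<^sub>R x)"
  using vecF_add[OF assms assms] by (simp add: scaleR_2)

lemma matF_id: "matF W (mat 1)"
  by (simp add: matF_def mat_def FF_const)

lemma vecF_mono: "vecF W x \<Longrightarrow> W \<subseteq> W' \<Longrightarrow> vecF W' x"
  using FF_mono[of W W'] by (auto simp: vecF_def)

lemma matF_mono: "matF W x \<Longrightarrow> W \<subseteq> W' \<Longrightarrow> matF W' x"
  using FF_mono[of W W'] by (auto simp: matF_def)

text \<open>For each \<open>k\<close>, the other coordinates of \<open>p w\<close> move to the
  right-hand side. What remains is a relation of degree one for \<open>p w $ k\<close>, so the
  coefficient \<open>a $ k\<close> is zero.\<close>

lemma inner_generic:
  assumes w: "w \<in> V" and a: "vecF (V - {w}) a" and b: "b \<in> FF (V - {w})" and eq: "a \<bullet> p w = b"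
  shows "a = 0"
proof -
  have "a $ k = 0" for k
  proof -
    let ?x = "\<lambda>(z, i). p z $ i" and ?I = "V \<times> (UNIV :: 'n set)"
    let ?F = "fld (?x ` (?I - {(w, k)}))"
    have sub: "FF (V - {w}) \<subseteq> ?F"
      unfolding FF_def by (intro fld_mono) auto
    have x: "p w $ i \<in> ?F" if "i \<noteq> k" for i
      using w that by (intro fld_base) force
    have "a \<bullet> p w = a $ k * p w $ k + (\<Sum>i\<in>UNIV - {k}. a $ i * p w $ i)"
      by (simp add: inner_vec_def sum.remove[of UNIV k])
    then have e: "a $ k * ?x (w, k) = b - (\<Sum>i\<in>UNIV - {k}. a $ i * p w $ i)"
      using eq by simp
    have "b - (\<Sum>i\<in>UNIV - {k}. a $ i * p w $ i) \<in> ?F"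
      using a b sub x by (intro fld_diff fld_sum fld_mult) (auto simp: vecF_def)
    moreover have "a $ k \<in> ?F" using a sub by (auto simp: vecF_def)
    ultimately show ?thesis
      using alg_indep_linear[of ?I ?x "(w, k)" "a $ k"] e gen w finV by (auto simp: generic_def)
  qed
  then show ?thesis by (simp add: vec_eq_iff)
qed

lemma matrix_generic:
  assumes w: "w \<in> V" and M: "matF (V - {w}) M" and c: "vecF (V - {w}) c" and eq: "M *v p w = c"
  shows "M = 0"
proof -
  have "M $ i = 0" for i
  proof (rule inner_generic[OF w])
    show "vecF (V - {w}) (M $ i)" using M by (simp add: matF_def vecF_def)
    show "c $ i \<in> FF (V - {w})" using c by (simp add: vecF_def)
    show "M $ i \<bullet> p w = c $ i" using eq by (auto simp: matrix_vector_mult_def inner_vec_def)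
  qed
  then show ?thesis by (simp add: vec_eq_iff)
qed

text \<open>The set \<open>W\<close> records on which points a product of reflections
  depends.\<close>

definition rat_aff :: "'a set \<Rightarrow> (real ^ 'n \<Rightarrow> real ^ 'n) \<Rightarrow> bool" where
  "rat_aff W B \<longleftrightarrow> (\<exists>M c. matF W M \<and> vecF W c \<and> (\<forall>x. B x = M *v x + c))"

lemma rat_aff_id: "rat_aff W (\<lambda>x. x)"
  unfolding rat_aff_def
  by (intro exI[of _ "mat 1"] exI[of _ 0]) (simp add: matF_id vecF_def FF_const)

lemma rat_aff_comp:
  assumes "rat_aff W B" "rat_aff W C" shows "rat_aff W (\<lambda>x. B (C x))"
proof -
  obtain M c where B: "matF W M" "vecF W c" "\<And>x. B x = M *v x + c"
    using assms(1) by (auto simp: rat_aff_def)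
  obtain N e where C: "matF W N" "vecF W e" "\<And>x. C x = N *v x + e"
    using assms(2) by (auto simp: rat_aff_def)
  show ?thesis unfolding rat_aff_def
    using B C
    by (intro exI[of _ "M ** N"] exI[of _ "M *v e + c"])
       (simp add: matF_mult vecF_add vecF_mult matrix_vector_mul_assoc matrix_vector_right_distrib)
qed

lemma rat_aff_mono: "rat_aff W B \<Longrightarrow> W \<subseteq> W' \<Longrightarrow> rat_aff W' B"
  unfolding rat_aff_def using matF_mono vecF_mono by blast

lemma rat_aff_vecF: "rat_aff W B \<Longrightarrow> vecF W x \<Longrightarrow> vecF W (B x)"
  unfolding rat_aff_def using vecF_mult vecF_add by metis

text \<open>Being fixed is the equation \<open>(M - mat 1) *v p w = - c\<close>, linear in
  \<open>p w\<close> over the field of the other points. It is trivial, so \<open>M = mat 1\<close>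
  and \<open>c = 0\<close>.\<close>

lemma rat_aff_fixed:
  assumes "w \<in> V" "rat_aff (V - {w}) B" "B (p w) = p w"
  shows "B x = x"
proof -
  obtain M c where B: "matF (V - {w}) M" "vecF (V - {w}) c" "\<And>x. B x = M *v x + c"
    using assms(2) by (auto simp: rat_aff_def)
  have e: "(M - mat 1) *v p w = - c"
    using assms(3) B(3)[of "p w"] by (simp add: matrix_vector_mult_diff_rdistrib algebra_simps)
  have "M - mat 1 = 0"
    by (rule matrix_generic[OF assms(1) _ _ e]) (use B in \<open>auto intro: matF_diff matF_id vecF_minus\<close>)
  moreover from this have "c = 0" using e by simp
  ultimately show ?thesis using B(3) by simp
qed

text \<open>After squaring, \<open>p u \<bullet> p u\<close> cancels and a linear equation for
  \<open>p u\<close> remains. Its coefficient vector, twice \<open>p v - B (p v)\<close>, vanishes;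
  and a map defined without \<open>v\<close> that fixes \<open>p v\<close> is the identity.\<close>

lemma rat_aff_dist:
  assumes uv: "u \<in> V" "v \<in> V" "u \<noteq> v" and B: "rat_aff (V - {u, v}) B"
    and eq: "norm (p u - B (p v)) = norm (p u - p v)"
  shows "B x = x"
proof -
  have F: "vecF (V - {u}) (p v)" using uv by (intro vecF_point) auto
  have FB: "vecF (V - {u}) (B (p v))"
    by (rule rat_aff_vecF[OF rat_aff_mono[OF B] F]) auto
  have "(norm (p u - B (p v)))\<^sup>2 = (norm (p u - p v))\<^sup>2" using eq by simp
  then have e: "(2 *\<^sub>R (p v - B (p v))) \<bullet> p u = p v \<bullet> p v - B (p v) \<bullet> B (p v)"
    by (simp add: power2_norm_eq_inner inner_diff_left inner_diff_right inner_commute algebra_simps)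
  have "2 *\<^sub>R (p v - B (p v)) = 0"
    by (rule inner_generic[OF uv(1) _ _ e])
       (use F FB in \<open>auto intro: vecF_double vecF_diff FF_closed(3) FF_inner\<close>)
  then have "B (p v) = p v" by simp
  then show ?thesis using rat_aff_fixed[OF uv(2) rat_aff_mono[OF B]] by blast
qed

section \<open>Orthogonal projections over a coordinate field, and affine independence\<close>

lemma projection_span:
  assumes "\<And>b. b \<in> B \<Longrightarrow> P *v b = b" "x \<in> span B" shows "(P :: real ^ 'n ^ 'n) *v x = x"
  using assms(2)
proof (induction rule: span_induct_alt)
  case base
  then show ?case by simp
next
  case (step c x y)
  then show ?case by (simp add: assms(1) matrix_vector_right_distrib matrix_vector_mult_scaleR)
qed

text \<open>Gram-Schmidt without normalisation: dividing by \<open>n \<bullet> n\<close> stays in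
  the field, whereas unit vectors would require square roots.\<close>

lemma projection_exists:
  assumes "finite B" "\<And>b. b \<in> B \<Longrightarrow> vecF W b"
  shows "\<exists>P. matF W P \<and> (\<forall>b\<in>B. P *v b = b) \<and> (\<forall>x. P *v x \<in> span B)
    \<and> (\<forall>x y. x \<bullet> (P *v y) = (P *v x) \<bullet> y)"
  using assms
proof (induction B rule: finite_induct)
  case empty
  show ?case by (intro exI[of _ 0]) (simp add: matF_def FF_const)
next
  case (insert v B)
  then obtain P where P: "matF W P" "\<And>b. b \<in> B \<Longrightarrow> P *v b = b" "\<And>x. P *v x \<in> span B"
    "\<And>x y. x \<bullet> (P *v y) = (P *v x) \<bullet> y"
    by auto
  have fixes_span: "P *v x = x" if "x \<in> span B" for x
    using projection_span[OF P(2) that] .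
  define n where "n = v - P *v v"
  have nF: "vecF W n" using insert.prems P(1) by (auto simp: n_def intro: vecF_diff vecF_mult)
  have Pn: "P *v n = 0" using fixes_span[OF P(3)] by (simp add: n_def matrix_vector_mult_diff_distrib)
  have nP: "n \<bullet> (P *v x) = 0" for x using P(4)[of n x] Pn by simp
  \<comment> \<open>The projection onto the line of \<open>n\<close>. For \<open>n = 0\<close>
    division by zero makes it the zero matrix, which is also right.\<close>
  define N :: "real ^ 'n ^ 'n" where "N = (\<chi> i j. n $ i * n $ j / (n \<bullet> n))"
  have N: "N *v x = ((n \<bullet> x) / (n \<bullet> n)) *\<^sub>R n" for x
    by (simp add: vec_eq_iff N_def matrix_vector_mult_def inner_vec_def sum_distrib_left
        sum_distrib_right sum_divide_distrib mult_ac)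
  have NF: "matF W N" unfolding matF_def N_def
    using nF FF_inner[OF nF nF] by (auto simp: vecF_def intro!: FF_closed)
  have nv: "n \<bullet> v = n \<bullet> n" using nP[of v] by (simp add: n_def inner_diff_right inner_diff_left)
  have "n \<in> span (insert v B)"
    unfolding n_def using P(3)[of v] span_mono[of B "insert v B"]
    by (intro span_diff) (auto intro: span_base)
  then have "(P + N) *v x \<in> span (insert v B)" for x
    unfolding matrix_vector_mult_add_rdistrib N
    using P(3)[of x] span_mono[of B "insert v B"] by (intro span_add span_scale) auto
  moreover have "(P + N) *v b = b" if "b \<in> insert v B" for b
  proof (cases "b = v")
    case True
    then show ?thesis
      by (cases "n = 0") (auto simp: matrix_vector_mult_add_rdistrib N nv, auto simp: n_def)
  next
    case False
    then have "P *v b = b" using that P(2) by auto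
    moreover from this have "n \<bullet> b = 0" using nP[of b] by simp
    ultimately show ?thesis by (simp add: matrix_vector_mult_add_rdistrib N)
  qed
  moreover have "x \<bullet> ((P + N) *v y) = ((P + N) *v x) \<bullet> y" for x y
    by (simp add: matrix_vector_mult_add_rdistrib N inner_add_left inner_add_right P(4)[of x y] inner_commute)
  ultimately show ?case using P(1) NF by (intro exI[of _ "P + N"]) (auto intro: matF_add)
qed

text \<open>If \<open>p w - p z0\<close> lay in the span of the other differences, the projection
  onto that span would give a linear equation for \<open>p w\<close> over the other points.
  Genericity then makes the projection the identity, but fewer than \<open>CARD('n)\<close> vectors
  cannot span the space.\<close>

lemma affine_independent:
  assumes "Z \<subseteq> V" "z0 \<in> V" "z0 \<notin> Z" "card Z \<le> CARD('n)"
  shows "independent ((\<lambda>z. p z - p z0) ` Z) \<and> inj_on (\<lambda>z. p z - p z0) Z"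
proof -
  have "finite Z" using assms(1) finV finite_subset by blast
  then show ?thesis using assms
  proof (induction Z rule: finite_induct)
    case empty
    then show ?case by (simp add: independent_empty)
  next
    case (insert w Z)
    let ?f = "\<lambda>z. p z - p z0"
    have IH: "independent (?f ` Z)" "inj_on ?f Z" using insert by auto
    have cB: "card (?f ` Z) < CARD('n)" using insert IH(2) by (simp add: card_image)
    have Fv: "vecF (V - {w}) b" if "b \<in> ?f ` Z" for b
      using insert that by (auto intro!: vecF_diff vecF_point)
    have "vecF (V - {w}) (p z0)" using insert by (auto intro!: vecF_point)
    have fB: "finite (?f ` Z)" using insert(1) by simp
    obtain P where P: "matF (V - {w}) P" "\<And>b. b \<in> ?f ` Z \<Longrightarrow> P *v b = b"
      "\<And>x. P *v x \<in> span (?f ` Z)"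
      using projection_exists[of "?f ` Z" "V - {w}", OF fB Fv] by metis
    have nin: "?f w \<notin> span (?f ` Z)"
    proof
      assume "?f w \<in> span (?f ` Z)"
      then have "P *v (?f w) = ?f w" using projection_span P(2) by blast
      then have e: "(P - mat 1) *v p w = (P - mat 1) *v p z0"
        by (simp add: matrix_vector_mult_diff_distrib matrix_vector_mult_diff_rdistrib algebra_simps)
      have "P - mat 1 = 0"
        by (rule matrix_generic[OF _ _ _ e])
           (use insert P(1) \<open>vecF (V - {w}) (p z0)\<close> in \<open>auto intro: vecF_mult matF_diff matF_id\<close>)
      then have "x \<in> span (?f ` Z)" for x using P(3)[of x] by simp
      then have "span (?f ` Z) = UNIV" by blast
      then have "CARD('n) \<le> card (?f ` Z)"
        using dim_le_card[of UNIV "?f ` Z"] insert(1) by simp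
      then show False using cB by simp
    qed
    have "?f w \<notin> ?f ` Z" using nin span_base[of "?f w" "?f ` Z"] by blast
    then show ?case using IH nin insert(1,2)
      by (simp add: independent_insert)
  qed
qed

lemma spanning:
  assumes "Z \<subseteq> V" "z0 \<in> V" "z0 \<notin> Z" "card Z = CARD('n)"
  shows "span ((\<lambda>z. p z - p z0) ` Z) = UNIV"
proof -
  let ?f = "\<lambda>z. p z - p z0"
  have "independent (?f ` Z)" "card (?f ` Z) = CARD('n)"
    using affine_independent[OF assms(1-3)] assms(4) by (auto simp: card_image)
  then show ?thesis
    using card_ge_dim_independent[of "?f ` Z" UNIV] by auto
qed

section \<open>Points, reflections and isometries determined by distances\<close>

lemma pin_inner:
  assumes "norm (y - p z0) = norm (x - p z0)" "norm (y - p z) = norm (x - p z)"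
  shows "(y - x) \<bullet> (p z - p z0) = 0"
proof -
  have "(y - p z0) \<bullet> (p z - p z0) = (x - p z0) \<bullet> (p z - p z0)"
    by (rule norm_diff_eq_inner) (use assms in simp_all)
  then show ?thesis by (simp add: inner_diff_left)
qed

text \<open>By polarisation \<open>y - x\<close> is orthogonal to the differences of points of
  \<open>K\<close>, and by genericity these span the space.\<close>

lemma pin:
  assumes "K \<subseteq> V" "CARD('n) < card K" "\<And>z. z \<in> K \<Longrightarrow> norm (y - p z) = norm (x - p z)"
  shows "y = x"
proof -
  have finK: "finite K" using assms(1) finV finite_subset by blast
  obtain z0 where z0: "z0 \<in> K" using assms(2) by fastforce
  have "CARD('n) \<le> card (K - {z0})" using assms(2) z0 finK by simp
  then obtain Z where Z: "Z \<subseteq> K - {z0}" "card Z = CARD('n)" by (metis obtain_subset_with_card_n)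
  have sp: "span ((\<lambda>z. p z - p z0) ` Z) = UNIV"
    by (rule spanning) (use Z z0 assms(1) in auto)
  have "(y - x) \<bullet> (y - x) = 0"
  proof -
    have "y - x \<in> span ((\<lambda>z. p z - p z0) ` Z)" using sp by blast
    moreover have "orthogonal (y - x) b" if "b \<in> (\<lambda>z. p z - p z0) ` Z" for b
      using that pin_inner[of y z0 x] assms(3) z0 Z by (auto simp: orthogonal_def)
    ultimately show ?thesis using orthogonal_to_span by (metis orthogonal_def)
  qed
  then show ?thesis by simp
qed

text \<open>With \<open>P\<close> the projection onto the directions of the hyperplane through
  \<open>Q\<close>, the map \<open>2P - 1\<close> about \<open>p z0\<close> has coefficients in
  \<open>FF Q\<close>. Prescribed distances to the points of \<open>Q\<close> fix the component
  along the hyperplane and the length of the orthogonal one, which leaves two mirror images.\<close>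

lemma reflection_exists:
  assumes QV: "Q \<subseteq> V" and cQ: "card Q = CARD('n)"
  shows "\<exists>R. rat_aff Q R \<and> (\<forall>x y. norm (R x - R y) = norm (x - y)) \<and> (\<forall>x. R (R x) = x)
    \<and> (\<forall>z\<in>Q. R (p z) = p z) \<and> (\<forall>w\<in>V - Q. R (p w) \<noteq> p w)
    \<and> (\<forall>x y. (\<forall>z\<in>Q. norm (y - p z) = norm (x - p z)) \<longrightarrow> y = x \<or> y = R x)"
proof -
  have finQ: "finite Q" using QV finV finite_subset by blast
  obtain z0 where z0: "z0 \<in> Q" using cQ by fastforce
  define Z where "Z = Q - {z0}"
  define B where "B = (\<lambda>z. p z - p z0) ` Z"
  have cZ: "card Z = CARD('n) - 1" using z0 finQ cQ by (simp add: Z_def)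
  have Z: "Z \<subseteq> V" "z0 \<in> V" "z0 \<notin> Z" "card Z \<le> CARD('n)" using z0 QV cZ by (auto simp: Z_def)
  have indB: "independent B" and cB: "card B = CARD('n) - 1"
    using affine_independent[OF Z] cZ by (auto simp: B_def card_image)
  have finB: "finite B" using finQ by (simp add: B_def Z_def)
  have BF: "vecF Q b" if "b \<in> B" for b
    using that z0 by (auto simp: B_def Z_def intro!: vecF_diff vecF_point)
  then obtain P where P: "matF Q P" "\<And>b. b \<in> B \<Longrightarrow> P *v b = b" "\<And>x. P *v x \<in> span B"
    "\<And>x y. x \<bullet> (P *v y) = (P *v x) \<bullet> y"
    using projection_exists[of B Q, OF finB BF] by metis
  have PP: "P *v (P *v x) = P *v x" for x using projection_span[OF P(2) P(3)] .
  define L where "L x = 2 *\<^sub>R (P *v x) - x" for x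
  have LL: "L (L x) = x" for x
    by (simp add: L_def matrix_vector_mult_scaleR matrix_vector_mult_diff_distrib PP
        scaleR_diff_right)
  have L_diff: "L x - L y = L (x - y)" for x y
    by (simp add: L_def matrix_vector_mult_diff_distrib scaleR_diff_right)
  have "L x \<bullet> L x = x \<bullet> x" for x
    using P(4)[of x x] P(4)[of x "P *v x"] PP
    by (simp add: L_def inner_diff_left inner_diff_right inner_commute)
  then have L_norm: "norm (L x) = norm x" for x by (simp add: norm_eq_sqrt_inner)
  have L_B: "L b = b" if "b \<in> B" for b using P(2)[OF that] by (simp add: L_def scaleR_2)
  define R where "R x = p z0 + L (x - p z0)" for x
  have Rz: "R (p z) = p z" if "z \<in> Q" for z
  proof (cases "z = z0")
    case True
    then show ?thesis by (simp add: R_def L_def)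
  next
    case False
    then have "p z - p z0 \<in> B" using that by (auto simp: B_def Z_def)
    then show ?thesis using L_B by (simp add: R_def)
  qed
  have "L x = (2 *\<^sub>R P - mat 1) *v x" for x
    by (simp add: L_def matrix_vector_mult_diff_rdistrib scaleR_matrix_vector_assoc)
  then have "R x = (2 *\<^sub>R P - mat 1) *v x + (p z0 - (2 *\<^sub>R P - mat 1) *v p z0)" for x
    by (simp add: R_def matrix_vector_mult_diff_distrib)
  then have ratR: "rat_aff Q R"
    unfolding rat_aff_def using P(1) z0
    by (intro exI[of _ "2 *\<^sub>R P - mat 1"] exI[of _ "p z0 - (2 *\<^sub>R P - mat 1) *v p z0"])
       (auto intro: matF_double matF_diff matF_id vecF_diff vecF_mult vecF_point)
  have Rw: "R (p w) \<noteq> p w" if w: "w \<in> V - Q" for w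
  proof
    assume "R (p w) = p w"
    moreover have "rat_aff (V - {w}) R" by (rule rat_aff_mono[OF ratR]) (use w QV in auto)
    \<comment> \<open>A trivial reflection would make \<open>P\<close> the identity, although only
      \<open>CARD('n) - 1\<close> vectors span its range.\<close>
    ultimately have "R x = x" for x using rat_aff_fixed w by blast
    from this[of "_ + p z0"] have "L x = x" for x by (simp add: R_def)
    then have "2 *\<^sub>R (P *v x) = 2 *\<^sub>R x" for x
      by (simp add: L_def diff_eq_eq scaleR_2)
    then have "P *v x = x" for x by (metis scaleR_cancel_left zero_neq_numeral)
    then have "x \<in> span B" for x using P(3)[of x] by simp
    then have "span B = UNIV" by blast
    then have "CARD('n) \<le> card B" using dim_le_card[of UNIV B] finB by simp
    moreover have "CARD('n) > 0" by simp
    ultimately show False using cB by linarith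
  qed
  have dich: "y = x \<or> y = R x" if xy: "\<And>z. z \<in> Q \<Longrightarrow> norm (y - p z) = norm (x - p z)" for x y
  proof -
    define a where "a = x - p z0"
    define b where "b = y - p z0"
    have ab: "orthogonal (b - a) s" if "s \<in> span B" for s
      using that
    proof (rule orthogonal_to_span)
      fix t assume "t \<in> B"
      then show "orthogonal (b - a) t"
        using pin_inner[of y z0 x] xy z0 by (auto simp: B_def Z_def a_def b_def orthogonal_def)
    qed
    have nab: "b \<bullet> b = a \<bullet> a" using xy[OF z0] by (simp add: a_def b_def norm_eq_sqrt_inner)
    have "(P *v (b - a)) \<bullet> (P *v (b - a)) = 0"
      using P(4)[of "P *v (b - a)" "b - a"] PP ab[OF P(3), of "b - a"]
        inner_commute[of "b - a" "P *v (b - a)"] by (simp add: orthogonal_def)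
    then have Pab: "P *v b = P *v a" by (simp add: matrix_vector_mult_diff_distrib)
    \<comment> \<open>The components of \<open>a\<close> and \<open>b\<close> orthogonal to the
      hyperplane: they have equal length and lie on one line.\<close>
    define u where "u = a - P *v a"
    define v where "v = b - P *v b"
    have orth: "(c - P *v c) \<bullet> s = 0" if "s \<in> span B" for c s
      using projection_span[OF P(2) that] P(4)[of c s] by (simp add: inner_diff_left)
    have ou: "u \<bullet> s = 0" "v \<bullet> s = 0" if "s \<in> span B" for s
      using orth[OF that] by (simp_all add: u_def v_def)
    have uv: "u \<bullet> u = v \<bullet> v"
    proof -
      have "c \<bullet> c = (P *v c) \<bullet> (P *v c) + (c - P *v c) \<bullet> (c - P *v c)" for c
        using orth[OF P(3), of c c] by (simp add: inner_diff_left inner_diff_right inner_commute)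
      from this[of a] this[of b] show ?thesis using nab Pab by (simp add: u_def v_def)
    qed
    have "v = u \<or> v = - u"
    proof (cases "u = 0")
      case True
      then show ?thesis using uv by simp
    next
      case False
      have nu: "u \<notin> span B" using ou(1)[of u] False by auto
      then have "independent (insert u B)" using indB by (simp add: independent_insert)
      moreover have "u \<notin> B" using nu span_base[of u B] by blast
      then have "card (insert u B) = CARD('n)" using cB finB by simp
      ultimately have "span (insert u B) = UNIV"
        using card_ge_dim_independent[of "insert u B" UNIV] by auto
      then obtain k where k: "v - k *\<^sub>R u \<in> span B"
        using span_breakdown_eq[of v u B] by blast
      \<comment> \<open>The vector lies in \<open>span B\<close> and is orthogonal to it.\<close>
      have "(v - k *\<^sub>R u) \<bullet> (v - k *\<^sub>R u) = 0"
        using ou[OF k] by (simp add: inner_diff_left)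
      then have vk: "v = k *\<^sub>R u" by simp
      then have "u \<bullet> u = k * k * (u \<bullet> u)" using uv by simp
      then have "k * k = 1" using False by simp
      then have "k = 1 \<or> k = - 1" by (metis mult_1_right square_eq_1_iff)
      then show ?thesis using vk by auto
    qed
    then show ?thesis
    proof
      assume "v = u"
      then have "a = b" using Pab by (simp add: u_def v_def)
      then show ?thesis by (simp add: a_def b_def)
    next
      assume "v = - u"
      have "b = P *v b + v" by (simp add: v_def)
      also have "\<dots> = P *v a + (P *v a - a)" unfolding Pab \<open>v = - u\<close> by (simp add: u_def)
      also have "\<dots> = L a" by (simp only: L_def scaleR_2 add_diff_eq)
      finally have "b = L a" .
      then show ?thesis by (simp add: a_def b_def R_def algebra_simps)
    qed
  qed
  have "norm (R x - R y) = norm (x - y)" for x y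
    using L_norm[of "x - y"] L_diff[of "x - p z0" "y - p z0"] by (simp add: R_def)
  moreover have "R (R x) = x" for x by (simp add: R_def LL)
  ultimately show ?thesis using ratR Rz Rw dich by (intro exI[of _ R]) auto
qed

lemma isom_unique:
  assumes "isom A" "K \<subseteq> V" "CARD('n) < card K" "\<And>z. z \<in> K \<Longrightarrow> norm (t - A (p z)) = norm (s - p z)"
  shows "t = A s"
proof -
  obtain y where y: "t = A y" using assms(1) unfolding isom_def surj_def by blast
  have "y = s"
    by (rule pin[OF assms(2,3)]) (use assms(1,4) y in \<open>simp add: isom_def\<close>)
  then show ?thesis using y by simp
qed

text \<open>A linear map prescribed on a basis of differences preserves inner products there by
  polarisation, hence everywhere. The other points of \<open>K\<close> are then pinned by their
  distances to the chosen ones.\<close>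

lemma isom_exists:
  assumes K: "K \<subseteq> V" "CARD('n) < card K"
    and q: "\<And>z z'. z \<in> K \<Longrightarrow> z' \<in> K \<Longrightarrow> norm (q z - q z') = norm (p z - p z')"
  shows "\<exists>A. isom A \<and> (\<forall>z\<in>K. A (p z) = q z)"
proof -
  have finK: "finite K" using K(1) finV finite_subset by blast
  obtain z0 where z0: "z0 \<in> K" using K(2) by fastforce
  have "CARD('n) \<le> card (K - {z0})" using K(2) z0 finK by simp
  then obtain Z where Z: "Z \<subseteq> K - {z0}" "card Z = CARD('n)" by (metis obtain_subset_with_card_n)
  let ?f = "\<lambda>z. p z - p z0"
  have ZV: "Z \<subseteq> V" "z0 \<in> V" "z0 \<notin> Z" using Z z0 K by auto
  have sp: "span (?f ` Z) = UNIV" by (rule spanning[OF ZV Z(2)])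
  have ind: "independent (?f ` Z)" and inj: "inj_on ?f Z"
    using affine_independent[OF ZV] Z(2) by auto
  obtain g where g: "linear g" "\<forall>b\<in>?f ` Z. g b = q (the_inv_into Z ?f b) - q z0"
    using linear_independent_extend[OF ind, of "\<lambda>b. q (the_inv_into Z ?f b) - q z0"] by blast
  have gz: "g (?f z) = q z - q z0" if "z \<in> Z" for z
    using g(2) that the_inv_into_f_f[OF inj that] by simp
  have g_inner: "g (?f z) \<bullet> g (?f z') = ?f z \<bullet> ?f z'" if "z \<in> Z" "z' \<in> Z" for z z'
    unfolding gz[OF that(1)] gz[OF that(2)]
    by (rule norm_diff_eq_inner) (use q that Z z0 in auto)
  have g1: "g x \<bullet> g (?f z) = x \<bullet> ?f z" if "z \<in> Z" for x z
  proof -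
    have "x \<in> span (?f ` Z)" using sp by simp
    then show ?thesis
    proof (induction rule: span_induct_alt)
      case base
      then show ?case by (simp add: linear_0[OF g(1)])
    next
      case (step c x y)
      then show ?case using g_inner that
        by (auto simp: linear_add[OF g(1)] linear_cmul[OF g(1)] inner_add_left)
    qed
  qed
  have g2: "g x \<bullet> g y = x \<bullet> y" for x y
  proof -
    have "y \<in> span (?f ` Z)" using sp by simp
    then show ?thesis
    proof (induction rule: span_induct_alt)
      case base
      then show ?case by (simp add: linear_0[OF g(1)])
    next
      case (step c x y)
      then show ?case using g1
        by (auto simp: linear_add[OF g(1)] linear_cmul[OF g(1)] inner_add_right)
    qed
  qed
  have orth: "orthogonal_transformation g"
    unfolding orthogonal_transformation_def using g(1) g2 by blast
  define A where "A x = g (x - p z0) + q z0" for x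
  have "norm (A x - A y) = norm (x - y)" for x y
    using orthogonal_transformation_norm[OF orth, of "x - y"]
    by (simp add: A_def linear_diff[OF g(1), symmetric])
  moreover have "surj A"
  proof (rule surjI)
    show "A (inv g (y - q z0) + p z0) = y" for y
      using orthogonal_transformation_surj[OF orth] by (simp add: A_def surj_f_inv_f)
  qed
  ultimately have isA: "isom A" by (simp add: isom_def)
  have Az: "A (p z) = q z" if "z \<in> insert z0 Z" for z
    using that gz by (auto simp: A_def linear_0[OF g(1)])
  have "A (p z) = q z" if z: "z \<in> K" for z
  proof (rule sym, rule isom_unique[OF isA, of "insert z0 Z"])
    show "insert z0 Z \<subseteq> V" using ZV by auto
    show "CARD('n) < card (insert z0 Z)" using ZV Z finK finite_subset[of Z V] finV by simp
    fix z' assume z': "z' \<in> insert z0 Z"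
    then have "z' \<in> K" using Z z0 by auto
    then show "norm (q z - A (p z')) = norm (p z - p z')" using Az[OF z'] q z by simp
  qed
  then show ?thesis using isA by blast
qed

text \<open>\<open>A'\<close> is determined by its values on \<open>Q\<close> and one more vertex
  \<open>t\<close>. Pulled back along \<open>A\<close>, the image of \<open>p t\<close> has the same
  distances to \<open>Q\<close> as \<open>p t\<close>, so it is \<open>p t\<close> or its mirror
  image.\<close>

lemma isom_two:
  assumes A: "isom A" "isom A'" and Q: "Q \<subseteq> V" "card Q = CARD('n)"
    and R: "\<forall>x y. norm (R x - R y) = norm (x - y)"
      "\<forall>x. R (R x) = x" "\<forall>z\<in>Q. R (p z) = p z"
      "\<forall>x y. (\<forall>z\<in>Q. norm (y - p z) = norm (x - p z)) \<longrightarrow> y = x \<or> y = R x"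
    and t: "t \<in> V - Q" and eq: "\<And>z. z \<in> Q \<Longrightarrow> A' (p z) = A (p z)"
  shows "A' = A \<or> A' = (\<lambda>x. A (R x))"
proof -
  have finQ: "finite Q" using Q finV finite_subset by blast
  obtain y where y: "A' (p t) = A y" using A(1) unfolding isom_def surj_def by metis
  have K: "insert t Q \<subseteq> V" "CARD('n) < card (insert t Q)" using t Q finQ by auto
  have "norm (y - p z) = norm (p t - p z)" if "z \<in> Q" for z
    using A that eq y unfolding isom_def by metis
  then consider "y = p t" | "y = R (p t)" using R(4) by blast
  then show ?thesis
  proof cases
    case 1
    have "A' x = A x" for x
      by (rule isom_unique[OF A(1) K]) (use 1 y eq A in \<open>auto simp: isom_def, metis+\<close>)
    then show ?thesis by blast
  next
    case 2
    have surjR: "surj R" using R(2) by (metis surjI)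
    have "isom (\<lambda>x. A (R x))"
      unfolding isom_def
    proof
      show "\<forall>x y. norm (A (R x) - A (R y)) = norm (x - y)" using A(1) R(1) by (simp add: isom_def)
      show "surj (\<lambda>x. A (R x))" using A(1) comp_surj[OF surjR, of A] by (simp add: isom_def comp_def)
    qed
    moreover have e: "A' (p z) = A (R (p z))" if "z \<in> insert t Q" for z
      using that 2 y eq R(3) by auto
    ultimately have "A' x = A (R x)" for x
      by (intro isom_unique[OF _ K, of "\<lambda>x. A (R x)"]) (use A in \<open>auto simp: isom_def simp flip: e\<close>)
    then show ?thesis by blast
  qed
qed

text \<open>Edges leaving the reflected component end in \<open>Q\<close>, whose points are fixed.
  The reflection is defined without \<open>u\<close> and \<open>v\<close>, so keeping their distance
  would make it fix \<open>p v\<close>.\<close>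

lemma reflected_framework:
  assumes E: "E \<subseteq> all_pairs V" and Q: "Q \<subseteq> V" "card Q = CARD('n)"
    and uv: "u \<in> V - Q" "v \<in> V - Q" "\<not> reach (V - Q) E u v"
  shows "\<exists>q. equivalent_fw E p q \<and> norm (q u - q v) \<noteq> norm (p u - p v)"
proof -
  obtain R where R: "rat_aff Q R" "\<And>x y. norm (R x - R y) = norm (x - y)"
    "\<And>z. z \<in> Q \<Longrightarrow> R (p z) = p z" "\<And>w. w \<in> V - Q \<Longrightarrow> R (p w) \<noteq> p w"
    using reflection_exists[OF Q] by blast
  let ?C = "reach (V - Q) E v"
  define q where "q x = (if ?C x then R (p x) else p x)" for x
  have C: "x \<in> V - Q" if "?C x" for x using reach_mem[OF that uv(2)] .
  have border: "norm (p x - R (p y)) = norm (p x - p y)" if "{x, y} \<in> E" "\<not> ?C x" "?C y" for x y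
  proof -
    have "x \<in> V" using E that(1) by (auto simp: all_pairs_def doubleton_eq_iff)
    moreover have "x \<notin> V - Q"
      using that C[OF that(3)] reach_trans[OF that(3) reach_edge[of y "V - Q" x E]]
      by (auto simp: insert_commute)
    ultimately have "R (p x) = p x" using R(3) by blast
    then show ?thesis using R(2)[of "p x" "p y"] by simp
  qed
  have "norm (p x - p y) = norm (q x - q y)" if e: "{x, y} \<in> E" for x y
    using border[of x y] border[of y x] e R(2)
    by (auto simp: q_def insert_commute norm_minus_commute)
  then have "equivalent_fw E p q" by (simp add: equivalent_fw_def)
  moreover have "norm (q u - q v) \<noteq> norm (p u - p v)"
  proof
    assume eq: "norm (q u - q v) = norm (p u - p v)"
    have "\<not> ?C u" using uv reach_sym by metis
    then have "norm (p u - R (p v)) = norm (p u - p v)" using eq by (simp add: q_def)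
    moreover have "u \<noteq> v" using uv by auto
    moreover have "rat_aff (V - {u, v}) R" by (rule rat_aff_mono[OF R(1)]) (use uv Q in auto)
    ultimately have "R (p v) = p v" using rat_aff_dist uv by blast
    then show False using R(4) uv by blast
  qed
  ultimately show ?thesis by blast
qed

end

section \<open>Rigidity along the tree\<close>

text \<open>If the new vertex \<open>v\<close> is linked to a non-neighbour \<open>y\<close>, it has
  more than \<open>CARD('n)\<close> neighbours; they form a clique and determine an isometry. It
  carries \<open>p v\<close> to \<open>q v\<close> because of the edges at \<open>v\<close>, and
  \<open>p y\<close> to \<open>q y\<close> by induction, since each neighbour of \<open>v\<close> is
  linked to \<open>y\<close>.\<close>

lemma (in generic_fw) ns_dist:
  assumes "finite W" "chordal W E" "loopfree E" "k_connected CARD('n) W E" "W \<subseteq> V"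
    and eq: "equivalent_fw E p q" and "x \<in> W" "y \<in> W" "ns CARD('n) W E x y"
  shows "norm (q x - q y) = norm (p x - p y)"
proof -
  have edge: "norm (q x - q y) = norm (p x - p y)" if "{x, y} \<in> E" for x y
    using eq that by (simp add: equivalent_fw_def)
  have d1: "CARD('n) \<ge> 1" by (simp add: Suc_leI)
  \<comment> \<open>Genericity concerns the fixed set \<open>V\<close>; only the vertex set
    \<open>W\<close> of the graph grows in the induction.\<close>
  have "W \<subseteq> V \<longrightarrow> (\<forall>x\<in>W. \<forall>y\<in>W. ns CARD('n) W E x y \<longrightarrow> norm (q x - q y) = norm (p x - p y))"
    using assms(1-4)
  proof (induction rule: chordal_connected_induct)
    case (complete W)
    have "norm (q x - q y) = norm (p x - p y)" if "x \<in> W" "y \<in> W" for x y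
      using edge[of x y] complete(3) that by (cases "x = y") (auto simp: clique_def)
    then show ?case by blast
  next
    case (simplicial W v)
    note st = simplicial(1,2) assms(3) simplicial(3) d1 simplicial(4,5)
    show ?case
    proof (intro impI)
      assume WV: "insert v W \<subseteq> V"
      have IH: "norm (q x - q y) = norm (p x - p y)" if "x \<in> W" "y \<in> W" "ns CARD('n) W E x y" for x y
        using simplicial(6) WV that by auto
      have new: "norm (q v - q y) = norm (p v - p y)"
        if y: "y \<in> W" and nsy: "ns CARD('n) (insert v W) E v y" for y
      proof (cases "y \<in> nb W E v")
        case True
        then show ?thesis using edge by (simp add: nb_def)
      next
        case False
        let ?K = "nb W E v"
        have K: "?K \<subseteq> V" "CARD('n) < card ?K"
          using WV ns_step_card[OF st nsy y False] by (auto simp: nb_def)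
        have "norm (q z - q z') = norm (p z - p z')" if "z \<in> ?K" "z' \<in> ?K" for z z'
          using edge[of z z'] simplicial(3) that by (cases "z = z'") (auto simp: clique_def)
        then obtain A where A: "isom A" "\<And>z. z \<in> ?K \<Longrightarrow> A (p z) = q z"
          using isom_exists[OF K, of q] by auto
        have "q v = A (p v)"
        proof (rule isom_unique[OF A(1) K])
          fix z assume z: "z \<in> ?K"
          then show "norm (q v - A (p z)) = norm (p v - p z)"
            using edge[of v z] A(2) by (simp add: nb_def)
        qed
        moreover have "q y = A (p y)"
        proof (rule isom_unique[OF A(1) K])
          fix z assume z: "z \<in> ?K"
          then have "ns CARD('n) W E z y" using ns_step_nb[OF st nsy y] by simp
          then have "norm (q z - q y) = norm (p z - p y)" using IH z y by (simp add: nb_def)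
          then show "norm (q y - A (p z)) = norm (p y - p z)"
            using A(2)[OF z] by (simp add: norm_minus_commute)
        qed
        ultimately show ?thesis using A(1) by (simp add: isom_def)
      qed
      show "\<forall>x\<in>insert v W. \<forall>y\<in>insert v W. ns CARD('n) (insert v W) E x y \<longrightarrow>
        norm (q x - q y) = norm (p x - p y)"
      proof (intro ballI impI)
        fix x y assume xy: "x \<in> insert v W" "y \<in> insert v W" and nsxy: "ns CARD('n) (insert v W) E x y"
        consider "x = y" | "x = v" "y \<in> W" | "y = v" "x \<in> W" | "x \<in> W" "y \<in> W" using xy by blast
        then show "norm (q x - q y) = norm (p x - p y)"
        proof cases
          case 2
          then show ?thesis using new nsxy by simp
        next
          case 3
          then show ?thesis using new[of x] ns_sym[OF nsxy] by (simp add: norm_minus_commute)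
        next
          case 4
          then show ?thesis using IH nsxy ns_step[OF st] by blast
        qed simp
      qed
    qed
  qed
  then show ?thesis using assms by blast
qed

locale loose_framework = loose_graph V F "CARD('n)" + generic_fw V p
  for V :: "'a set" and F and p :: "'a \<Rightarrow> real ^ 'n" +
  fixes q :: "'a \<Rightarrow> real ^ 'n"
  assumes qF: "{x, y} \<in> F \<Longrightarrow> norm (q x - q y) = norm (p x - p y)"
begin

text \<open>A maximal clique has more than \<open>CARD('n)\<close> points, so the isometry is unique
  and the choice harmless.\<close>

definition mc_isom :: "'a set \<Rightarrow> real ^ 'n \<Rightarrow> real ^ 'n" where
  "mc_isom S = (SOME A. isom A \<and> (\<forall>z\<in>S. A (p z) = q z))"

lemma mc_isom:
  assumes "S \<in> mc" shows "isom (mc_isom S)" "\<And>z. z \<in> S \<Longrightarrow> mc_isom S (p z) = q z"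
proof -
  have "norm (q z - q z') = norm (p z - p z')" if "z \<in> S" "z' \<in> S" for z z'
    using mc_clique[OF assms] qF that by (cases "z = z'") (auto simp: clique_def)
  then have "\<exists>A. isom A \<and> (\<forall>z\<in>S. A (p z) = q z)"
    using isom_exists[OF mc_sub max_card] assms by blast
  then have "isom (mc_isom S) \<and> (\<forall>z\<in>S. mc_isom S (p z) = q z)"
    unfolding mc_isom_def by (rule someI_ex)
  then show "isom (mc_isom S)" "\<And>z. z \<in> S \<Longrightarrow> mc_isom S (p z) = q z" by auto
qed

text \<open>Both isometries agree on the points of \<open>Q\<close>, which leaves the identity or
  the reflection. The change \<open>B\<close> is composed on the right so that it acts on
  \<open>p\<close> and is defined over \<open>FF Q\<close>.\<close>

lemma mc_isom_step:
  assumes "Q \<in> seps" "S \<in> mc" "S' \<in> mc" "Q \<subseteq> S" "Q \<subseteq> S'"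
  shows "\<exists>B. rat_aff Q B \<and> mc_isom S' = (\<lambda>x. mc_isom S (B x)) \<and>
    (mc_isom S' \<noteq> mc_isom S \<longrightarrow>
      (\<forall>x. B (B x) = x) \<and> (\<forall>z\<in>Q. B (p z) = p z) \<and> (\<forall>w\<in>V - Q. B (p w) \<noteq> p w))"
proof -
  have Q: "Q \<subseteq> V" "card Q = CARD('n)" using sepD[OF assms(1)] by auto
  obtain R where R: "rat_aff Q R" "\<forall>x y. norm (R x - R y) = norm (x - y)" "\<forall>x. R (R x) = x"
    "\<forall>z\<in>Q. R (p z) = p z" "\<forall>w\<in>V - Q. R (p w) \<noteq> p w"
    "\<forall>x y. (\<forall>z\<in>Q. norm (y - p z) = norm (x - p z)) \<longrightarrow> y = x \<or> y = R x"
    using reflection_exists[OF Q] by (elim exE conjE) (rule that)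
  obtain t where "t \<in> S - Q" using node_extra[of "Inl S" Q] assms by auto
  then have t: "t \<in> V - Q" using mc_sub assms by blast
  have agree: "mc_isom S' (p z) = mc_isom S (p z)" if "z \<in> Q" for z
  proof -
    have "z \<in> S" "z \<in> S'" using assms that by auto
    then show ?thesis using mc_isom(2)[OF assms(2)] mc_isom(2)[OF assms(3)] by simp
  qed
  have "mc_isom S' = mc_isom S \<or> mc_isom S' = (\<lambda>x. mc_isom S (R x))"
    by (rule isom_two[OF mc_isom(1)[OF assms(2)] mc_isom(1)[OF assms(3)] Q R(2,3,4,6) t agree])
  then consider "mc_isom S' = mc_isom S" | "mc_isom S' = (\<lambda>x. mc_isom S (R x))" by (elim disjE)
  then show ?thesis
  proof cases
    case 1
    then show ?thesis by (intro exI[of _ "\<lambda>x. x"]) (simp add: rat_aff_id)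
  next
    case 2
    then show ?thesis using R(1,3-5) by (intro exI[of _ R]) simp
  qed
qed

text \<open>Paths alternate between cliques and separators, so inductions remove one of each at a
  time.\<close>

lemma tpath_cases:
  assumes "tpath CARD('n) V F P" "hd P = Inl S" "last P = Inl S'"
  obtains "P = [Inl S]" "S = S'" "S \<in> mc"
  | Q S2 P2 where "P = Inl S # Inr Q # P2" "tpath CARD('n) V F P2" "hd P2 = Inl S2" "last P2 = Inl S'"
    "Q \<in> seps" "S \<in> mc" "S2 \<in> mc" "Q \<subseteq> S" "Q \<subseteq> S2" "Inl S \<notin> set P2" "Inr Q \<notin> set P2" "P2 \<noteq> []"
proof (cases "tl P = []")
  case True
  then have "P = [Inl S]" using assms by (cases P) (auto simp: tpath_def)
  then show ?thesis using that(1) assms by (auto simp: tpath_def)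
next
  case False
  then obtain Y P2 where P: "P = Inl S # Y # P2"
    using assms by (metis list.collapse list.sel(2))
  have t1: "tpath CARD('n) V F (Y # P2)" "tadj CARD('n) V F (Inl S) Y" "Inl S \<notin> set (Y # P2)"
    using assms(1) tpath_append[of "[Inl S]" "Y # P2"] P by auto
  then obtain Q where Y: "Y = Inr Q" "Q \<in> seps" "S \<in> mc" "Q \<subseteq> S" by (cases Y) auto
  have ne: "P2 \<noteq> []" using assms(3) P Y by auto
  then have t2: "tpath CARD('n) V F P2" "tadj CARD('n) V F (Inr Q) (hd P2)" "Inr Q \<notin> set P2"
    using t1(1) tpath_append[of "[Y]" P2] Y by auto
  then obtain S2 where "hd P2 = Inl S2" "S2 \<in> mc" "Q \<subseteq> S2" by (cases "hd P2") auto
  then show ?thesis using that(2)[of Q P2 S2] P Y t1 t2 ne assms(3) by auto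
qed

lemma tpath_rat:
  assumes "tpath CARD('n) V F P" "hd P = Inl S" "last P = Inl S'"
    and "\<forall>Q. Inr Q \<in> set P \<longrightarrow> Q \<subseteq> W"
  shows "\<exists>B. rat_aff W B \<and> mc_isom S' = (\<lambda>x. mc_isom S (B x))"
  using assms
proof (induction "length P" arbitrary: P S rule: less_induct)
  case less
  from less.prems(1-3) show ?case
  proof (cases rule: tpath_cases)
    case 1
    then show ?thesis by (intro exI[of _ "\<lambda>x. x"]) (simp add: rat_aff_id)
  next
    case (2 Q S2 P2)
    obtain B where B: "rat_aff Q B" "mc_isom S2 = (\<lambda>x. mc_isom S (B x))"
      using mc_isom_step[OF 2(5-9)] by (elim exE conjE) (rule that)
    have "Q \<subseteq> W" using less.prems(4) 2 by simp
    then have BW: "rat_aff W B" using rat_aff_mono[OF B(1)] by simp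
    have len: "length P2 < length P" using 2(1) by simp
    have sub: "\<forall>Q'. Inr Q' \<in> set P2 \<longrightarrow> Q' \<subseteq> W" using less.prems(4) 2(1) by simp
    obtain C where C: "rat_aff W C" "mc_isom S' = (\<lambda>x. mc_isom S2 (C x))"
      using less.hyps[OF len 2(2-4) sub] by (elim exE conjE) (rule that)
    show ?thesis
      by (intro exI[of _ "\<lambda>x. B (C x)"]) (simp add: rat_aff_comp[OF BW C(1)] C(2) B(2))
  qed
qed

text \<open>If the isometries at both ends agree, consider the first separator Q at which a reflection
  happens. The remaining reflections compose to the reflection in Q. They do not involve a vertex w
  of Q outside the next separator, but fix p w, so by genericity they compose to the identity.\<close>

lemma tpath_rigid:
  assumes "tpath CARD('n) V F P" "hd P = Inl S" "last P = Inl S'" "mc_isom S' = mc_isom S"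
    and "Inl T \<in> set P"
  shows "mc_isom T = mc_isom S"
  using assms
proof (induction "length P" arbitrary: P S rule: less_induct)
  case less
  from less.prems(1-3) show ?case
  proof (cases rule: tpath_cases)
    case 1
    then show ?thesis using less.prems by simp
  next
    case (2 Q S2 P2)
    have "mc_isom S2 = mc_isom S"
    proof (rule ccontr)
      assume ne: "mc_isom S2 \<noteq> mc_isom S"
      obtain R where R0: "rat_aff Q R" "mc_isom S2 = (\<lambda>x. mc_isom S (R x))"
        "mc_isom S2 \<noteq> mc_isom S \<longrightarrow> (\<forall>x. R (R x) = x) \<and> (\<forall>z\<in>Q. R (p z) = p z)
          \<and> (\<forall>w\<in>V - Q. R (p w) \<noteq> p w)"
        using mc_isom_step[OF 2(5-9)] by (elim exE conjE) (rule that)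
      have R: "R (R x) = x" "z \<in> Q \<Longrightarrow> R (p z) = p z" "w \<in> V - Q \<Longrightarrow> R (p w) \<noteq> p w" for x z w
        using R0(3) ne by auto
      obtain t where "t \<in> S - Q" using node_extra[of "Inl S" Q] 2 by auto
      then have t: "t \<in> V - Q" using mc_sub 2 by blast
      from 2(2-4) show False
      proof (cases rule: tpath_cases)
        case 1
        then show ?thesis using ne less.prems(4) by simp
      next
        case t2: (2 Q2 S3 P3)
        have "Q2 \<noteq> Q" using 2 t2 by auto
        then obtain w where w: "w \<in> Q" "w \<notin> Q2" using sep_diff[of Q Q2] 2 t2 by blast
        have wV: "w \<in> V" using w 2 sepD(1) by blast
        have sub: "\<forall>Q'. Inr Q' \<in> set P2 \<longrightarrow> Q' \<subseteq> V - {w}"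
        proof (intro allI impI)
          fix Q' assume Q': "Inr Q' \<in> set P2"
          have "Q' \<in> seps" using Q' 2(2) by (auto simp: tpath_def)
          moreover have "w \<notin> Q'"
          proof (cases "Q' = Q2")
            case False
            then have "Inr Q' \<in> set P3" using Q' t2 by auto
            then show ?thesis using tpath_later[of S2 Q2 P3 w "Inr Q'"] 2 t2 w by auto
          qed (use w in simp)
          ultimately show "Q' \<subseteq> V - {w}" using sepD(1)[of Q'] by blast
        qed
        obtain B where B: "rat_aff (V - {w}) B" "mc_isom S' = (\<lambda>x. mc_isom S2 (B x))"
          using tpath_rat[OF 2(2-4) sub] by (elim exE conjE) (rule that)
        have "mc_isom S (R (B x)) = mc_isom S x" for x
          using fun_cong[OF less.prems(4), of x] by (simp add: B(2) R0(2))
        then have RB: "R (B x) = x" for x by (rule isom_inj[OF mc_isom(1)[OF 2(6)]])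
        have BR: "B x = R x" for x using R(1)[of "B x"] RB[of x] by simp
        have "B (p w) = p w" using BR R(2) w by simp
        then have "B (p t) = p t" by (rule rat_aff_fixed[OF wV B(1)])
        then show False using BR R(3) t by simp
      qed
    qed
    moreover have "length P2 < length P" using 2(1) by simp
    ultimately have "mc_isom T = mc_isom S" if "Inl T \<in> set P2"
      using less.hyps[OF _ 2(2-4) _ that] less.prems(4) by simp
    then show ?thesis using less.prems(5) 2(1) by auto
  qed
qed

text \<open>The ends of the path are cliques, as a separator at an end would be contained in the
  next node. All separators on the path therefore avoid \<open>x\<close> and \<open>y\<close>, and
  the length of \<open>xy\<close> makes the product of reflections trivial. The neighbours of
  \<open>Q\<close> on the path are the wanted cliques.\<close>

lemma edge_rigid_path:
  assumes P: "tpath CARD('n) V F P" "hd P \<noteq> last P" "x \<in> nverts (hd P)" "y \<in> nverts (last P)"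
    and x: "\<And>X. X \<in> set (tl P) \<Longrightarrow> x \<notin> nverts X" and y: "\<And>X. X \<in> set (butlast P) \<Longrightarrow> y \<notin> nverts X"
    and eq: "norm (q x - q y) = norm (p x - p y)"
    and Q: "Q \<in> seps" "x \<notin> Q" "y \<notin> Q" "\<not> conn Q x y"
  obtains T T' t t' where "T \<in> mc" "T' \<in> mc" "Q \<subseteq> T" "Q \<subseteq> T'" "t \<in> T - Q" "t' \<in> T' - Q"
    "conn Q x t" "conn Q y t'" "mc_isom T = mc_isom T'"
proof -
  have ne: "P \<noteq> []" using P(1) by (simp add: tpath_def)
  have PN: "set P \<subseteq> nodes" using P(1) by (simp add: tpath_def)
  have hdP: "hd P \<in> set P" "last P \<in> set P" using ne by auto
  have xyV: "x \<in> V" "y \<in> V" using P(3,4) hdP PN node_sub by blast+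
  have xy: "x \<noteq> y" using Q by auto
  have tl: "tl P \<noteq> []" using P(2) ne by (cases P) auto
  have bl: "butlast P \<noteq> []" using tl ne by (cases P) auto
  obtain S where S: "hd P = Inl S"
  proof (cases "hd P")
    case (Inr Q')
    have "tadj CARD('n) V F (hd P) (hd (tl P))"
      using P(1) tpath_append[of "[hd P]" "tl P"] ne tl by auto
    then obtain S where "hd (tl P) = Inl S" "Q' \<subseteq> S" using Inr by (cases "hd (tl P)") auto
    moreover have "x \<notin> nverts (hd (tl P))" by (rule x) (use tl in simp)
    ultimately show ?thesis using P(3) Inr by auto
  qed (use that in blast)
  obtain S' where S': "last P = Inl S'"
  proof (cases "last P")
    case (Inr Q')
    have "tadj CARD('n) V F (last (butlast P)) (last P)"
      using P(1) tpath_append[of "butlast P" "[last P]"] ne bl by auto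
    then obtain S where "last (butlast P) = Inl S" "Q' \<subseteq> S" using Inr by (cases "last (butlast P)") auto
    moreover have "y \<notin> nverts (last (butlast P))" by (rule y) (use bl in simp)
    ultimately show ?thesis using P(4) Inr by auto
  qed (use that in blast)
  have mcS: "S \<in> mc" "S' \<in> mc" using S S' hdP PN by (metis subsetD tnodes_iff(1))+
  have sub: "\<forall>Q'. Inr Q' \<in> set P \<longrightarrow> Q' \<subseteq> V - {x, y}"
  proof (intro allI impI)
    fix Q' assume Q': "Inr Q' \<in> set P"
    have "Inr Q' \<noteq> hd P" "Inr Q' \<noteq> last P" using S S' by auto
    moreover have "set P = insert (hd P) (set (tl P))" using ne by (cases P) auto
    moreover have "set P = insert (last P) (set (butlast P))" using ne by (cases P rule: rev_cases) auto
    ultimately have "Inr Q' \<in> set (tl P)" "Inr Q' \<in> set (butlast P)" using Q' by auto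
    then have "x \<notin> Q'" "y \<notin> Q'" using x y by force+
    moreover have "Q' \<subseteq> V" using Q' PN node_sub by fastforce
    ultimately show "Q' \<subseteq> V - {x, y}" by blast
  qed
  obtain B where B: "rat_aff (V - {x, y}) B" "mc_isom S' = (\<lambda>x. mc_isom S (B x))"
    using tpath_rat[OF P(1) S S' sub] by (elim exE conjE) (rule that)
  have "q x = mc_isom S (p x)" using mc_isom(2)[OF mcS(1)] P(3) S by simp
  moreover have "q y = mc_isom S (B (p y))" using mc_isom(2)[OF mcS(2), of y] P(4) S' B(2) by simp
  ultimately have "norm (p x - B (p y)) = norm (p x - p y)"
    using eq mc_isom(1)[OF mcS(1)] by (simp add: isom_def)
  then have "B z = z" for z by (rule rat_aff_dist[OF xyV xy B(1)])
  then have same: "mc_isom S' = mc_isom S" using B(2) by simp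
  \<comment> \<open>A path avoiding the node \<open>Q\<close> would connect \<open>x\<close> to
    \<open>y\<close> off \<open>Q\<close>.\<close>
  have "Inr Q \<in> set P"
    using tpath_conn[OF P(1) Q(1) _ hdP, of x y] P(3,4) Q by blast
  then obtain P1 P2 where P12: "P = P1 @ Inr Q # P2" by (meson split_list)
  have ne1: "P1 \<noteq> []" using P12 S by auto
  have ne2: "P2 \<noteq> []" using P12 S' by auto
  have t1: "tpath CARD('n) V F P1" "tpath CARD('n) V F (Inr Q # P2)" "tadj CARD('n) V F (last P1) (Inr Q)"
    "Inr Q \<notin> set P1"
    using P(1) P12 tpath_append[of P1 "Inr Q # P2"] ne1 by auto
  have t2: "tpath CARD('n) V F P2" "tadj CARD('n) V F (Inr Q) (hd P2)" "Inr Q \<notin> set P2"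
    using t1(2) tpath_append[of "[Inr Q]" P2] ne2 by auto
  obtain T where T: "last P1 = Inl T" "T \<in> mc" "Q \<subseteq> T" using t1(3) by (cases "last P1") auto
  obtain T' where T': "hd P2 = Inl T'" "T' \<in> mc" "Q \<subseteq> T'" using t2(2) by (cases "hd P2") auto
  obtain t where t: "t \<in> T - Q" using node_extra[of "Inl T" Q] T Q by auto
  obtain t' where t': "t' \<in> T' - Q" using node_extra[of "Inl T'" Q] T' Q by auto
  have i1: "Inl T \<in> set P1" "hd P \<in> set P1" using T(1) ne1 P12 last_in_set[OF ne1] by auto
  have i2: "Inl T' \<in> set P2" "last P \<in> set P2" using T'(1) ne2 P12 hd_in_set[OF ne2] by auto
  have "conn Q x t" using tpath_conn[OF t1(1) Q(1) t1(4) i1(2,1), of x t] P(3) Q t by auto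
  moreover have "conn Q y t'" using tpath_conn[OF t2(1) Q(1) t2(3) i2(2,1), of y t'] P(4) Q t' by auto
  moreover have "mc_isom T = mc_isom S" by (rule tpath_rigid[OF P(1) S S' same]) (use i1 P12 in auto)
  moreover have "mc_isom T' = mc_isom S" by (rule tpath_rigid[OF P(1) S S' same]) (use i2 P12 in auto)
  ultimately show ?thesis using that[OF T(2) T'(2) T(3) T'(3) t t'] by simp
qed

lemma edge_rigid:
  assumes xyV: "x \<in> V" "y \<in> V" and eq: "norm (q x - q y) = norm (p x - p y)"
    and Q: "Q \<in> seps" "x \<notin> Q" "y \<notin> Q" "\<not> conn Q x y"
  obtains T T' t t' where "T \<in> mc" "T' \<in> mc" "Q \<subseteq> T" "Q \<subseteq> T'" "t \<in> T - Q" "t' \<in> T' - Q"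
    "conn Q x t" "conn Q y t'" "mc_isom T = mc_isom T'"
proof -
  obtain P where P: "min_tpath CARD('n) V F x y P" using min_tpath_exists xyV by blast
  have tP: "tpath CARD('n) V F P" using P by (simp add: min_tpath_def)
  from P show ?thesis
  proof (cases rule: min_tpath_ends)
    case (single X)
    then have "X \<in> nodes" using tP by (simp add: tpath_def)
    then have "conn Q x y" using clique_conn[OF node_clique] single Q by blast
    then show ?thesis using Q by simp
  next
    case forward
    show ?thesis
    proof (rule edge_rigid_path[OF tP forward eq Q])
      fix T T' t t'
      assume a: "T \<in> mc" "T' \<in> mc" "Q \<subseteq> T" "Q \<subseteq> T'" "t \<in> T - Q" "t' \<in> T' - Q"
        "conn Q x t" "conn Q y t'" "mc_isom T = mc_isom T'"
      show thesis by (rule that[OF a])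
    qed
  next
    case backward
    have eq': "norm (q y - q x) = norm (p y - p x)" using eq by (simp add: norm_minus_commute)
    have nc: "\<not> conn Q y x" using Q(4) reach_sym[of "V - Q" F y x] by blast
    show ?thesis
    proof (rule edge_rigid_path[OF tP backward eq' Q(1,3,2) nc])
      fix T T' t t'
      assume a: "T \<in> mc" "T' \<in> mc" "Q \<subseteq> T" "Q \<subseteq> T'" "t \<in> T - Q" "t' \<in> T' - Q"
        "conn Q y t" "conn Q x t'" "mc_isom T = mc_isom T'"
      show thesis by (rule that[OF a(2,1,4,3,6,5,8,7) a(9)[symmetric]])
    qed
  qed
qed

section \<open>Agreement of all clique isometries when every separator is crossed\<close>

context
  fixes D :: "'a set set"
  assumes D: "\<And>x y. {x, y} \<in> D \<Longrightarrow> norm (q x - q y) = norm (p x - p y)"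
    and connected: "\<And>Q. Q \<in> seps \<Longrightarrow> connected_on (V - Q) D"
begin

text \<open>A walk in \<open>D\<close> from \<open>s\<close> to \<open>s'\<close> off
  \<open>Q\<close> is followed from component to component. An edge inside a component changes
  nothing; for an edge between two components, the cliques around \<open>Q\<close> on its two sides
  have equal isometries.\<close>

lemma separator_rigid:
  assumes Q: "Q \<in> seps" and S: "S \<in> mc" "S' \<in> mc" "Q \<subseteq> S" "Q \<subseteq> S'"
  shows "mc_isom S' = mc_isom S"
proof -
  obtain s where s: "s \<in> S - Q" using node_extra[of "Inl S" Q] S Q by auto
  obtain s' where s': "s' \<in> S' - Q" using node_extra[of "Inl S'" Q] S Q by auto
  have "s \<in> V - Q" "s' \<in> V - Q" using s s' S mc_sub by blast+
  then have "reach (V - Q) D s s'" using connected[OF Q] by (simp add: connected_on_reach)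
  then have "\<forall>T\<in>mc. Q \<subseteq> T \<longrightarrow> (\<forall>t\<in>T - Q. conn Q s' t \<longrightarrow> mc_isom T = mc_isom S)"
  proof (induction rule: reach_induct)
    case refl
    then show ?case using mc_component_unique[OF Q S(1) _ S(3)] s by blast
  next
    case (step y z)
    show ?case
    proof (intro ballI impI)
      fix T t assume T: "T \<in> mc" "Q \<subseteq> T" "t \<in> T - Q" "conn Q z t"
      show "mc_isom T = mc_isom S"
      proof (cases "conn Q y z")
        case True
        then have "conn Q y t" using T(4) by (rule reach_trans)
        then show ?thesis using step(5) T by blast
      next
        case False
        have yz: "y \<in> V" "z \<in> V" "y \<notin> Q" "z \<notin> Q" using step by auto
        obtain T1 T2 t1 t2 where T12: "T1 \<in> mc" "T2 \<in> mc" "Q \<subseteq> T1" "Q \<subseteq> T2" "t1 \<in> T1 - Q" "t2 \<in> T2 - Q"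
          "conn Q y t1" "conn Q z t2" "mc_isom T1 = mc_isom T2"
          by (rule edge_rigid[OF yz(1,2) D[OF step(4)] Q yz(3,4) False])
        have "conn Q t2 t" by (rule reach_trans[OF reach_sym[OF T12(8)] T(4)])
        \<comment> \<open>A component has only one clique around \<open>Q\<close>, so the one found
          for the edge is the one in question.\<close>
        then have "T2 = T" using mc_component_unique[OF Q T12(2) T(1) T12(4) T(2) T12(6) T(3)] by blast
        moreover have "mc_isom T1 = mc_isom S" using step(5) T12 by blast
        ultimately show ?thesis using T12(9) by simp
      qed
    qed
  qed
  then show ?thesis using S(2,4) s' reach_refl[of "V - Q" F s'] by blast
qed

lemma all_rigid:
  assumes "S \<in> mc" "S' \<in> mc" shows "mc_isom S' = mc_isom S"
proof -
  have "reach nodes tedges (Inl S) (Inl S')" using assms tree_connected by simp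
  \<comment> \<open>Stated for all cliques containing the current node, the claim passes through
    separator nodes; at a clique node maximality leaves only that clique.\<close>
  then have "\<forall>T\<in>mc. nverts (Inl S') \<subseteq> T \<longrightarrow> mc_isom T = mc_isom S"
  proof (induction rule: reach_induct)
    case refl
    have "T = S" if "T \<in> mc" "S \<subseteq> T" for T
      using that assms(1) by (simp add: maximal_cliques_def)
    then show ?case by auto
  next
    case (step Y Z)
    show ?case
    proof (intro ballI impI)
      fix T assume T: "T \<in> mc" "nverts Z \<subseteq> T"
      show "mc_isom T = mc_isom S"
      proof (cases Z)
        case (Inl S1)
        then obtain Q where "Y = Inr Q" "Q \<subseteq> S1" using step(4) by (cases Y) auto
        then show ?thesis using step(5) T Inl by auto
      next
        case (Inr Q)
        then obtain S1 where S1: "Y = Inl S1" "Q \<subseteq> S1" "S1 \<in> mc" "Q \<in> seps" using step(4) by (cases Y) auto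
        then have "mc_isom T = mc_isom S1" using separator_rigid[of Q S1 T] T Inr by simp
        then show ?thesis using step(5) S1 by simp
      qed
    qed
  qed
  then show ?thesis using assms by simp
qed

lemma framework_rigid:
  assumes "x \<in> V" "y \<in> V" shows "norm (q x - q y) = norm (p x - p y)"
proof -
  obtain S S' where S: "S \<in> mc" "x \<in> S" "S' \<in> mc" "y \<in> S'" using vertex_in_mc assms by blast
  have "q x = mc_isom S (p x)" using mc_isom(2)[OF S(1,2)] by simp
  moreover have "q y = mc_isom S (p y)"
    using mc_isom(2)[OF S(3,4)] all_rigid[OF S(1,3)] by simp
  ultimately show ?thesis using mc_isom(1)[OF S(1)] by (simp add: isom_def)
qed

end

end

section \<open>The totally loose closure as the graph of linked pairs\<close>

definition closure_edges :: "nat \<Rightarrow> 'a set \<Rightarrow> 'a set set \<Rightarrow> 'a set set" where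
  "closure_edges d V E = {{x, y} | x y. x \<in> V \<and> y \<in> V \<and> x \<noteq> y \<and> ns d V E x y}"

lemma closure_edges_iff:
  "{x, y} \<in> closure_edges d V E \<longleftrightarrow> x \<in> V \<and> y \<in> V \<and> x \<noteq> y \<and> ns d V E x y"
  unfolding closure_edges_def by (auto simp: doubleton_eq_iff ns_sym)

lemma all_pairs_loopfree: "E \<subseteq> all_pairs V \<Longrightarrow> loopfree E"
  by (auto simp: loopfree_def all_pairs_def doubleton_eq_iff)

lemma all_pairsE:
  assumes "e \<in> all_pairs V" obtains x y where "e = {x, y}" "x \<in> V" "y \<in> V" "x \<noteq> y"
  using assms by (auto simp: all_pairs_def)

lemma subset_closure_edges:
  assumes "E \<subseteq> all_pairs V" shows "E \<subseteq> closure_edges d V E"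
proof
  fix e assume e: "e \<in> E"
  then have "e \<in> all_pairs V" using assms by blast
  then show "e \<in> closure_edges d V E"
    by (rule all_pairsE) (use e in \<open>auto simp: closure_edges_iff ns_edge\<close>)
qed

lemma closure_edges_subset: "closure_edges d V E \<subseteq> all_pairs V"
  by (auto simp: closure_edges_def all_pairs_def)

text \<open>The ends of an added edge are not separated by \<open>Q\<close>, so it joins vertices of
  one component.\<close>

lemma closure_reach:
  assumes "E \<subseteq> all_pairs V" "Q \<subseteq> V" "card Q = d"
  shows "reach (V - Q) (closure_edges d V E) x y \<longleftrightarrow> reach (V - Q) E x y"
proof
  assume "reach (V - Q) (closure_edges d V E) x y"
  then show "reach (V - Q) E x y"
  proof (induction rule: reach_induct)
    case (step y z)
    then have "reach (V - Q) E y z" using assms by (auto simp: closure_edges_iff ns_def)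
    with step(5) show ?case by (rule reach_trans)
  qed simp
next
  assume "reach (V - Q) E x y"
  then show "reach (V - Q) (closure_edges d V E) x y"
    by (rule reach_mono) (use subset_closure_edges[OF assms(1)] in auto)
qed

lemma separators_closure:
  assumes "E \<subseteq> all_pairs V"
  shows "separators d V (closure_edges d V E) = separators d V E"
proof -
  have "connected_on (V - Q) (closure_edges d V E) \<longleftrightarrow> connected_on (V - Q) E"
    if "Q \<subseteq> V" "card Q = d" for Q
    using closure_reach[OF assms that] by (simp add: connected_on_reach)
  then show ?thesis unfolding separators_def by blast
qed

text \<open>Facts about separators are transferred from G by the agreement of components. For
  \<open>max_card\<close>, at most \<open>d\<close> pairwise linked vertices can always be enlarged
  by another one.\<close>

lemma loose_graph_closure:
  assumes "finite V" "E \<subseteq> all_pairs V" "chordal V E" "k_connected d V E" "d \<ge> 1"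
  shows "loose_graph V (closure_edges d V E) d"
proof
  let ?F = "closure_edges d V E"
  have lfE: "loopfree E" by (rule all_pairs_loopfree[OF assms(2)])
  note base = assms(1,3) lfE assms(4,5)
  show "finite V" "d \<ge> 1" by fact+
  show "loopfree ?F" by (rule all_pairs_loopfree[OF closure_edges_subset])
  show "\<exists>Q. Q \<subseteq> V \<and> card Q = d \<and> x \<notin> Q \<and> y \<notin> Q \<and> \<not> reach (V - Q) ?F x y"
    if xy: "x \<in> V" "y \<in> V" "x \<noteq> y" "{x, y} \<notin> ?F" for x y
  proof -
    have "\<not> ns d V E x y" using xy by (simp add: closure_edges_iff)
    then show ?thesis using closure_reach[OF assms(2)] unfolding ns_def by blast
  qed
  show cl: "clique V ?F Q" if Q: "Q \<in> separators d V ?F" for Q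
  proof -
    have "clique V E Q"
      using separator_clique[OF base] Q unfolding separators_closure[OF assms(2)]
      by (simp add: separators_def)
    then show ?thesis using subset_closure_edges[OF assms(2), of d] unfolding clique_def by blast
  qed
  show "\<exists>w\<in>V - Q. reach (V - Q) ?F u w \<and> (\<forall>z\<in>Q. {w, z} \<in> ?F)"
    if Q: "Q \<in> separators d V ?F" and u: "u \<in> V - Q" for Q u
  proof -
    have Q': "Q \<subseteq> V" "card Q = d" using Q by (auto simp: separators_def)
    have "clique V E Q"
      using separator_clique[OF base] Q unfolding separators_closure[OF assms(2)]
      by (simp add: separators_def)
    then obtain w where "w \<in> V - Q" "reach (V - Q) E u w" "\<forall>z\<in>Q. {w, z} \<in> E"
      using clique_extend_component[OF base _ Q'(2) u] by blast
    then show ?thesis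
      using subset_closure_edges[OF assms(2), of d] closure_reach[OF assms(2) Q'] by blast
  qed
  show "d < card S" if S: "S \<in> maximal_cliques V ?F" for S
  proof (rule ccontr)
    assume "\<not> d < card S"
    then have c: "card S \<le> d" by simp
    have SV: "S \<subseteq> V" using S by (auto simp: maximal_cliques_def clique_def)
    have "ns d V E x y" if "x \<in> S" "y \<in> S" "x \<noteq> y" for x y
      using S that by (auto simp: maximal_cliques_def clique_def closure_edges_iff)
    then obtain w where w: "w \<in> V - S" "\<forall>s\<in>S. ns d V E w s"
      using ns_clique_extend[OF base SV _ c] by blast
    then have "clique V ?F (insert w S)"
      using S SV by (auto simp: maximal_cliques_def clique_def closure_edges_iff ns_sym)
    then have "insert w S = S" using S unfolding maximal_cliques_def by blast
    then show False using w by blast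
  qed
qed

text \<open>A pair that is not linked is loose by reflection in every generic realization.
  Conversely, a totally loose supergraph contains each linked pair, whose distance is already
  determined by \<open>E\<close>. So the linked pairs form the least such supergraph, and
  antisymmetry settles the definite description.\<close>

lemma tlc_eq_closure:
  fixes V :: "'a set"
  assumes "finite V" "E \<subseteq> all_pairs V" "chordal V E" "k_connected CARD('n::finite) V E"
  shows "tlc TYPE('n) V E = closure_edges CARD('n) V E"
proof -
  let ?F = "closure_edges CARD('n) V E"
  have loose: "totally_loose TYPE('n) V ?F"
    unfolding totally_loose_def
  proof (intro ballI impI)
    fix u v assume uv: "u \<in> V" "v \<in> V" "u \<noteq> v \<and> {u, v} \<notin> ?F"
    then have "\<not> ns CARD('n) V E u v" by (auto simp: closure_edges_iff)
    then obtain Q where Q: "Q \<subseteq> V" "card Q = CARD('n)" "u \<notin> Q" "v \<notin> Q" "\<not> reach (V - Q) E u v"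
      unfolding ns_def by blast
    then have nr: "\<not> reach (V - Q) ?F u v" using closure_reach[OF assms(2) Q(1,2)] by simp
    have "\<exists>q. equivalent_fw ?F p q \<and> norm (q u - q v) \<noteq> norm (p u - p v)"
      if "generic V p" for p :: "'a \<Rightarrow> real ^ 'n"
    proof -
      interpret generic_fw V p by unfold_locales (fact assms(1), fact that)
      show ?thesis
        by (rule reflected_framework[OF closure_edges_subset Q(1,2) _ _ nr]) (use uv Q in auto)
    qed
    then show "\<not> weakly_globally_linked TYPE('n) V ?F u v"
      unfolding weakly_globally_linked_def by blast
  qed
  have least: "?F \<subseteq> F'"
    if F': "E \<subseteq> F'" "F' \<subseteq> all_pairs V" "totally_loose TYPE('n) V F'" for F'
  proof
    fix e assume "e \<in> ?F"
    then obtain x y where e: "e = {x, y}" and xy: "x \<in> V" "y \<in> V" "x \<noteq> y" "ns CARD('n) V E x y"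
      unfolding closure_edges_def by blast
    obtain p :: "'a \<Rightarrow> real ^ 'n" where p: "generic V p" using generic_exists[OF assms(1)] by blast
    interpret generic_fw V p by unfold_locales (fact assms(1), fact p)
    have "norm (q x - q y) = norm (p x - p y)" if q: "equivalent_fw F' p q" for q
    proof -
      have "equivalent_fw E p q" using q F'(1) unfolding equivalent_fw_def by blast
      then show ?thesis
        using ns_dist[OF assms(1,3) all_pairs_loopfree[OF assms(2)] assms(4) order_refl _ xy(1,2,4)]
        by blast
    qed
    then have "weakly_globally_linked TYPE('n) V F' x y"
      unfolding weakly_globally_linked_def using p by blast
    then show "e \<in> F'" using F'(3) xy e unfolding totally_loose_def by blast
  qed
  show ?thesis
    unfolding tlc_def
  proof (rule the_equality)
    show "E \<subseteq> ?F \<and> ?F \<subseteq> all_pairs V \<and> totally_loose TYPE('n) V ?F \<and>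
      (\<forall>F'. E \<subseteq> F' \<and> F' \<subseteq> all_pairs V \<and> totally_loose TYPE('n) V F' \<longrightarrow> ?F \<subseteq> F')"
      using subset_closure_edges[OF assms(2)] closure_edges_subset loose least by simp
  next
    fix F assume F: "E \<subseteq> F \<and> F \<subseteq> all_pairs V \<and> totally_loose TYPE('n) V F \<and>
      (\<forall>F'. E \<subseteq> F' \<and> F' \<subseteq> all_pairs V \<and> totally_loose TYPE('n) V F' \<longrightarrow> F \<subseteq> F')"
    show "F = ?F"
    proof
      have "E \<subseteq> ?F \<and> ?F \<subseteq> all_pairs V \<and> totally_loose TYPE('n) V ?F"
        using subset_closure_edges[OF assms(2)] closure_edges_subset loose by simp
      then show "F \<subseteq> ?F" using F by simp
      show "?F \<subseteq> F" by (rule least) (use F in simp_all)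
    qed
  qed
qed

text \<open>As \<open>V\<close> has at least \<open>d + 2\<close> vertices, a smaller set missing
  \<open>u\<close> and \<open>v\<close> can be enlarged to size \<open>d\<close> without containing
  them.\<close>

lemma k_connected_Suc:
  assumes "finite V" "card V \<ge> d + 2"
    and sep: "\<And>Q u v. Q \<subseteq> V \<Longrightarrow> card Q = d \<Longrightarrow> u \<in> V - Q \<Longrightarrow> v \<in> V - Q \<Longrightarrow> reach (V - Q) E u v"
  shows "k_connected (d + 1) V E"
proof -
  have "reach (V - S) E u v" if S: "S \<subseteq> V" "card S < d + 1" and uv: "u \<in> V - S" "v \<in> V - S" for S u v
  proof -
    have fin: "finite (V - {u, v})" using assms(1) by simp
    have "card {u, v} \<le> 2" by (simp add: card_insert_if)
    then have "d \<le> card (V - {u, v})"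
      using diff_card_le_card_Diff[of "{u, v}" V] assms(2) by simp
    moreover have "S \<subseteq> V - {u, v}" "card S \<le> d" using S uv by auto
    ultimately obtain Q where Q: "S \<subseteq> Q" "Q \<subseteq> V - {u, v}" "card Q = d"
      using exists_subset_between[of S d "V - {u, v}"] fin by blast
    have "reach (V - Q) E u v" by (rule sep) (use Q uv in auto)
    then show ?thesis by (rule reach_mono) (use Q in auto)
  qed
  then show ?thesis using assms(2) by (auto simp: k_connected_def connected_on_reach)
qed

theorem theorem8p5:
  fixes V :: "'a set" and E E' :: "'a set set"
  assumes "graph V E"
    and "chordal V E"
    and "k_connected CARD('n::finite) V E"
    and "card V \<ge> CARD('n) + 2"
    and "\<forall>e\<in>E'. \<exists>u v. e = {u, v} \<and> u \<in> V \<and> v \<in> V \<and> u \<noteq> v \<and> {u, v} \<notin> E"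
  shows "(globally_rigid TYPE('n) V (E \<union> E') \<longleftrightarrow> k_connected (CARD('n) + 1) V (E \<union> E')) \<and>
         (k_connected (CARD('n) + 1) V (E \<union> E') \<longleftrightarrow>
           (\<forall>Q \<in> separators CARD('n) V (tlc TYPE('n) V E).
              \<not> cut_vertex (tnodes CARD('n) V (tlc TYPE('n) V E))
                  (tree_plus_adj CARD('n) V (tlc TYPE('n) V E) E') (Inr Q)))"
proof -
  let ?d = "CARD('n)" and ?F = "closure_edges CARD('n) V E"
  have fin: "finite V" and EV: "E \<subseteq> all_pairs V" using assms(1) by (auto simp: graph_def)
  have EE: "E \<union> E' \<subseteq> all_pairs V" 
  proof
    fix e assume "e \<in> E \<union> E'"
    then show "e \<in> all_pairs V"
    proof
      assume "e \<in> E'"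
      then obtain u v where "e = {u, v}" "u \<in> V" "v \<in> V" "u \<noteq> v" using assms(5) by blast
      then show ?thesis unfolding all_pairs_def by blast
    qed (use EV in blast)
  qed
  have d1: "?d \<ge> 1" by (simp add: Suc_leI)
  have tlc: "tlc TYPE('n) V E = ?F" by (rule tlc_eq_closure[OF fin EV assms(2,3)])
  interpret lg: loose_graph V ?F ?d by (rule loose_graph_closure[OF fin EV assms(2,3) d1])
  have cut: "connected_on (V - Q) (E \<union> E') \<longleftrightarrow> \<not> cut_vertex lg.nodes (tree_plus_adj ?d V ?F E') (Inr Q)"
    if Q: "Q \<in> lg.seps" for Q
  proof -
    \<comment> \<open>Off \<open>Q\<close>, edges of G* can be replaced by walks in G; this links
      the tree of G* to the graph \<open>E \<union> E'\<close>.\<close>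
    have Fr: "reach (V - Q) E x y" if "x \<in> V - Q" "y \<in> V - Q" "{x, y} \<in> ?F" for x y
      using closure_reach[OF EV, of Q ?d x y] lg.sepD[OF Q] reach_edge[OF that] by blast
    note sub = subset_closure_edges[OF EV, of ?d]
    show ?thesis
      using lg.connected_imp_not_cut[OF sub Q Fr] lg.not_cut_imp_connected[OF sub Q Fr] by blast
  qed
  have sep_conn: "k_connected (?d + 1) V (E \<union> E') \<longleftrightarrow> (\<forall>Q\<in>lg.seps. connected_on (V - Q) (E \<union> E'))"
  proof
    assume k: "k_connected (?d + 1) V (E \<union> E')"
    then show "\<forall>Q\<in>lg.seps. connected_on (V - Q) (E \<union> E')"
      using lg.sepD by (auto simp: k_connected_def)
  next
    assume c: "\<forall>Q\<in>lg.seps. connected_on (V - Q) (E \<union> E')"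
    show "k_connected (?d + 1) V (E \<union> E')"
    proof (rule k_connected_Suc[OF fin assms(4)])
      fix Q u v assume Q: "Q \<subseteq> V" "card Q = ?d" "u \<in> V - Q" "v \<in> V - Q"
      show "reach (V - Q) (E \<union> E') u v"
      proof (cases "Q \<in> lg.seps")
        case True
        then show ?thesis using c Q by (simp add: connected_on_reach)
      next
        case False
        \<comment> \<open>Off a d-set that is not a separator of G*, the edges of \<open>E\<close>
          alone already connect.\<close>
        then have "reach (V - Q) ?F u v" using lg.sepI Q by blast
        then have "reach (V - Q) E u v" using closure_reach[OF EV Q(1,2)] by simp
        then show ?thesis by (rule reach_mono) auto
      qed
    qed
  qed
  have rigid_conn: "k_connected (?d + 1) V (E \<union> E')" if gr: "globally_rigid TYPE('n) V (E \<union> E')"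
  proof (rule k_connected_Suc[OF fin assms(4)])
    obtain p :: "'a \<Rightarrow> real ^ 'n" where p: "generic V p" "globally_rigid_fw V (E \<union> E') p"
      using gr unfolding globally_rigid_def by blast
    interpret generic_fw V p by unfold_locales (fact fin, fact p(1))
    fix Q u v assume Q: "Q \<subseteq> V" "card Q = ?d" "u \<in> V - Q" "v \<in> V - Q"
    show "reach (V - Q) (E \<union> E') u v"
    proof (rule ccontr)
      assume "\<not> reach (V - Q) (E \<union> E') u v"
      then obtain q where "equivalent_fw (E \<union> E') p q" "norm (q u - q v) \<noteq> norm (p u - p v)"
        using reflected_framework[OF EE Q] by blast
      then show False using p(2) Q unfolding globally_rigid_fw_def congruent_fw_def by fastforce
    qed
  qed
  have conn_rigid: "globally_rigid TYPE('n) V (E \<union> E')" if k: "k_connected (?d + 1) V (E \<union> E')"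
  proof -
    obtain p :: "'a \<Rightarrow> real ^ 'n" where p: "generic V p" using generic_exists[OF fin] by blast
    interpret gf: generic_fw V p by unfold_locales (fact fin, fact p)
    have "congruent_fw V p q" if q: "equivalent_fw (E \<union> E') p q" for q
    proof -
      have D: "norm (q x - q y) = norm (p x - p y)" if "{x, y} \<in> E \<union> E'" for x y
        using q that unfolding equivalent_fw_def by metis
      have qE: "equivalent_fw E p q" using q by (simp add: equivalent_fw_def)
      \<comment> \<open>Equivalence on \<open>E\<close> already preserves all lengths in G*, so the
        clique isometries exist before \<open>E'\<close> is taken into account.\<close>
      interpret loose_framework V ?F p q
      proof
        show "norm (q x - q y) = norm (p x - p y)" if "{x, y} \<in> ?F" for x y
          using that gf.ns_dist[OF fin assms(2) all_pairs_loopfree[OF EV] assms(3) order_refl qE]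
          by (simp add: closure_edges_iff)
      qed
      have "connected_on (V - Q) (E \<union> E')" if "Q \<in> lg.seps" for Q
        using k that sep_conn by blast
      then have "norm (q x - q y) = norm (p x - p y)" if "x \<in> V" "y \<in> V" for x y
        using framework_rigid[OF D _ that] by blast
      then show ?thesis by (simp add: congruent_fw_def)
    qed
    then show ?thesis unfolding globally_rigid_def globally_rigid_fw_def using p by blast
  qed
  show ?thesis
    unfolding tlc using rigid_conn conn_rigid sep_conn cut by blast
qed

end
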